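(* Let $G$ be a finite VZ-group of odd order. Then $c(G)=\mu(G)=q(G)$.
   Context: All groups are finite. A VZ-group is a non-abelian group all of whose nonlinear irreducible complex characters vanish off the center (equivalently, its set of irreducible character degrees is $\{1,|G/Z(G)|^{1/2}\}$). A quasi-permutation matrix is a square complex matrix whose trace is a non-negative integer. $c(G)$ is the minimal degree of a faithful representation of $G$ by complex quasi-permutation matrices; $q(G)$ is the minimal degree of a faithful representation of $G$ by quasi-permutation matrices over $\mathbb{Q}$; $\mu(G)$ is the least positive integer $n$ such that $G$ embeds in the symmetric group $S_n$. *)

theory Defs
  imports
    Complex_Main
    "HOL-Algebra.Sym_Groups"
    "Jordan_Normal_Form.VS_Connect"
begin

definition group_center :: "('a, 'b) monoid_scheme \<Rightarrow> 'a set" where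
  "group_center G = {z \<in> carrier G. \<forall>g \<in> carrier G. z \<otimes>\<^bsub>G\<^esub> g = g \<otimes>\<^bsub>G\<^esub> z}"

abbreviation GL :: "'k::field itself \<Rightarrow> nat \<Rightarrow> 'k mat monoid" where
  "GL ty n \<equiv> units_of (ring_mat ty n ())"

definition matrix_rep ::
  "('a, 'b) monoid_scheme \<Rightarrow> nat \<Rightarrow> ('a \<Rightarrow> 'k::field mat) \<Rightarrow> bool" where
  "matrix_rep G n \<rho> \<longleftrightarrow> n > 0 \<and> \<rho> \<in> hom G (GL TYPE('k) n)"

definition faithful_rep ::
  "('a, 'b) monoid_scheme \<Rightarrow> nat \<Rightarrow> ('a \<Rightarrow> 'k::field mat) \<Rightarrow> bool" where
  "faithful_rep G n \<rho> \<longleftrightarrow> matrix_rep G n \<rho> \<and> inj_on \<rho> (carrier G)"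

definition irreducible_rep ::
  "('a, 'b) monoid_scheme \<Rightarrow> nat \<Rightarrow> ('a \<Rightarrow> 'k::field mat) \<Rightarrow> bool" where
  "irreducible_rep G n \<rho> \<longleftrightarrow> matrix_rep G n \<rho> \<and>
     (\<forall>W. VectorSpace.subspace class_ring W (module_vec TYPE('k) n) \<and>
          (\<forall>g \<in> carrier G. \<forall>w \<in> W. \<rho> g *\<^sub>v w \<in> W)
        \<longrightarrow> W = {0\<^sub>v n} \<or> W = carrier_vec n)"

definition mat_trace :: "'k::comm_monoid_add mat \<Rightarrow> 'k" where
  "mat_trace A = (\<Sum>i < dim_row A. A $$ (i, i))"

definition rep_character :: "('a \<Rightarrow> 'k::field mat) \<Rightarrow> 'a \<Rightarrow> 'k" where
  "rep_character \<rho> g = mat_trace (\<rho> g)"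

text \<open>An irreducible character is the character of an irreducible representation; it is
  nonlinear when the degree of the representation exceeds 1.\<close>

definition VZ_group :: "('a, 'b) monoid_scheme \<Rightarrow> bool" where
  "VZ_group G \<longleftrightarrow> group G \<and> \<not> comm_group G \<and>
     (\<forall>n (\<rho> :: 'a \<Rightarrow> complex mat). irreducible_rep G n \<rho> \<and> n > 1 \<longrightarrow>
        (\<forall>g \<in> carrier G - group_center G. rep_character \<rho> g = 0))"

definition quasi_permutation_mat :: "'k::field_char_0 mat \<Rightarrow> bool" where
  "quasi_permutation_mat A \<longleftrightarrow> square_mat A \<and> mat_trace A \<in> \<nat>"

definition faithful_quasi_perm_rep ::
  "('a, 'b) monoid_scheme \<Rightarrow> nat \<Rightarrow> ('a \<Rightarrow> 'k::field_char_0 mat) \<Rightarrow> bool" where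
  "faithful_quasi_perm_rep G n \<rho> \<longleftrightarrow>
     faithful_rep G n \<rho> \<and> (\<forall>g \<in> carrier G. quasi_permutation_mat (\<rho> g))"

text \<open>For a finite group the sets minimised over below are nonempty: they contain the
  group order, by the regular representation.\<close>

definition c_degree :: "('a, 'b) monoid_scheme \<Rightarrow> nat" where
  "c_degree G = (LEAST n. \<exists>\<rho> :: 'a \<Rightarrow> complex mat. faithful_quasi_perm_rep G n \<rho>)"

definition q_degree :: "('a, 'b) monoid_scheme \<Rightarrow> nat" where
  "q_degree G = (LEAST n. \<exists>\<rho> :: 'a \<Rightarrow> rat mat. faithful_quasi_perm_rep G n \<rho>)"

definition mu_degree :: "('a, 'b) monoid_scheme \<Rightarrow> nat" where
  "mu_degree G = (LEAST n. n > 0 \<and> mon G (sym_group n) \<noteq> {})"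

end

(* If psi is the character of a faithful complex quasi-permutation representation of degree n, it
   suffices to embed G into S_n, since permutation matrices are rational. Comparing the regular
   representation with the irreducible ones shows that commutators of a VZ-group are central.

   Write m(lambda) for the multiplicity in psi of a character lambda of the centre Z. For every prime
   p at which lambda is nontrivial there is a subgroup K whose elements of order p in Z lie in the
   kernel of lambda, and |G:K| <= p^k m(lambda), where p^k is the p-part of the order of lambda. On the
   p-part of G, K is maximal among the subgroups meeting the radical of the form lambda([x,y]) in the
   kernel of an extension of lambda to it; as p is odd, the orthogonal of K is isotropic.

   A minimal set of pairs (lambda, p) that detects all elements of prime order in Z has dual elements,
   whose suitable product z satisfies sum |G:K| <= psi(1) - psi(z) <= n: since psi is rational it is
   constant on Galois classes, and for odd order the sum of 1 - Re(lambda(z)^j) over the units j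
   dominates the sum of the p-parts of the order of lambda. *)
theory Submission
  imports Defs "HOL-Number_Theory.Number_Theory" "Jordan_Normal_Form.Schur_Decomposition"
begin

section \<open>Commutators and groups of class two\<close>

text \<open>The quaternion group of order 8 is a VZ-group with c = 4 and q = mu = 8, so some step
  must fail for the prime 2. It is the isotropy of the orthogonal of K: modulo K that orthogonal has
  at most one subgroup of order p, which forces a p-group to be cyclic only when p is odd.

  A permutation representation of a group of class two is faithful as soon as no central element of
  prime order acts trivially. Hence K has to control elements of order p only, and with pairs
  (lambda, p) each prime is charged just with its own part of the order of lambda: several primes
  contribute a sum of prime powers instead of their product.

  The element z has one value at each lambda, whereas lambda may belong to several pairs. So only
  one dual element per lambda enters z, and the drop 1 - Re(lambda(z)^j) caused by this one prime
  has to pay for all primes paired with lambda. Of the dual elements chosen for other characters,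
  those whose prime is paired with lambda are invisible to lambda; the remaining ones contribute the
  uncontrolled factor w in the inequality.\<close>

definition commut :: "('a, 'b) monoid_scheme \<Rightarrow> 'a \<Rightarrow> 'a \<Rightarrow> 'a" where
  "commut G x y = x \<otimes>\<^bsub>G\<^esub> y \<otimes>\<^bsub>G\<^esub> inv\<^bsub>G\<^esub> x \<otimes>\<^bsub>G\<^esub> inv\<^bsub>G\<^esub> y"

context group
begin

lemma cancel_l1: "x \<in> carrier G \<Longrightarrow> y \<in> carrier G \<Longrightarrow> x \<otimes> (inv x \<otimes> y) = y"
  by (simp add: m_assoc[symmetric])

lemma cancel_l2: "x \<in> carrier G \<Longrightarrow> y \<in> carrier G \<Longrightarrow> inv x \<otimes> (x \<otimes> y) = y"
  by (simp add: m_assoc[symmetric])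

lemma commut_closed [simp]: "x \<in> carrier G \<Longrightarrow> y \<in> carrier G \<Longrightarrow> commut G x y \<in> carrier G"
  by (simp add: commut_def)

lemma commut_mult: "x \<in> carrier G \<Longrightarrow> y \<in> carrier G \<Longrightarrow> commut G x y \<otimes> (y \<otimes> x) = x \<otimes> y"
  by (simp add: commut_def m_assoc cancel_l2)

lemma commut_eqI:
  assumes "x \<in> carrier G" "y \<in> carrier G" "c \<in> carrier G" "c \<otimes> (y \<otimes> x) = x \<otimes> y"
  shows "commut G x y = c"
proof -
  have "c \<otimes> (y \<otimes> x) = commut G x y \<otimes> (y \<otimes> x)"
    using assms by (simp add: commut_mult)
  then show ?thesis using assms by (subst (asm) right_cancel) auto
qed

lemma commut_eq_one_iff:
  assumes "x \<in> carrier G" "y \<in> carrier G"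
  shows "commut G x y = \<one> \<longleftrightarrow> x \<otimes> y = y \<otimes> x"
  using commut_mult[OF assms] commut_eqI[OF assms, of \<one>] assms by auto

lemma inv_commut:
  assumes "x \<in> carrier G" "y \<in> carrier G"
  shows "inv (commut G x y) = commut G y x"
  using assms by (simp add: commut_def inv_mult_group m_assoc)

lemma conj_eq_commut_mult:
  assumes "x \<in> carrier G" "y \<in> carrier G"
  shows "x \<otimes> y \<otimes> inv x = commut G x y \<otimes> y"
  using assms by (simp add: commut_def m_assoc)

text \<open>Inverses are powers: \<open>inv x\<close> equals \<open>x\<close> raised to the group
  order minus one.\<close>

lemma finite_subgroupI:
  assumes "finite (carrier G)" "H \<subseteq> carrier G" "\<one> \<in> H"
    and m: "\<And>x y. x \<in> H \<Longrightarrow> y \<in> H \<Longrightarrow> x \<otimes> y \<in> H"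
  shows "subgroup H G"
proof
  fix x assume x: "x \<in> H"
  then have xc: "x \<in> carrier G" using assms by auto
  have p: "x [^] n \<in> H" for n :: nat
    by (induction n) (auto simp: assms(3) m x)
  have "x [^] (Coset.order G - 1) \<otimes> x = x [^] (Coset.order G)"
    using order_gt_0_iff_finite assms(1) by (simp flip: nat_pow_Suc)
  also have "\<dots> = \<one>" using pow_order_eq_1[OF xc] by simp
  finally have "inv x = x [^] (Coset.order G - 1)"
    using xc by (metis inv_equality nat_pow_closed)
  then show "inv x \<in> H" using p by simp
qed (use assms in auto)

lemma subgroup_pow_closed: "subgroup H G \<Longrightarrow> x \<in> H \<Longrightarrow> x [^] (n::nat) \<in> H"
  by (induction n) (auto simp: subgroup.one_closed subgroup.m_closed)

lemma subgroup_commut_closed: "subgroup H G \<Longrightarrow> x \<in> H \<Longrightarrow> y \<in> H \<Longrightarrow> commut G x y \<in> H"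
  by (simp add: commut_def subgroup.m_closed subgroup.m_inv_closed)

text \<open>Elements with the same value under \<open>f\<close> lie in one right translate of
  \<open>N\<close>, so each fibre has at most \<open>card N\<close> elements. This half of the
  isomorphism theorem supplies the bounds on subgroup orders.\<close>

lemma card_le_card_fibres:
  assumes A: "subgroup A G" and "finite N" "finite X" "f ` A \<subseteq> X"
    and fib: "\<And>x y. x \<in> A \<Longrightarrow> y \<in> A \<Longrightarrow> f x = f y \<Longrightarrow> x \<otimes> inv y \<in> N"
    and fin: "finite A"
  shows "card A \<le> card X * card N"
proof -
  have 1: "card {x \<in> A. f x = v} \<le> card N" for v
  proof (cases "{x \<in> A. f x = v} = {}")
    case True then show ?thesis by (metis card.empty le0)
  next
    case False
    then obtain y where y: "y \<in> A" "f y = v" by auto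
    have sub: "A \<subseteq> carrier G" using A by (rule subgroup.subset)
    have "inj_on (\<lambda>x. x \<otimes> inv y) {x \<in> A. f x = v}"
      using sub y by (auto simp: inj_on_def subset_iff)
    moreover have "(\<lambda>x. x \<otimes> inv y) ` {x \<in> A. f x = v} \<subseteq> N" using fib y by auto
    ultimately show ?thesis by (rule card_inj_on_le) (fact \<open>finite N\<close>)
  qed
  have "card A = (\<Sum>v\<in>f ` A. card {x \<in> A. f x = v})"
    using sum.image_gen[OF fin, of "\<lambda>_. 1::nat" f] by simp
  also have "\<dots> \<le> (\<Sum>v\<in>f ` A. card N)" by (intro sum_mono 1)
  also have "\<dots> = card (f ` A) * card N" by simp
  also have "\<dots> \<le> card X * card N" using assms by (intro mult_right_mono card_mono) auto
  finally show ?thesis .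
qed

end

section \<open>Groups of nilpotency class at most two\<close>

locale class2_group = group +
  assumes commut_central:
    "\<lbrakk>x \<in> carrier G; y \<in> carrier G; z \<in> carrier G\<rbrakk> \<Longrightarrow> commut G x y \<otimes> z = z \<otimes> commut G x y"
begin

lemma commut_mult_left:
  assumes [simp]: "x \<in> carrier G" "y \<in> carrier G" "z \<in> carrier G"
  shows "commut G (x \<otimes> y) z = commut G x z \<otimes> commut G y z"
proof (rule commut_eqI)
  have "commut G x z \<otimes> commut G y z \<otimes> (z \<otimes> (x \<otimes> y)) = commut G y z \<otimes> (commut G x z \<otimes> (z \<otimes> x)) \<otimes> y"
    using commut_central[of x z "commut G y z"] by (simp add: m_assoc[symmetric])
  also have "\<dots> = commut G y z \<otimes> x \<otimes> (z \<otimes> y)"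
    by (simp add: commut_mult) (simp add: m_assoc)
  also have "\<dots> = x \<otimes> (commut G y z \<otimes> (z \<otimes> y))"
    using commut_central[of y z x] by (simp add: m_assoc)
  also have "\<dots> = x \<otimes> y \<otimes> z" by (simp add: commut_mult m_assoc)
  finally show "commut G x z \<otimes> commut G y z \<otimes> (z \<otimes> (x \<otimes> y)) = x \<otimes> y \<otimes> z" .
qed simp_all

lemma commut_mult_right:
  assumes [simp]: "x \<in> carrier G" "y \<in> carrier G" "z \<in> carrier G"
  shows "commut G z (x \<otimes> y) = commut G z x \<otimes> commut G z y"
proof -
  have "commut G z (x \<otimes> y) = inv (commut G (x \<otimes> y) z)" by (simp add: inv_commut)
  also have "\<dots> = inv (commut G y z) \<otimes> inv (commut G x z)"
    by (simp add: commut_mult_left inv_mult_group)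
  also have "\<dots> = commut G z x \<otimes> commut G z y"
    using commut_central[of z y "commut G z x"] by (simp add: inv_commut)
  finally show ?thesis .
qed

lemma commut_one [simp]: "x \<in> carrier G \<Longrightarrow> commut G \<one> x = \<one>" "x \<in> carrier G \<Longrightarrow> commut G x \<one> = \<one>"
  "x \<in> carrier G \<Longrightarrow> commut G x x = \<one>"
  by (auto simp: commut_eq_one_iff)

lemma commut_pow_left:
  assumes "x \<in> carrier G" "y \<in> carrier G"
  shows "commut G (x [^] (n::nat)) y = commut G x y [^] n"
  using assms by (induction n) (auto simp: commut_mult_left)

lemma commut_pow_central:
  assumes [simp]: "x \<in> carrier G" "y \<in> carrier G" "z \<in> carrier G"
  shows "commut G x y [^] (k::nat) \<otimes> z = z \<otimes> commut G x y [^] k"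
proof (induction k)
  case (Suc k)
  have "commut G x y [^] Suc k \<otimes> z = (commut G x y [^] k \<otimes> z) \<otimes> commut G x y"
    using commut_central[of x y z] by (simp add: m_assoc)
  then show ?case by (simp add: Suc m_assoc)
qed simp

text \<open>Sorting the factors moves every \<open>x\<close> to the left past all earlier
  \<open>y\<close>, and each such exchange costs one central commutator; the number of exchanges is
  the binomial coefficient.\<close>

lemma mult_pow:
  assumes [simp]: "x \<in> carrier G" "y \<in> carrier G"
  shows "(x \<otimes> y) [^] (n::nat) = commut G y x [^] (n * (n - 1) div 2) \<otimes> (x [^] n \<otimes> y [^] n)"
proof (induction n)
  case 0 then show ?case by simp
next
  case (Suc n)
  let ?c = "commut G y x"
  have "even (n * (n - 1))" by (cases n) auto
  then have e: "Suc n * (Suc n - 1) div 2 = n * (n - 1) div 2 + n"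
    by (cases n) auto
  have c: "y [^] n \<otimes> x = ?c [^] n \<otimes> (x \<otimes> y [^] n)"
    using commut_mult[of "y [^] n" x] by (simp add: commut_pow_left)
  have cc: "?c [^] k \<otimes> z = z \<otimes> ?c [^] k" if "z \<in> carrier G" for z and k :: nat
    using that by (simp add: commut_pow_central)
  have "(x \<otimes> y) [^] Suc n = ?c [^] (n * (n - 1) div 2) \<otimes> (x [^] n \<otimes> (y [^] n \<otimes> x) \<otimes> y)"
    using Suc by (simp add: m_assoc)
  also have "x [^] n \<otimes> (y [^] n \<otimes> x) \<otimes> y = x [^] n \<otimes> ?c [^] n \<otimes> (x \<otimes> y [^] n \<otimes> y)"
    by (simp add: c m_assoc)
  also have "x [^] n \<otimes> ?c [^] n = ?c [^] n \<otimes> x [^] n" by (simp add: cc)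
  finally show ?case unfolding e by (simp add: nat_pow_mult[symmetric] m_assoc)
qed

end

section \<open>Linear characters of subgroups and their extensions\<close>

lemma cis_root_power_neq_1:
  assumes "0 < i" "i < n"
  shows "cis (2 * pi / real n) ^ i \<noteq> 1"
proof
  assume "cis (2 * pi / real n) ^ i = 1"
  then have "cis (2 * pi * real i / real n) = cis (2 * pi * real 0 / real n)"
    by (simp add: Complex.DeMoivre mult_ac)
  moreover have "inj_on (\<lambda>k. cis (2 * pi * real k / real n)) {..<n}"
    using bij_betw_roots_unity[of n] assms by (auto dest: bij_betw_imp_inj_on)
  ultimately have "i = 0" using assms by (auto dest!: inj_onD[where x = i and y = 0])
  then show False using assms by simp
qed

lemma cis_root_power_n: "n > 0 \<Longrightarrow> cis (2 * pi / real n) ^ n = 1"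
  by (simp add: Complex.DeMoivre)

text \<open>Multiplication by a primitive n-th root of unity permutes the solutions of
  \<open>c ^ n = w\<close> and multiplies the sum by a factor that differs from 1 for
  \<open>0 < i < n\<close>.\<close>

lemma sum_power_nth_roots:
  fixes w :: complex
  assumes "w \<noteq> 0" "i < n"
  shows "(\<Sum>c | c ^ n = w. c ^ i) = (if i = 0 then of_nat n else 0)"
proof (cases "i = 0")
  case True then show ?thesis using assms by (simp add: card_nth_roots)
next
  case False
  let ?z = "cis (2 * pi / real n)"
  have zn: "?z ^ n = 1" "?z \<noteq> 0" using assms by (auto simp: cis_root_power_n)
  have "bij_betw (\<lambda>c. ?z * c) {c. c ^ n = w} {c. c ^ n = w}"
    by (rule bij_betw_byWitness[of _ "\<lambda>c. c / ?z"]) (auto simp: power_mult_distrib power_divide zn)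
  then have "(\<Sum>c | c ^ n = w. c ^ i) = (\<Sum>c | c ^ n = w. (?z * c) ^ i)"
    by (rule sum.reindex_bij_betw[symmetric])
  also have "\<dots> = ?z ^ i * (\<Sum>c | c ^ n = w. c ^ i)"
    by (simp add: power_mult_distrib sum_distrib_left)
  finally have "(1 - ?z ^ i) * (\<Sum>c | c ^ n = w. c ^ i) = 0" by (simp add: algebra_simps)
  then show ?thesis using False cis_root_power_neq_1[of i n] assms by auto
qed

text \<open>The value 0 outside \<open>H\<close> makes two characters equal as functions once they
  agree on \<open>H\<close>, so that sets of characters can be counted.\<close>

definition lin_chars :: "('a, 'b) monoid_scheme \<Rightarrow> 'a set \<Rightarrow> ('a \<Rightarrow> complex) set" where
  "lin_chars G H = {\<chi>. (\<forall>x\<in>H. \<forall>y\<in>H. \<chi> (x \<otimes>\<^bsub>G\<^esub> y) = \<chi> x * \<chi> y) \<and> \<chi> \<one>\<^bsub>G\<^esub> = 1 \<and> (\<forall>x. x \<notin> H \<longrightarrow> \<chi> x = 0)}"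

definition ext_chars :: "('a, 'b) monoid_scheme \<Rightarrow> 'a set \<Rightarrow> ('a \<Rightarrow> complex) \<Rightarrow> 'a set \<Rightarrow> ('a \<Rightarrow> complex) set" where
  "ext_chars G A \<alpha> B = {\<chi> \<in> lin_chars G B. \<forall>a\<in>A. \<chi> a = \<alpha> a}"

text \<open>The normalised inner product of \<open>f\<close> and \<open>\<chi>\<close> over
  \<open>H\<close>. If \<open>f\<close> is the character of a representation, it is the multiplicity
  of \<open>\<chi>\<close> in the restriction to \<open>H\<close>.\<close>

definition char_mult :: "('a \<Rightarrow> complex) \<Rightarrow> 'a set \<Rightarrow> ('a \<Rightarrow> complex) \<Rightarrow> complex" where
  "char_mult f H \<chi> = (\<Sum>h\<in>H. f h * cnj (\<chi> h)) / of_nat (card H)"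

lemma lin_chars_mult: "\<chi> \<in> lin_chars G H \<Longrightarrow> x \<in> H \<Longrightarrow> y \<in> H \<Longrightarrow> \<chi> (x \<otimes>\<^bsub>G\<^esub> y) = \<chi> x * \<chi> y"
  and lin_chars_one: "\<chi> \<in> lin_chars G H \<Longrightarrow> \<chi> \<one>\<^bsub>G\<^esub> = 1"
  and lin_chars_outside: "\<chi> \<in> lin_chars G H \<Longrightarrow> x \<notin> H \<Longrightarrow> \<chi> x = 0"
  by (auto simp: lin_chars_def)

lemma lin_chars_eqI:
  assumes "\<chi> \<in> lin_chars G H" "\<chi>' \<in> lin_chars G H" "\<And>x. x \<in> H \<Longrightarrow> \<chi> x = \<chi>' x"
  shows "\<chi> = \<chi>'"
  using assms by (metis ext lin_chars_outside)

lemma lin_chars_power: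
  assumes "\<chi> \<in> lin_chars G H" "j > 0"
  shows "(\<lambda>x. \<chi> x ^ j) \<in> lin_chars G H"
  using assms by (auto simp: lin_chars_def power_mult_distrib)

context group
begin

lemma lin_chars_inv:
  assumes "subgroup H G" "\<chi> \<in> lin_chars G H" "x \<in> H"
  shows "\<chi> x * \<chi> (inv x) = 1"
  using lin_chars_mult[OF assms(2,3), of "inv x"] lin_chars_one[OF assms(2)] assms
  by (simp add: subgroup.m_inv_closed subgroup.mem_carrier)

lemma lin_chars_nonzero: "subgroup H G \<Longrightarrow> \<chi> \<in> lin_chars G H \<Longrightarrow> x \<in> H \<Longrightarrow> \<chi> x \<noteq> 0"
  using lin_chars_inv by fastforce

lemma lin_chars_inv_eq: "subgroup H G \<Longrightarrow> \<chi> \<in> lin_chars G H \<Longrightarrow> x \<in> H \<Longrightarrow> \<chi> (inv x) = inverse (\<chi> x)"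
  using lin_chars_inv by (metis inverse_unique)

lemma lin_chars_pow:
  assumes "subgroup H G" "\<chi> \<in> lin_chars G H" "x \<in> H"
  shows "\<chi> (x [^] (n::nat)) = \<chi> x ^ n"
  using assms by (induction n) (auto simp: lin_chars_one lin_chars_mult subgroup_pow_closed)

lemma lin_chars_norm:
  assumes "subgroup H G" "\<chi> \<in> lin_chars G H" "x \<in> H" "finite (carrier G)"
  shows "norm (\<chi> x) = 1"
proof -
  have "\<chi> x ^ Coset.order G = 1"
    using lin_chars_pow[OF assms(1-3), of "Coset.order G"] lin_chars_one[OF assms(2)]
      pow_order_eq_1 subgroup.mem_carrier[OF assms(1,3)] by simp
  moreover have "Coset.order G > 0" using assms order_gt_0_iff_finite by simp
  ultimately show ?thesis using power_eq_1_iff[of "\<chi> x" "Coset.order G"] by simp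
qed

lemma lin_chars_cnj:
  assumes "subgroup H G" "\<chi> \<in> lin_chars G H" "x \<in> H" "finite (carrier G)"
  shows "\<chi> x * cnj (\<chi> x) = 1"
  using lin_chars_norm[OF assms] by (simp add: complex_norm_square[symmetric])

lemma lin_chars_subgroup:
  assumes "\<chi> \<in> lin_chars G B" "subgroup A G" "A \<subseteq> B"
  shows "(\<lambda>x. if x \<in> A then \<chi> x else 0) \<in> lin_chars G A"
  using assms by (auto simp: lin_chars_def subgroup.m_closed subgroup.one_closed subset_iff)

end

section \<open>Extension of a linear character by one further element\<close>

definition adjoin :: "('a, 'b) monoid_scheme \<Rightarrow> 'a set \<Rightarrow> 'a \<Rightarrow> 'a set" where
  "adjoin G A x = {a \<otimes>\<^bsub>G\<^esub> x [^]\<^bsub>G\<^esub> (i::nat) | a i. a \<in> A}"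

text \<open>By \<open>comm\<close> the commutators of \<open>B\<close> lie in the kernel of
  \<open>\<alpha>\<close>. Hence \<open>B\<close> normalises \<open>A\<close> and fixes
  \<open>\<alpha>\<close> under conjugation, which is what makes the extension to \<open>A\<close>
  and \<open>x\<close> possible.\<close>

locale char_step = group +
  fixes A B \<alpha> x
  assumes fin: "finite (carrier G)" and A: "subgroup A G" and B: "subgroup B G" and AB: "A \<subseteq> B"
    and \<alpha>: "\<alpha> \<in> lin_chars G A"
    and comm: "\<And>b c. b \<in> B \<Longrightarrow> c \<in> B \<Longrightarrow> commut G b c \<in> A \<and> \<alpha> (commut G b c) = 1"
    and xB: "x \<in> B"
begin

abbreviation "A1 \<equiv> adjoin G A x"

lemma Ac: "a \<in> A \<Longrightarrow> a \<in> carrier G" and Bc: "b \<in> B \<Longrightarrow> b \<in> carrier G"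
  using subgroup.mem_carrier[OF A] subgroup.mem_carrier[OF B] by auto

lemma xc [simp]: "x \<in> carrier G" using xB Bc by auto

lemma conj_A:
  assumes "b \<in> B" "a \<in> A"
  shows "b \<otimes> a \<otimes> inv b \<in> A" "\<alpha> (b \<otimes> a \<otimes> inv b) = \<alpha> a"
proof -
  have "b \<otimes> a \<otimes> inv b = commut G b a \<otimes> a"
    using assms Ac Bc by (simp add: conj_eq_commut_mult)
  moreover have "commut G b a \<in> A" "\<alpha> (commut G b a) = 1" using comm assms AB by auto
  ultimately show "b \<otimes> a \<otimes> inv b \<in> A" "\<alpha> (b \<otimes> a \<otimes> inv b) = \<alpha> a"
    using assms A \<alpha> by (auto simp: subgroup.m_closed lin_chars_mult)
qed

lemma adjoin_mult:
  assumes "a \<in> A" "b \<in> A"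
  shows "\<exists>b'\<in>A. \<alpha> b' = \<alpha> b \<and> (a \<otimes> x [^] i) \<otimes> (b \<otimes> x [^] j) = (a \<otimes> b') \<otimes> x [^] (i + j :: nat)"
proof (intro bexI conjI)
  let ?b = "x [^] i \<otimes> b \<otimes> inv (x [^] i)"
  have xi: "x [^] i \<in> B" using xB B by (simp add: subgroup_pow_closed)
  show "?b \<in> A" "\<alpha> ?b = \<alpha> b" using conj_A[OF xi] assms by auto
  show "(a \<otimes> x [^] i) \<otimes> (b \<otimes> x [^] j) = (a \<otimes> ?b) \<otimes> x [^] (i + j)"
    using assms Ac by (simp add: m_assoc nat_pow_mult[symmetric] cancel_l2)
qed

lemma A_sub_A1: "A \<subseteq> A1"
proof
  fix a assume "a \<in> A"
  then have "a = a \<otimes> x [^] (0::nat)" using Ac by simp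
  then show "a \<in> A1" using \<open>a \<in> A\<close> unfolding adjoin_def by blast
qed

lemma x_in_A1: "x \<in> A1"
proof -
  have "x = \<one> \<otimes> x [^] (1::nat)" by simp
  then show ?thesis using subgroup.one_closed[OF A] unfolding adjoin_def by blast
qed

lemma A1_sub_B: "A1 \<subseteq> B"
  using AB xB B by (auto simp: adjoin_def intro!: subgroup.m_closed subgroup_pow_closed)

lemma A1_subgroup: "subgroup A1 G"
proof (rule finite_subgroupI[OF fin])
  show "A1 \<subseteq> carrier G" using A1_sub_B Bc by auto
  show "\<one> \<in> A1" using A_sub_A1 subgroup.one_closed[OF A] by auto
next
  fix y z assume "y \<in> A1" "z \<in> A1"
  then obtain a b i j where ab: "a \<in> A" "b \<in> A" "y = a \<otimes> x [^] (i::nat)" "z = b \<otimes> x [^] (j::nat)"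
    by (auto simp: adjoin_def)
  then obtain b' where "b' \<in> A" "y \<otimes> z = (a \<otimes> b') \<otimes> x [^] (i + j)"
    using adjoin_mult by blast
  then show "y \<otimes> z \<in> A1" using ab A unfolding adjoin_def by (auto intro!: subgroup.m_closed)
qed

definition "n = (LEAST n. n > 0 \<and> x [^] (n::nat) \<in> A)"

lemma n: "n > 0" "x [^] n \<in> A"
proof -
  have "Coset.order G > 0 \<and> x [^] Coset.order G \<in> A"
    using fin order_gt_0_iff_finite pow_order_eq_1[of x] subgroup.one_closed[OF A] by simp
  then have "n > 0 \<and> x [^] n \<in> A" unfolding n_def by (rule LeastI)
  then show "n > 0" "x [^] n \<in> A" by auto
qed

lemma n_least: "0 < i \<Longrightarrow> x [^] (i::nat) \<in> A \<Longrightarrow> n \<le> i"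
  unfolding n_def by (rule Least_le) auto

lemma pow_in_A:
  assumes "x [^] (d::nat) \<in> A"
  shows "n dvd d" "c ^ n = \<alpha> (x [^] n) \<Longrightarrow> \<alpha> (x [^] d) = c ^ d"
proof -
  let ?q = "d div n" and ?r = "d mod n"
  have q: "(x [^] n) [^] ?q \<in> A" using n A by (simp add: subgroup_pow_closed)
  have eq: "x [^] d = (x [^] n) [^] ?q \<otimes> x [^] ?r"
    by (simp add: nat_pow_pow nat_pow_mult)
  then have "x [^] ?r = inv ((x [^] n) [^] ?q) \<otimes> x [^] d"
    by (simp add: cancel_l2)
  also have "\<dots> \<in> A" using q assms A by (simp add: subgroup.m_closed subgroup.m_inv_closed)
  finally have "x [^] ?r \<in> A" .
  then have "?r = 0" using n_least[of ?r] n by (metis mod_less_divisor not_gr_zero not_less)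
  then show dvd: "n dvd d" by auto
  assume c: "c ^ n = \<alpha> (x [^] n)"
  have "\<alpha> (x [^] d) = \<alpha> (x [^] n) ^ ?q"
    using eq \<open>?r = 0\<close> lin_chars_pow[OF A \<alpha> n(2)] by simp
  also have "\<dots> = c ^ d" using dvd by (simp add: c[symmetric] power_mult[symmetric])
  finally show "\<alpha> (x [^] d) = c ^ d" .
qed

lemma adjoin_eq_imp:
  assumes "a \<in> A" "b \<in> A" "a \<otimes> x [^] (i::nat) = b \<otimes> x [^] (j::nat)" "i \<le> j"
  shows "x [^] (j - i) \<in> A" "a = b \<otimes> x [^] (j - i)"
proof -
  have "b \<otimes> x [^] j = (b \<otimes> x [^] (j - i)) \<otimes> x [^] i"
    using assms Ac by (simp add: m_assoc nat_pow_mult)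
  then show *: "a = b \<otimes> x [^] (j - i)" using assms Ac by simp
  then have "x [^] (j - i) = inv b \<otimes> a" using assms Ac by (simp add: cancel_l2)
  then show "x [^] (j - i) \<in> A" using assms A by (simp add: subgroup.m_closed subgroup.m_inv_closed)
qed

lemma adjoin_bij: "bij_betw (\<lambda>(a, i). a \<otimes> x [^] i) (A \<times> {..<n}) A1"
proof (rule bij_betw_imageI)
  have *: "a = b \<and> i = j" if "a \<in> A" "b \<in> A" "i \<le> j" "j < n" "a \<otimes> x [^] i = b \<otimes> x [^] j" for a b i j
  proof -
    have "j - i = 0"
      using adjoin_eq_imp[OF that(1,2,5,3)] n_least[of "j - i"] that by fastforce
    then show ?thesis using adjoin_eq_imp[OF that(1,2,5,3)] that Ac by simp
  qed
  show "inj_on (\<lambda>(a, i). a \<otimes> x [^] i) (A \<times> {..<n})"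
  proof (rule inj_onI, clarsimp)
    fix a b i j assume "a \<in> A" "b \<in> A" "i < n" "j < n" "a \<otimes> x [^] i = b \<otimes> x [^] j"
    then show "a = b \<and> i = j" using *[of a b i j] *[of b a j i] by (cases "i \<le> j") auto
  qed
  show "(\<lambda>(a, i). a \<otimes> x [^] i) ` (A \<times> {..<n}) = A1"
  proof (intro equalityI subsetI)
    fix y assume "y \<in> A1"
    then obtain a i where a: "a \<in> A" "y = a \<otimes> x [^] (i::nat)" by (auto simp: adjoin_def)
    have q: "(x [^] n) [^] (i div n) \<in> A" using n A by (simp add: subgroup_pow_closed)
    have "x [^] i = (x [^] n) [^] (i div n) \<otimes> x [^] (i mod n)"
      by (simp add: nat_pow_pow nat_pow_mult)
    then have "y = (a \<otimes> (x [^] n) [^] (i div n)) \<otimes> x [^] (i mod n)"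
      using a Ac q by (simp add: m_assoc)
    moreover have "a \<otimes> (x [^] n) [^] (i div n) \<in> A" using a q A by (simp add: subgroup.m_closed)
    ultimately show "y \<in> (\<lambda>(a, i). a \<otimes> x [^] i) ` (A \<times> {..<n})" using n by force
  qed (auto simp: adjoin_def)
qed

text \<open>As \<open>n\<close> is the least positive exponent with a power of \<open>x\<close> in
  \<open>A\<close>, all relations between powers of \<open>x\<close> and \<open>A\<close> follow
  from the single one for \<open>x [^] n\<close>. The equation for \<open>c\<close> is therefore the
  only constraint on the value at \<open>x\<close>.\<close>

lemma ext_char_exists:
  assumes c: "c ^ n = \<alpha> (x [^] n)"
  shows "\<exists>\<chi>\<in>ext_chars G A \<alpha> A1. \<chi> x = c"
proof -
  have c0: "c \<noteq> 0" using c n lin_chars_nonzero[OF A \<alpha> n(2)] by (metis power_eq_0_iff)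
  define \<chi> where "\<chi> y = (if y \<in> A1 then THE v. \<exists>a\<in>A. \<exists>i::nat. y = a \<otimes> x [^] i \<and> v = \<alpha> a * c ^ i else 0)" for y
  \<comment> \<open>Two expressions of one element differ by a power of \<open>x\<close> that lies
    in \<open>A\<close>; the order of the exponents keeps this power natural.\<close>
  have wd: "\<alpha> a * c ^ i = \<alpha> b * c ^ j"
    if "a \<in> A" "b \<in> A" "a \<otimes> x [^] i = b \<otimes> x [^] j" "i \<le> j" for a b i j
  proof -
    have "x [^] (j - i) \<in> A" "a = b \<otimes> x [^] (j - i)" using adjoin_eq_imp[OF that] by auto
    then have "\<alpha> a = \<alpha> b * c ^ (j - i)"
      using that pow_in_A(2)[OF _ c] lin_chars_mult[OF \<alpha>] by simp
    then show ?thesis using that by (simp flip: power_add)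
  qed
  have \<chi>: "\<chi> (a \<otimes> x [^] i) = \<alpha> a * c ^ i" if "a \<in> A" for a and i :: nat
  proof -
    have "a \<otimes> x [^] i \<in> A1" using that by (auto simp: adjoin_def)
    moreover have "(THE v. \<exists>b\<in>A. \<exists>j::nat. a \<otimes> x [^] i = b \<otimes> x [^] j \<and> v = \<alpha> b * c ^ j) = \<alpha> a * c ^ i"
    proof (rule the_equality)
      fix v assume "\<exists>b\<in>A. \<exists>j::nat. a \<otimes> x [^] i = b \<otimes> x [^] j \<and> v = \<alpha> b * c ^ j"
      then obtain b j where "b \<in> A" "a \<otimes> x [^] i = b \<otimes> x [^] (j::nat)" "v = \<alpha> b * c ^ j" by auto
      then show "v = \<alpha> a * c ^ i" using wd[of a b i j] wd[of b a j i] that by (cases "i \<le> j") auto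
    qed (use that in auto)
    ultimately show ?thesis by (simp add: \<chi>_def)
  qed
  have \<chi>A: "\<chi> a = \<alpha> a" if "a \<in> A" for a using \<chi>[OF that, of 0] that Ac by simp
  have "\<chi> (y \<otimes> z) = \<chi> y * \<chi> z" if yz: "y \<in> A1" "z \<in> A1" for y z
  proof -
    obtain a b i j where ab: "a \<in> A" "b \<in> A" "y = a \<otimes> x [^] (i::nat)" "z = b \<otimes> x [^] (j::nat)"
      using yz unfolding adjoin_def by blast
    then obtain b' where b': "b' \<in> A" "\<alpha> b' = \<alpha> b" "y \<otimes> z = (a \<otimes> b') \<otimes> x [^] (i + j)"
      using adjoin_mult by blast
    then show ?thesis
      using ab A by (simp add: \<chi> subgroup.m_closed lin_chars_mult[OF \<alpha>] power_add)
  qed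
  moreover have "\<chi> \<one> = 1" using \<chi>A subgroup.one_closed[OF A] lin_chars_one[OF \<alpha>] by simp
  ultimately have "\<chi> \<in> ext_chars G A \<alpha> A1"
    using \<chi>A by (auto simp: ext_chars_def lin_chars_def \<chi>_def)
  moreover have "\<chi> x = c" using \<chi>[OF subgroup.one_closed[OF A], of 1] lin_chars_one[OF \<alpha>] by simp
  ultimately show ?thesis by blast
qed

lemma ext_char_value:
  assumes "\<chi> \<in> ext_chars G A \<alpha> A1" "a \<in> A"
  shows "\<chi> (a \<otimes> x [^] (i::nat)) = \<alpha> a * \<chi> x ^ i"
proof -
  have \<chi>: "\<chi> \<in> lin_chars G A1" "\<chi> a = \<alpha> a" using assms by (auto simp: ext_chars_def)
  have "x [^] i \<in> A1" using x_in_A1 A1_subgroup by (simp add: subgroup_pow_closed)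
  then show ?thesis
    using lin_chars_mult[OF \<chi>(1)] A_sub_A1 assms lin_chars_pow[OF A1_subgroup \<chi>(1) x_in_A1] \<chi> by auto
qed

lemma ext_char_bij: "bij_betw (\<lambda>\<chi>. \<chi> x) (ext_chars G A \<alpha> A1) {c. c ^ n = \<alpha> (x [^] n)}"
proof (rule bij_betw_imageI)
  show "inj_on (\<lambda>\<chi>. \<chi> x) (ext_chars G A \<alpha> A1)"
  proof (rule inj_onI)
    fix \<chi> \<chi>' assume *: "\<chi> \<in> ext_chars G A \<alpha> A1" "\<chi>' \<in> ext_chars G A \<alpha> A1" "\<chi> x = \<chi>' x"
    show "\<chi> = \<chi>'"
    proof (rule lin_chars_eqI[of _ G A1])
      fix y assume "y \<in> A1"
      then obtain a i where "a \<in> A" "y = a \<otimes> x [^] (i::nat)" by (auto simp: adjoin_def)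
      then show "\<chi> y = \<chi>' y" using ext_char_value[OF *(1)] ext_char_value[OF *(2)] *(3) by simp
    qed (use * in \<open>auto simp: ext_chars_def\<close>)
  qed
  show "(\<lambda>\<chi>. \<chi> x) ` ext_chars G A \<alpha> A1 = {c. c ^ n = \<alpha> (x [^] n)}"
  proof (intro equalityI subsetI)
    fix c assume "c \<in> (\<lambda>\<chi>. \<chi> x) ` ext_chars G A \<alpha> A1"
    then obtain \<chi> where \<chi>: "\<chi> \<in> ext_chars G A \<alpha> A1" "c = \<chi> x" by auto
    then have "\<chi> (x [^] n) = \<chi> x ^ n"
      using lin_chars_pow[OF A1_subgroup _ x_in_A1] by (auto simp: ext_chars_def)
    then show "c \<in> {c. c ^ n = \<alpha> (x [^] n)}" using \<chi> n by (auto simp: ext_chars_def)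
  qed (use ext_char_exists in force)
qed

lemma finite_ext_step: "finite (ext_chars G A \<alpha> A1)"
  using bij_betw_finite[OF ext_char_bij] finite_nth_roots[of n "\<alpha> (x [^] n)"] n by simp

text \<open>An extension is determined by its value at \<open>x\<close>, which runs through all n-th
  roots of \<open>\<alpha> (x [^] n)\<close>. Summing over these roots cancels the cosets of
  \<open>A\<close> by \<open>x [^] i\<close> with \<open>0 < i < n\<close> and multiplies the part
  over \<open>A\<close> by \<open>n\<close>, the index of \<open>A\<close> in
  \<open>A1\<close>.\<close>

lemma sum_ext_step: "(\<Sum>\<chi>\<in>ext_chars G A \<alpha> A1. char_mult f A1 \<chi>) = char_mult f A \<alpha>"
proof -
  let ?E = "ext_chars G A \<alpha> A1" and ?C = "{c. c ^ n = \<alpha> (x [^] n)}"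
  have fA: "finite A" using finite_subset[OF subgroup.subset[OF A] fin] .
  have card: "card A1 = card A * n"
    using bij_betw_same_card[OF adjoin_bij] by (simp add: card_cartesian_product)
  have a0: "\<alpha> (x [^] n) \<noteq> 0" using lin_chars_nonzero[OF A \<alpha> n(2)] .
  have "(\<Sum>\<chi>\<in>?E. \<Sum>h\<in>A1. f h * cnj (\<chi> h)) = (\<Sum>\<chi>\<in>?E. \<Sum>(a, i)\<in>A \<times> {..<n}. f (a \<otimes> x [^] i) * cnj (\<chi> (a \<otimes> x [^] i)))"
    by (intro sum.cong refl) (simp add: sum.reindex_bij_betw[OF adjoin_bij, symmetric] case_prod_unfold)
  also have "\<dots> = (\<Sum>\<chi>\<in>?E. \<Sum>(a, i)\<in>A \<times> {..<n}. f (a \<otimes> x [^] i) * cnj (\<alpha> a) * cnj (\<chi> x ^ i))"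
    by (intro sum.cong refl) (auto simp: ext_char_value)
  also have "\<dots> = (\<Sum>(a, i)\<in>A \<times> {..<n}. f (a \<otimes> x [^] i) * cnj (\<alpha> a) * cnj (\<Sum>\<chi>\<in>?E. \<chi> x ^ i))"
    by (subst sum.swap) (auto simp: sum_distrib_left case_prod_unfold intro!: sum.cong)
  also have "\<dots> = (\<Sum>(a, i)\<in>A \<times> {..<n}. f (a \<otimes> x [^] i) * cnj (\<alpha> a) * (if i = 0 then of_nat n else 0))"
  proof -
    have "(\<Sum>\<chi>\<in>?E. \<chi> x ^ i) = (if i = 0 then of_nat n else 0)" if "i < n" for i
    proof -
      have "(\<Sum>\<chi>\<in>?E. \<chi> x ^ i) = (\<Sum>c\<in>?C. c ^ i)"
        using sum.reindex_bij_betw[OF ext_char_bij, of "\<lambda>c. c ^ i"] by simp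
      also have "\<dots> = (if i = 0 then of_nat n else 0)" using sum_power_nth_roots[OF a0 that] .
      finally show ?thesis .
    qed
    then show ?thesis by (intro sum.cong refl) (auto simp del: cnj_sum)
  qed
  also have "\<dots> = (\<Sum>a\<in>A. \<Sum>i<n. if i = 0 then f a * cnj (\<alpha> a) * of_nat n else 0)"
    unfolding sum.cartesian_product[symmetric] using Ac by (intro sum.cong refl) auto
  also have "\<dots> = (\<Sum>a\<in>A. f a * cnj (\<alpha> a)) * of_nat n"
    using n by (simp add: sum.delta sum_distrib_right)
  finally show ?thesis
    using n by (simp add: char_mult_def card sum_divide_distrib[symmetric])
qed

end

context group
begin

text \<open>For \<open>A = {\<one>}\<close> and \<open>B\<close> abelian this is Fourier inversion at \<open>\<one>\<close>.\<close>
theorem sum_ext_chars: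
  assumes fin: "finite (carrier G)" and A: "subgroup A G" and B: "subgroup B G" and AB: "A \<subseteq> B"
    and \<alpha>: "\<alpha> \<in> lin_chars G A"
    and comm: "\<And>b c. b \<in> B \<Longrightarrow> c \<in> B \<Longrightarrow> commut G b c \<in> A \<and> \<alpha> (commut G b c) = 1"
  shows "finite (ext_chars G A \<alpha> B) \<and> (\<Sum>\<chi>\<in>ext_chars G A \<alpha> B. char_mult f B \<chi>) = char_mult f A \<alpha>"
  using A AB \<alpha> comm
proof (induction "card B - card A" arbitrary: A \<alpha> rule: less_induct)
  case less
  have fB: "finite B" using finite_subset[OF subgroup.subset[OF B] fin] .
  show ?case
  proof (cases "A = B")
    case True
    then have "ext_chars G A \<alpha> B = {\<alpha>}"
      using less.prems by (auto simp: ext_chars_def intro: lin_chars_eqI)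
    then show ?thesis using True by simp
  next
    case False
    then obtain x where x: "x \<in> B" "x \<notin> A" using less.prems by auto
    interpret char_step G A B \<alpha> x
      by (rule char_step.intro, rule is_group, rule char_step_axioms.intro) (use less.prems fin B x in auto)
    let ?E = "ext_chars G A \<alpha> A1"
    have "card A < card A1" "card A1 \<le> card B"
      using A_sub_A1 x_in_A1 x A1_sub_B fB
      by (auto intro!: psubset_card_mono card_mono intro: finite_subset[OF A1_sub_B fB])
    then have dec: "card B - card A1 < card B - card A" by auto
    have IH: "finite (ext_chars G A1 \<beta> B) \<and> (\<Sum>\<chi>\<in>ext_chars G A1 \<beta> B. char_mult f B \<chi>) = char_mult f A1 \<beta>"
      if "\<beta> \<in> ?E" for \<beta>
      using that A_sub_A1 comm by (intro less.hyps[OF dec A1_subgroup A1_sub_B]) (auto simp: ext_chars_def)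
    have eq: "ext_chars G A \<alpha> B = (\<Union>\<beta>\<in>?E. ext_chars G A1 \<beta> B)"
    proof (intro equalityI subsetI)
      fix \<chi> assume \<chi>: "\<chi> \<in> ext_chars G A \<alpha> B"
      let ?b = "\<lambda>x. if x \<in> A1 then \<chi> x else 0"
      have "?b \<in> ?E" using \<chi> lin_chars_subgroup[OF _ A1_subgroup A1_sub_B] A_sub_A1
        by (auto simp: ext_chars_def)
      moreover have "\<chi> \<in> ext_chars G A1 ?b B" using \<chi> by (auto simp: ext_chars_def)
      ultimately show "\<chi> \<in> (\<Union>\<beta>\<in>?E. ext_chars G A1 \<beta> B)" by blast
    qed (use A_sub_A1 in \<open>auto simp: ext_chars_def\<close>)
    have disj: "ext_chars G A1 \<beta> B \<inter> ext_chars G A1 \<gamma> B = {}" if "\<beta> \<in> ?E" "\<gamma> \<in> ?E" "\<beta> \<noteq> \<gamma>" for \<beta> \<gamma>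
      using that lin_chars_eqI[of \<beta> G A1 \<gamma>] by (auto simp: ext_chars_def)
    have "(\<Sum>\<chi>\<in>ext_chars G A \<alpha> B. char_mult f B \<chi>) = (\<Sum>\<beta>\<in>?E. \<Sum>\<chi>\<in>ext_chars G A1 \<beta> B. char_mult f B \<chi>)"
      unfolding eq using IH disj finite_ext_step by (intro sum.UNION_disjoint) auto
    also have "\<dots> = (\<Sum>\<beta>\<in>?E. char_mult f A1 \<beta>)" using IH by (intro sum.cong) auto
    also have "\<dots> = char_mult f A \<alpha>" by (rule sum_ext_step)
    finally show ?thesis using eq IH finite_ext_step by auto
  qed
qed

end

section \<open>Roots of unity as values of linear characters\<close>

lemma complex_eq_1_if_coprime_powers:
  fixes x :: complex
  assumes "x ^ m = 1" "x ^ n = 1" "coprime m n"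
  shows "x = 1"
proof (cases "m = 0")
  case True then show ?thesis using assms by simp
next
  case False
  then obtain u v where uv: "m * u = n * v + 1"
    using bezout_nat[of m n] assms(3) coprime_imp_gcd_eq_1[of m n] by auto
  have "x ^ (m * u) = x ^ (n * v + 1)" by (simp only: uv)
  then show ?thesis using assms(1,2) by (simp only: power_add power_mult) simp
qed

text \<open>The powers \<open>w ^ i\<close> with \<open>i < p\<close> are distinct, so they exhaust
  the \<open>p\<close> roots of unity of exponent \<open>p\<close>.\<close>

lemma prime_root_is_power:
  fixes w :: complex
  assumes p: "prime (p::nat)" and w: "w ^ p = 1" "w \<noteq> 1" and v: "v ^ p = 1"
  shows "\<exists>i. v = w ^ i"
proof -
  have inj: "inj_on (\<lambda>i. w ^ i) {..<p}"
  proof (rule linorder_inj_onI)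
    fix i j assume ij: "i < j" "i \<in> {..<p}" "j \<in> {..<p}"
    show "w ^ i \<noteq> w ^ j"
    proof
      assume "w ^ i = w ^ j"
      moreover have "w ^ j = w ^ i * w ^ (j - i)" using ij by (simp flip: power_add)
      ultimately have "w ^ i * w ^ (j - i) = w ^ i" by simp
      moreover have "w \<noteq> 0" using w p by (metis prime_gt_0_nat zero_neq_one zero_power)
      ultimately have "w ^ (j - i) = 1" by simp
      moreover have "coprime (j - i) p"
        using ij prime_imp_coprime[OF p, of "j - i"] nat_dvd_not_less[of "j - i" p]
        by (auto simp: coprime_commute)
      ultimately show False using w complex_eq_1_if_coprime_powers by blast
    qed
  qed auto
  have p0: "p > 0" using p by (rule prime_gt_0_nat)
  have "(\<lambda>i. w ^ i) ` {..<p} = {z. z ^ p = 1}"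
  proof (rule card_subset_eq)
    show "finite {z::complex. z ^ p = 1}" using p0 by (intro finite_roots_unity) auto
    show "(\<lambda>i. w ^ i) ` {..<p} \<subseteq> {z. z ^ p = 1}" using w by (auto simp: power_mult[symmetric]) (metis mult.commute power_mult power_one)
    show "card ((\<lambda>i. w ^ i) ` {..<p}) = card {z::complex. z ^ p = 1}"
      using card_image[OF inj] card_roots_unity_eq[OF p0] by simp
  qed
  then show ?thesis using v by blast
qed

lemma roots_unity_subset_imp_dvd:
  assumes "{w::complex. w ^ c = 1} \<subseteq> {w. w ^ d = 1}" "c > 0"
  shows "c dvd d"
proof (rule ccontr)
  assume n: "\<not> c dvd d"
  let ?w = "cis (2 * pi / real c)"
  have "?w ^ c = 1" by (rule cis_root_power_n) fact
  then have "?w ^ d = 1" using assms by blast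
  moreover have "?w ^ d = (?w ^ c) ^ (d div c) * ?w ^ (d mod c)"
    by (simp flip: power_mult power_add)
  ultimately have "?w ^ (d mod c) = 1" using \<open>?w ^ c = 1\<close> by simp
  then show False using cis_root_power_neq_1[of "d mod c" c] assms n by (auto simp: dvd_eq_mod_eq_0)
qed

context group
begin

text \<open>Multiplication by a value \<open>w\<close> permutes the image, so the product of all
  values equals \<open>w ^ card\<close> times itself. Every value is thus a root of unity of
  exponent the size of the image, and there are only that many such roots.\<close>

lemma lin_char_image:
  assumes H: "subgroup H G" and \<chi>: "\<chi> \<in> lin_chars G H" and fin: "finite (carrier G)"
  shows "card (\<chi> ` H) > 0" "\<chi> ` H = {w. w ^ card (\<chi> ` H) = 1}"
proof -
  have fH: "finite H" using finite_subset[OF subgroup.subset[OF H] fin] .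
  show N: "card (\<chi> ` H) > 0" using fH subgroup.one_closed[OF H] by (auto simp: card_gt_0_iff)
  have "w ^ card (\<chi> ` H) = 1" if w: "w \<in> \<chi> ` H" for w
  proof -
    obtain x where x: "x \<in> H" "w = \<chi> x" using w by auto
    have w0: "w \<noteq> 0" using lin_chars_nonzero[OF H \<chi> x(1)] x by simp
    have "(\<lambda>v. w * v) ` (\<chi> ` H) \<subseteq> \<chi> ` H"
      using x H by (auto simp: lin_chars_mult[OF \<chi>, symmetric] subgroup.m_closed)
    moreover have inj: "inj_on (\<lambda>v. w * v) (\<chi> ` H)" using w0 by (auto simp: inj_on_def)
    ultimately have "(\<lambda>v. w * v) ` (\<chi> ` H) = \<chi> ` H"
      using fH by (intro card_subset_eq) (auto simp: card_image)
    then have "\<Prod> (\<chi> ` H) = (\<Prod>v\<in>\<chi> ` H. w * v)"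
      using prod.reindex[OF inj, of "\<lambda>x. x"] by simp
    also have "\<dots> = w ^ card (\<chi> ` H) * \<Prod> (\<chi> ` H)" by (simp add: prod.distrib)
    finally show ?thesis using fH lin_chars_nonzero[OF H \<chi>] by auto
  qed
  then show "\<chi> ` H = {w. w ^ card (\<chi> ` H) = 1}"
    using N finite_roots_unity[of "card (\<chi> ` H)", where 'a = complex]
    by (intro card_subset_eq) (auto simp: card_roots_unity_eq)
qed

lemma pow_cong:
  assumes x: "x \<in> carrier G" "x [^] (E::nat) = \<one>" and m: "[m = k] (mod E)"
  shows "x [^] m = x [^] (k::nat)"
proof -
  have red: "x [^] (j::nat) = x [^] (j mod E)" for j
  proof -
    have "x [^] j = x [^] (E * (j div E) + j mod E)" by simp
    also have "\<dots> = (x [^] E) [^] (j div E) \<otimes> x [^] (j mod E)"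
      using x(1) by (simp only: nat_pow_pow nat_pow_mult)
    finally show ?thesis using x by simp
  qed
  show ?thesis using red[of m] red[of k] m by (simp add: cong_def)
qed

text \<open>Substituting \<open>h [^] k\<close> for \<open>h\<close>, where \<open>k\<close> inverts
  \<open>j\<close> modulo \<open>E\<close>, moves the exponent from \<open>\<chi>\<close> to
  \<open>f\<close>. In effect Galois conjugate characters occur equally often in a function that is
  invariant under powers coprime to the exponent.\<close>

lemma char_mult_power:
  assumes H: "subgroup H G" and \<chi>: "\<chi> \<in> lin_chars G H"
    and E: "\<And>x. x \<in> H \<Longrightarrow> x [^] (E::nat) = \<one>"
    and f: "\<And>x i. x \<in> H \<Longrightarrow> coprime i E \<Longrightarrow> f (x [^] (i::nat)) = f x"
    and j: "coprime j E"
  shows "char_mult f H (\<lambda>x. \<chi> x ^ j) = char_mult f H \<chi>"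
proof -
  have Hc: "x \<in> carrier G" if "x \<in> H" for x using subgroup.mem_carrier[OF H that] .
  obtain k where k: "[j * k = 1] (mod E)" using cong_solve_coprime_nat[OF j] by auto
  then have kj: "[k * j = 1] (mod E)" by (simp add: mult.commute)
  have ck: "coprime k E"
    using kj by (metis cong_imp_coprime cong_sym coprime_1_left coprime_mult_left_iff)
  have id: "x [^] (m::nat) = x" if "x \<in> H" "[m = 1] (mod E)" for x m
    using pow_cong[OF Hc[OF that(1)] E[OF that(1)] that(2)] Hc[OF that(1)] by simp
  have bij: "bij_betw (\<lambda>x. x [^] k) H H"
    using Hc H id[OF _ k] id[OF _ kj]
    by (intro bij_betw_byWitness[of _ "\<lambda>x. x [^] j"]) (auto simp: nat_pow_pow subgroup_pow_closed)
  have "(\<Sum>h\<in>H. f h * cnj (\<chi> h ^ j)) = (\<Sum>h\<in>H. f (h [^] k) * cnj (\<chi> (h [^] k) ^ j))"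
    by (rule sum.reindex_bij_betw[OF bij, symmetric])
  also have "\<dots> = (\<Sum>h\<in>H. f h * cnj (\<chi> h))"
  proof (intro sum.cong refl)
    fix h assume h: "h \<in> H"
    have "\<chi> (h [^] k) ^ j = \<chi> (h [^] (k * j))"
      using lin_chars_pow[OF H \<chi>] h by (simp add: power_mult)
    then show "f (h [^] k) * cnj (\<chi> (h [^] k) ^ j) = f h * cnj (\<chi> h)"
      using f[OF h ck] id[OF h kj] by simp
  qed
  finally show ?thesis by (simp add: char_mult_def)
qed

lemma indicator_lin_char: "subgroup M G \<Longrightarrow> (\<lambda>x. if x \<in> M then 1 else 0) \<in> lin_chars G M"
  by (auto simp: lin_chars_def subgroup.m_closed subgroup.one_closed)

text \<open>The set \<open>E\<close> consists of the characters of the abelian quotient of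
  \<open>K\<close> by \<open>M\<close>. In \<open>sum_ext_chars\<close>, applied to the indicator of
  \<open>M\<close>, each of them contributes \<open>card M / card K\<close>, and the total is
  1.\<close>

lemma card_ext_chars_trivial:
  assumes fin: "finite (carrier G)" and M: "subgroup M G" and K: "subgroup K G" and MK: "M \<subseteq> K"
    and comm: "\<And>b c. b \<in> K \<Longrightarrow> c \<in> K \<Longrightarrow> commut G b c \<in> M"
  defines "E \<equiv> ext_chars G M (\<lambda>x. if x \<in> M then 1 else 0) K"
  shows "finite E" "card E * card M = card K"
proof -
  let ?f = "\<lambda>x. if x \<in> M then 1 else 0 :: complex"
  have fK: "finite K" and fM: "finite M"
    using finite_subset[OF subgroup.subset[OF K] fin] finite_subset[OF subgroup.subset[OF M] fin] by auto
  have pos: "card K > 0" "card M > 0"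
    using fK fM subgroup.one_closed[OF K] subgroup.one_closed[OF M] by (auto simp: card_gt_0_iff)
  have *: "finite E \<and> (\<Sum>\<chi>\<in>E. char_mult ?f K \<chi>) = char_mult ?f M ?f"
    unfolding E_def using comm by (intro sum_ext_chars fin M K MK indicator_lin_char) auto
  then show "finite E" by simp
  have "char_mult ?f K \<chi> = of_nat (card M) / of_nat (card K)" if "\<chi> \<in> E" for \<chi>
  proof -
    have "(\<Sum>h\<in>K. ?f h * cnj (\<chi> h)) = (\<Sum>h\<in>M. 1)"
      using that MK fK by (intro sum.mono_neutral_cong_right) (auto simp: E_def ext_chars_def)
    then show ?thesis by (simp add: char_mult_def)
  qed
  then have "(\<Sum>\<chi>\<in>E. char_mult ?f K \<chi>) = of_nat (card E) * of_nat (card M) / of_nat (card K)" by simp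
  moreover have "char_mult ?f M ?f = 1" using pos by (simp add: char_mult_def)
  ultimately have "of_nat (card E * card M) = (of_nat (card K) :: complex)"
    using * pos by (simp add: field_simps)
  then show "card E * card M = card K" using of_nat_eq_iff by blast
qed

lemma adjoin_subgroup:
  assumes fin: "finite (carrier G)" and A: "subgroup A G" and x: "x \<in> carrier G"
    and norm: "\<And>a. a \<in> A \<Longrightarrow> x \<otimes> a \<otimes> inv x \<in> A"
  shows "subgroup (adjoin G A x) G" "A \<subseteq> adjoin G A x" "x \<in> adjoin G A x"
proof -
  have Ac: "a \<in> carrier G" if "a \<in> A" for a using subgroup.mem_carrier[OF A that] .
  have norm': "x [^] i \<otimes> a \<otimes> inv (x [^] i) \<in> A" if "a \<in> A" for a and i :: nat
  proof (induction i)
    case (Suc i)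
    have "x [^] Suc i \<otimes> a \<otimes> inv (x [^] Suc i) = x \<otimes> (x [^] i \<otimes> a \<otimes> inv (x [^] i)) \<otimes> inv x"
      using x Ac[OF that] by (simp only: nat_pow_Suc2) (simp add: m_assoc inv_mult_group)
    then show ?case using norm[OF Suc] by simp
  qed (use that Ac in simp)
  show sub: "A \<subseteq> adjoin G A x"
  proof
    fix a assume "a \<in> A"
    then have "a = a \<otimes> x [^] (0::nat)" using Ac by simp
    then show "a \<in> adjoin G A x" using \<open>a \<in> A\<close> unfolding adjoin_def by blast
  qed
  have "x = \<one> \<otimes> x [^] (1::nat)" using x by simp
  then show "x \<in> adjoin G A x" using subgroup.one_closed[OF A] unfolding adjoin_def by blast
  show "subgroup (adjoin G A x) G"
  proof (rule finite_subgroupI[OF fin])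
    show "adjoin G A x \<subseteq> carrier G" using x Ac by (auto simp: adjoin_def)
    show "\<one> \<in> adjoin G A x" using sub subgroup.one_closed[OF A] by auto
    fix y z assume yz: "y \<in> adjoin G A x" "z \<in> adjoin G A x"
    obtain a b i j where ab: "a \<in> A" "b \<in> A" "y = a \<otimes> x [^] (i::nat)" "z = b \<otimes> x [^] (j::nat)"
      using yz unfolding adjoin_def by blast
    have "y \<otimes> z = (a \<otimes> (x [^] i \<otimes> b \<otimes> inv (x [^] i))) \<otimes> x [^] (i + j)"
      using ab x Ac by (simp add: m_assoc nat_pow_mult[symmetric] cancel_l2)
    moreover have "a \<otimes> (x [^] i \<otimes> b \<otimes> inv (x [^] i)) \<in> A" using ab norm' A by (simp add: subgroup.m_closed)
    ultimately show "y \<otimes> z \<in> adjoin G A x" unfolding adjoin_def by blast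
  qed
qed

end

section \<open>Subgroups of small index in p-groups of class two\<close>

text \<open>Here the group has p-power exponent. The function \<open>\<psi>\<close> stands for a
  character, described by properties that can be transferred to the p-part of a larger group:
  constancy on conjugacy classes, invariance under powers coprime to \<open>p\<close>, and natural
  multiplicities.\<close>

locale central_char = class2_group G for G (structure) +
  fixes p a :: nat and Z \<psi> \<theta>
  assumes fin: "finite (carrier G)"
    and p: "prime p" "odd p"
    and exponent: "\<And>x. x \<in> carrier G \<Longrightarrow> x [^] (p ^ a) = \<one>"
    and Z: "subgroup Z G"
    and Z_central: "\<And>z x. z \<in> Z \<Longrightarrow> x \<in> carrier G \<Longrightarrow> z \<otimes> x = x \<otimes> z"
    and commut_Z: "\<And>x y. x \<in> carrier G \<Longrightarrow> y \<in> carrier G \<Longrightarrow> commut G x y \<in> Z"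
    and \<psi>_conj: "\<And>g x. g \<in> carrier G \<Longrightarrow> x \<in> carrier G \<Longrightarrow> \<psi> (g \<otimes> x \<otimes> inv g) = \<psi> x"
    and \<psi>_pow: "\<And>x j. x \<in> carrier G \<Longrightarrow> coprime j (p ^ a) \<Longrightarrow> \<psi> (x [^] (j::nat)) = \<psi> x"
    and \<psi>_mult: "\<And>H \<chi>. subgroup H G \<Longrightarrow> \<chi> \<in> lin_chars G H \<Longrightarrow> char_mult \<psi> H \<chi> \<in> \<nat>"
    and \<theta>: "\<theta> \<in> lin_chars G Z" "char_mult \<psi> Z \<theta> \<noteq> 0"
    and nontriv: "\<exists>z\<in>Z. \<theta> z \<noteq> 1"
begin

definition \<beta> :: "'a \<Rightarrow> 'a \<Rightarrow> complex" where "\<beta> x y = \<theta> (commut G x y)"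

definition R :: "'a set" where "R = {x \<in> carrier G. \<forall>g\<in>carrier G. \<beta> x g = 1}"

lemma Zc: "z \<in> Z \<Longrightarrow> z \<in> carrier G" using subgroup.mem_carrier[OF Z] .

lemma \<beta>_mult_left: "x \<in> carrier G \<Longrightarrow> y \<in> carrier G \<Longrightarrow> z \<in> carrier G \<Longrightarrow> \<beta> (x \<otimes> y) z = \<beta> x z * \<beta> y z"
  by (simp add: \<beta>_def commut_mult_left commut_Z lin_chars_mult[OF \<theta>(1)])

lemma \<beta>_mult_right: "x \<in> carrier G \<Longrightarrow> y \<in> carrier G \<Longrightarrow> z \<in> carrier G \<Longrightarrow> \<beta> z (x \<otimes> y) = \<beta> z x * \<beta> z y"
  by (simp add: \<beta>_def commut_mult_right commut_Z lin_chars_mult[OF \<theta>(1)])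

lemma \<beta>_swap: "x \<in> carrier G \<Longrightarrow> y \<in> carrier G \<Longrightarrow> \<beta> y x = inverse (\<beta> x y)"
  using inv_commut[of x y] by (simp add: \<beta>_def commut_Z flip: lin_chars_inv_eq[OF Z \<theta>(1)])

lemma \<beta>_one [simp]: "x \<in> carrier G \<Longrightarrow> \<beta> \<one> x = 1" "x \<in> carrier G \<Longrightarrow> \<beta> x \<one> = 1" "x \<in> carrier G \<Longrightarrow> \<beta> x x = 1"
  by (auto simp: \<beta>_def lin_chars_one[OF \<theta>(1)])

lemma \<beta>_pow_left: "x \<in> carrier G \<Longrightarrow> y \<in> carrier G \<Longrightarrow> \<beta> (x [^] (n::nat)) y = \<beta> x y ^ n"
  by (induction n) (auto simp: \<beta>_mult_left)

lemma \<beta>_inv_left: "x \<in> carrier G \<Longrightarrow> y \<in> carrier G \<Longrightarrow> \<beta> (inv x) y = inverse (\<beta> x y)"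
  using \<beta>_mult_left[of x "inv x" y] by (simp add: inverse_unique)

lemma Rc: "x \<in> R \<Longrightarrow> x \<in> carrier G" by (simp add: R_def)

lemma R_subgroup: "subgroup R G"
  by (rule finite_subgroupI[OF fin]) (auto simp: R_def \<beta>_mult_left)

lemma Z_sub_R: "Z \<subseteq> R"
proof
  fix z assume z: "z \<in> Z"
  have "commut G z g = \<one>" if "g \<in> carrier G" for g
    using commut_eq_one_iff[OF Zc[OF z] that] Z_central[OF z that] by simp
  then show "z \<in> R" using Zc[OF z] by (auto simp: R_def \<beta>_def lin_chars_one[OF \<theta>(1)])
qed

lemma \<beta>_R: "x \<in> R \<Longrightarrow> g \<in> carrier G \<Longrightarrow> \<beta> x g = 1" "x \<in> R \<Longrightarrow> g \<in> carrier G \<Longrightarrow> \<beta> g x = 1"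
  using \<beta>_swap[of x g] by (auto simp: R_def)

lemma nat_Re:
  assumes "z \<in> \<nat>"
  shows "Re z \<ge> 0" "z = of_real (Re z)" "z \<noteq> 0 \<Longrightarrow> Re z \<ge> 1"
  using assms by (auto elim!: Nats_cases)

lemma ext_exists:
  assumes "subgroup A G" "subgroup B G" "A \<subseteq> B" "\<alpha> \<in> lin_chars G A" "char_mult \<psi> A \<alpha> \<noteq> 0"
    and "\<And>b c. b \<in> B \<Longrightarrow> c \<in> B \<Longrightarrow> commut G b c \<in> A \<and> \<alpha> (commut G b c) = 1"
  shows "\<exists>\<chi>\<in>ext_chars G A \<alpha> B. char_mult \<psi> B \<chi> \<noteq> 0"
  using sum_ext_chars[OF fin assms(1-4,6), of \<psi>] assms(5) sum.neutral by metis

end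

text \<open>Since \<open>K\<close> meets \<open>R\<close> exactly in the kernel of
  \<open>\<nu>\<close>, it contains every element of \<open>Z\<close> with
  \<open>\<theta>\<close>-value 1. Commutators of elements that are orthogonal under
  \<open>\<beta>\<close> therefore lie in \<open>K\<close>.\<close>

locale central_char_ext = central_char +
  fixes \<nu> K
  assumes \<nu>: "\<nu> \<in> ext_chars G Z \<theta> R" "char_mult \<psi> R \<nu> \<noteq> 0"
    and K: "subgroup K G" "K \<inter> R = {r \<in> R. \<nu> r = 1}"
    and K_max: "\<And>K'. subgroup K' G \<Longrightarrow> K' \<inter> R = {r \<in> R. \<nu> r = 1} \<Longrightarrow> K \<subseteq> K' \<Longrightarrow> K' = K"
begin

abbreviation "M \<equiv> {r \<in> R. \<nu> r = 1}"

lemma \<nu>_char: "\<nu> \<in> lin_chars G R" and \<nu>_Z: "z \<in> Z \<Longrightarrow> \<nu> z = \<theta> z"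
  using \<nu>(1) by (auto simp: ext_chars_def)

lemma Kc: "x \<in> K \<Longrightarrow> x \<in> carrier G" using subgroup.mem_carrier[OF K(1)] .

lemma M_sub_K: "r \<in> R \<Longrightarrow> \<nu> r = 1 \<Longrightarrow> r \<in> K" and K_R: "r \<in> R \<Longrightarrow> r \<in> K \<Longrightarrow> \<nu> r = 1"
  using K(2) by auto

lemma ker_sub_K: "z \<in> Z \<Longrightarrow> \<theta> z = 1 \<Longrightarrow> z \<in> K"
  using M_sub_K Z_sub_R \<nu>_Z by auto

lemma K_Z: "z \<in> Z \<Longrightarrow> z \<in> K \<Longrightarrow> \<theta> z = 1"
  using K_R[of z] Z_sub_R \<nu>_Z[of z] by auto

lemma commut_in_K: "x \<in> carrier G \<Longrightarrow> y \<in> carrier G \<Longrightarrow> \<beta> x y = 1 \<Longrightarrow> commut G x y \<in> K"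
  using ker_sub_K commut_Z by (auto simp: \<beta>_def)

lemma M_subgroup: "subgroup M G"
  using R_subgroup
  by (intro finite_subgroupI[OF fin])
    (auto simp: Rc lin_chars_mult[OF \<nu>_char] lin_chars_one[OF \<nu>_char] subgroup.m_closed subgroup.one_closed)

text \<open>The orthogonal of \<open>K\<close> under \<open>\<beta>\<close>. By
  \<open>commut_KH\<close> its elements normalise \<open>K\<close>, and it is studied modulo
  \<open>K\<close>.\<close>

definition H :: "'a set" where "H = {g \<in> carrier G. \<forall>k\<in>K. \<beta> k g = 1}"

lemma Hc: "x \<in> H \<Longrightarrow> x \<in> carrier G" by (simp add: H_def)

lemma H_subgroup: "subgroup H G"
  by (rule finite_subgroupI[OF fin]) (auto simp: H_def Kc \<beta>_mult_right)

lemma R_sub_H: "R \<subseteq> H" by (auto simp: H_def Kc Rc \<beta>_R)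

lemma \<beta>_KH: "k \<in> K \<Longrightarrow> h \<in> H \<Longrightarrow> \<beta> k h = 1" "k \<in> K \<Longrightarrow> h \<in> H \<Longrightarrow> \<beta> h k = 1"
  using \<beta>_swap[of k h] by (auto simp: H_def Kc)

lemma commut_KH: "k \<in> K \<Longrightarrow> h \<in> H \<Longrightarrow> commut G k h \<in> K" "k \<in> K \<Longrightarrow> h \<in> H \<Longrightarrow> commut G h k \<in> K"
  using \<beta>_KH commut_in_K Kc Hc by auto

text \<open>The correction in \<open>mult_pow\<close> is a power of the commutator of
  \<open>r\<close> and \<open>k\<close>, which lies in \<open>K\<close> because \<open>r\<close>
  belongs to the radical.\<close>

lemma KR_pow:
  assumes "k \<in> K" "r \<in> R"
  shows "\<exists>k'\<in>K. (k \<otimes> r) [^] (n::nat) = k' \<otimes> r [^] n"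
proof
  have c: "commut G r k \<in> K" using assms commut_KH R_sub_H by auto
  let ?k = "commut G r k [^] (n * (n - 1) div 2) \<otimes> k [^] n"
  show "?k \<in> K" using c assms K(1) by (intro subgroup.m_closed subgroup_pow_closed) auto
  show "(k \<otimes> r) [^] n = ?k \<otimes> r [^] n"
    using assms Kc Rc by (simp add: mult_pow m_assoc)
qed

text \<open>By maximality, adjoining \<open>x\<close> to \<open>K\<close> produces an element
  \<open>k \<otimes> x [^] i\<close> of \<open>R\<close> outside the kernel of \<open>\<nu>\<close>.
  Then \<open>p\<close> does not divide \<open>i\<close>, so \<open>i\<close> can be inverted modulo
  \<open>p\<close>, and \<open>x\<close> is recovered modulo \<open>K\<close> from a power of that
  element.\<close>

lemma p_power_in_KR:
  assumes x: "x \<in> H" "x [^] p \<in> K"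
  shows "\<exists>k\<in>K. \<exists>r\<in>R. x = k \<otimes> r"
proof (cases "x \<in> K")
  case True
  then show ?thesis using subgroup.one_closed[OF R_subgroup] Kc by force
next
  case False
  have xc: "x \<in> carrier G" using x Hc by auto
  have norm: "x \<otimes> k \<otimes> inv x \<in> K" if "k \<in> K" for k
    using that commut_KH x K(1) xc Kc by (simp add: conj_eq_commut_mult subgroup.m_closed)
  note ad = adjoin_subgroup[OF fin K(1) xc norm]
  have "adjoin G K x \<inter> R \<noteq> M" using K_max[OF ad(1) _ ad(2)] ad(3) False by auto
  moreover have "M \<subseteq> adjoin G K x \<inter> R" using ad(2) K(2) by auto
  ultimately obtain y where y: "y \<in> adjoin G K x" "y \<in> R" "y \<notin> M" by auto
  then obtain k i where k: "k \<in> K" "y = k \<otimes> x [^] (i::nat)" unfolding adjoin_def by blast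
  have xi: "x [^] i = inv k \<otimes> y" using k xc Kc by (simp add: cancel_l2)
  have "\<not> p dvd i"
  proof
    assume "p dvd i"
    then obtain q where "i = p * q" by auto
    then have "x [^] i \<in> K" using subgroup_pow_closed[OF K(1) x(2), of q] xc by (simp add: nat_pow_pow)
    then have "y \<in> K" using k K(1) by (simp add: subgroup.m_closed)
    then show False using y K_R by auto
  qed
  then have cop: "coprime i p" using p(1) prime_imp_coprime by (metis coprime_commute)
  have i0: "i \<noteq> 0" using \<open>\<not> p dvd i\<close> by (metis dvd_0_right)
  obtain u v where uv: "i * u = p * v + 1"
    using bezout_nat[OF i0, of p] coprime_imp_gcd_eq_1[OF cop] by auto
  obtain k' where k': "k' \<in> K" "(inv k \<otimes> y) [^] u = k' \<otimes> y [^] u"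
    using KR_pow[of "inv k" y u] k y K(1) by (auto simp: subgroup.m_inv_closed)
  let ?l = "(x [^] p) [^] v"
  have l: "?l \<in> K" using x K(1) by (simp add: subgroup_pow_closed)
  have yu: "y [^] u \<in> R" using y R_subgroup by (simp add: subgroup_pow_closed)
  have "x [^] (i * u) = x [^] (p * v + 1)" by (simp only: uv)
  then have "(x [^] i) [^] u = ?l \<otimes> x"
    using xc by (simp only: nat_pow_pow nat_pow_mult[symmetric]) simp
  then have "?l \<otimes> x = k' \<otimes> y [^] u" using xi k' by simp
  then have "x = (inv ?l \<otimes> k') \<otimes> y [^] u"
    using xc l k' yu Kc Rc by (metis cancel_l2 inv_closed m_assoc)
  moreover have "inv ?l \<otimes> k' \<in> K" using l k' K(1) by (simp add: subgroup.m_closed subgroup.m_inv_closed)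
  ultimately show ?thesis using yu by blast
qed

text \<open>Modulo \<open>K\<close>, the elements in question are represented by elements of
  \<open>R\<close>, whose \<open>\<nu>\<close>-values are p-th roots of unity and determine them
  modulo \<open>K\<close>. They form a group of order at most \<open>p\<close>, generated by any
  \<open>d\<close> outside \<open>K\<close>.\<close>

lemma p_power_unique:
  assumes c: "c \<in> H" "c [^] p \<in> K" and d: "d \<in> H" "d [^] p \<in> K" "d \<notin> K"
  shows "\<exists>i. \<exists>k\<in>K. c = k \<otimes> d [^] (i::nat)"
proof -
  have root: "\<nu> r ^ p = 1" if kr: "k \<in> K" "r \<in> R" "(k \<otimes> r) [^] p \<in> K" for k r
  proof -
    obtain k' where k': "k' \<in> K" "(k \<otimes> r) [^] p = k' \<otimes> r [^] p" using KR_pow kr by blast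
    have "r [^] p = inv k' \<otimes> (k \<otimes> r) [^] p" using k' kr Kc Rc by (simp add: cancel_l2)
    also have "\<dots> \<in> K" using k' kr K(1) by (intro subgroup.m_closed subgroup.m_inv_closed)
    finally have "r [^] p \<in> K" .
    then show ?thesis
      using K_R[of "r [^] p"] subgroup_pow_closed[OF R_subgroup kr(2)] lin_chars_pow[OF R_subgroup \<nu>_char kr(2)]
      by simp
  qed
  obtain k r where kr: "k \<in> K" "r \<in> R" "c = k \<otimes> r" using p_power_in_KR[OF c] by blast
  obtain l s where ls: "l \<in> K" "s \<in> R" "d = l \<otimes> s" using p_power_in_KR[OF d(1,2)] by blast
  have "\<nu> s \<noteq> 1" using ls d(3) M_sub_K[of s] K(1) by (auto simp: subgroup.m_closed)
  then obtain i where i: "\<nu> r = \<nu> s ^ i"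
    using prime_root_is_power[OF p(1)] root[of k r] root[of l s] kr ls c d by metis
  let ?m = "r \<otimes> inv (s [^] i)"
  have si: "s [^] i \<in> R" using ls R_subgroup by (simp add: subgroup_pow_closed)
  have "\<nu> ?m = 1"
    using kr ls si i R_subgroup lin_chars_nonzero[OF R_subgroup \<nu>_char ls(2)]
    by (simp add: lin_chars_mult[OF \<nu>_char] subgroup.m_inv_closed lin_chars_inv_eq[OF R_subgroup \<nu>_char]
        lin_chars_pow[OF R_subgroup \<nu>_char])
  then have m: "?m \<in> K" using kr si R_subgroup M_sub_K by (simp add: subgroup.m_closed subgroup.m_inv_closed)
  obtain k' where k': "k' \<in> K" "d [^] i = k' \<otimes> s [^] i" using KR_pow ls by blast
  have "s [^] i = inv k' \<otimes> d [^] i" using k' si Kc Rc by (simp add: cancel_l2)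
  then have "c = (k \<otimes> ?m \<otimes> inv k') \<otimes> d [^] i"
    using kr si k' Kc Rc by (metis (no_types, lifting) inv_closed inv_solve_right' m_assoc m_closed)
  moreover have "k \<otimes> ?m \<otimes> inv k' \<in> K"
    using kr m k' K(1) by (simp add: subgroup.m_closed subgroup.m_inv_closed)
  ultimately show ?thesis by blast
qed

text \<open>This is where \<open>p\<close> odd enters: \<open>p\<close> divides
  \<open>p ^ s * (p ^ s - 1) div 2\<close>, so the power of the commutator in
  \<open>mult_pow\<close> has \<open>\<theta>\<close>-value 1 and falls into
  \<open>K\<close>.\<close>

lemma mult_pow_mod_K:
  assumes "x \<in> H" "y \<in> H" "\<beta> y x ^ p = 1" "s > 0"
  shows "\<exists>k\<in>K. (x \<otimes> y) [^] (p ^ s) = k \<otimes> (x [^] (p ^ s) \<otimes> y [^] (p ^ s))"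
proof
  let ?n = "p ^ s" let ?e = "?n * (?n - 1) div 2"
  obtain q where q: "?n - 1 = 2 * q" using p(2) by (metis even_diff_nat dvdE even_power odd_one prime_gt_0_nat p(1) odd_even_add)
  have "?e = ?n * q" unfolding q by simp
  moreover obtain t where "?n = p * t" using assms(4) by (cases s) auto
  ultimately have e: "?e = p * (t * q)" by simp
  have "\<theta> (commut G y x [^] ?e) = \<beta> y x ^ ?e"
    using assms Hc by (simp add: \<beta>_def lin_chars_pow[OF Z \<theta>(1)] commut_Z)
  also have "\<dots> = 1" unfolding e using assms(3) by (simp add: power_mult)
  finally show "commut G y x [^] ?e \<in> K"
    using assms Hc by (intro ker_sub_K subgroup_pow_closed[OF Z] commut_Z) auto
  show "(x \<otimes> y) [^] ?n = commut G y x [^] ?e \<otimes> (x [^] ?n \<otimes> y [^] ?n)"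
    using assms Hc by (simp add: mult_pow)
qed

text \<open>The logarithm to base \<open>p\<close> of the order of \<open>x\<close> modulo
  \<open>K\<close>.\<close>

definition order_mod :: "'a \<Rightarrow> nat" where "order_mod x = (LEAST t. x [^] (p ^ t) \<in> K)"

lemma order_mod: "x \<in> carrier G \<Longrightarrow> x [^] (p ^ order_mod x) \<in> K"
  unfolding order_mod_def by (rule LeastI[of _ a]) (simp add: exponent subgroup.one_closed[OF K(1)])

lemma order_mod_le: "x [^] (p ^ t) \<in> K \<Longrightarrow> order_mod x \<le> t"
  unfolding order_mod_def by (rule Least_le)

lemma order_mod_pos: "x \<in> carrier G \<Longrightarrow> x \<notin> K \<Longrightarrow> order_mod x > 0"
  using order_mod[of x] by (cases "order_mod x") auto

text \<open>Otherwise an element outside the radical of \<open>\<beta>\<close> on \<open>H\<close> of least order modulo \<open>K\<close>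
  could be multiplied by a power of an element not orthogonal to it so as to lower its order.\<close>
lemma H_isotropic:
  assumes "x \<in> H" "y \<in> H"
  shows "\<beta> x y = 1"
proof (rule ccontr)
  let ?P = "\<lambda>x. x \<in> H \<and> (\<exists>y\<in>H. \<beta> x y \<noteq> 1)"
  assume "\<beta> x y \<noteq> 1"
  then have "?P x" using assms by auto
  then obtain b where b: "?P b" and least: "\<And>x. ?P x \<Longrightarrow> order_mod b \<le> order_mod x"
    using ex_has_least_nat[of ?P x order_mod] by blast
  then obtain c where c: "c \<in> H" "\<beta> b c \<noteq> 1" by auto
  have bH: "b \<in> H" and bc: "b \<in> carrier G" and cc: "c \<in> carrier G" using b c Hc by auto
  have cb: "\<beta> c b \<noteq> 1" using c \<beta>_swap[OF bc cc] by auto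
  have bK: "b \<notin> K" and cK: "c \<notin> K" using c bH \<beta>_KH by auto
  define t s where "t = order_mod b" "s = order_mod c"
  have ts: "t \<le> s" unfolding t_s_def using least[of c] cb bH c by auto
  have t0: "t > 0" using order_mod_pos[OF bc bK] by (simp add: t_s_def)
  then have s0: "s > 0" using ts by simp
  have pp: "p * p ^ (n - 1) = p ^ n" "p ^ (n - 1) * p = p ^ n" if "n > 0" for n
    using that by (cases n; simp)+
  have bp: "(b [^] p ^ (t - 1)) [^] p \<in> K" "(c [^] p ^ (s - 1)) [^] p \<in> K"
    using order_mod[OF bc] order_mod[OF cc] t0 s0 by (auto simp: nat_pow_pow bc cc pp t_s_def simp del: One_nat_def)
  have nK: "c [^] p ^ (s - 1) \<notin> K"
    using order_mod_le[of c "s - 1"] s0 t_s_def by auto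
  have inH: "b [^] n \<in> H" "c [^] n \<in> H" for n :: nat
    using bH c H_subgroup by (auto simp: subgroup_pow_closed)
  \<comment> \<open>An element of order \<open>p\<close> modulo \<open>K\<close> is a product of
    elements of \<open>K\<close> and \<open>R\<close>, hence orthogonal to \<open>H\<close>. The
    bound makes \<open>t - 1\<close> positive, as \<open>mult_pow_mod_K\<close> demands.\<close>
  have t2: "t > 1"
  proof (rule ccontr)
    assume "\<not> t > 1"
    then have "t = 1" using t0 by simp
    then have "b [^] p \<in> K" using bp bc by simp
    then obtain k r where "k \<in> K" "r \<in> R" "b = k \<otimes> r" using p_power_in_KR[OF bH] by blast
    then have "\<beta> b c = 1" using Kc Rc cc c by (simp add: \<beta>_mult_left \<beta>_KH \<beta>_R)
    then show False using c by simp
  qed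
  have "(b [^] p) [^] (p ^ (t - 1)) \<in> K"
    using order_mod[OF bc] t0 by (simp add: nat_pow_pow bc pp t_s_def del: One_nat_def)
  then have "order_mod (b [^] p) < order_mod b" using order_mod_le[of "b [^] p" "t - 1"] t0 by (simp add: t_s_def)
  \<comment> \<open>The power \<open>b [^] p\<close> has smaller order modulo \<open>K\<close>, so
    by minimality it is orthogonal to all of \<open>H\<close>.\<close>
  then have rad: "\<beta> b h ^ p = 1" if "h \<in> H" for h
    using least[of "b [^] p"] inH that bc Hc \<beta>_pow_left[of b h p] by (metis not_less)
  obtain i k where ik: "k \<in> K" "b [^] p ^ (t - 1) = k \<otimes> (c [^] p ^ (s - 1)) [^] (i::nat)"
    using p_power_unique[OF inH(1) bp(1) inH(2) bp(2) nK] by blast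
  \<comment> \<open>A power of \<open>c\<close> that agrees with \<open>b\<close> modulo
    \<open>K\<close> after raising to \<open>p ^ (t - 1)\<close>; it exists because
    \<open>t \<le> s\<close>. Dividing \<open>b\<close> by \<open>e\<close> lowers the order modulo
    \<open>K\<close> but keeps the value of \<open>\<beta>\<close> against \<open>c\<close>, since
    \<open>c\<close> is orthogonal to its own powers.\<close>
  define e where "e = c [^] (i * p ^ (s - t))"
  have eH: "e \<in> H" unfolding e_def by (rule inH)
  have ec: "e \<in> carrier G" using eH Hc by auto
  have "s - 1 = (s - t) + (t - 1)" using ts t0 by simp
  then have "p ^ (s - 1) = p ^ (s - t) * p ^ (t - 1)" by (simp only: power_add)
  then have e: "e [^] (p ^ (t - 1)) = (c [^] p ^ (s - 1)) [^] i"
    by (simp add: e_def nat_pow_pow cc mult_ac)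
  have ieH: "inv e \<in> H" using eH H_subgroup by (simp add: subgroup.m_inv_closed)
  have "\<beta> (inv e) b ^ p = 1"
    using rad[OF ieH] \<beta>_swap[OF bc, of "inv e"] ec by (simp add: power_inverse)
  then obtain k' where k': "k' \<in> K"
    "(b \<otimes> inv e) [^] (p ^ (t - 1)) = k' \<otimes> (b [^] (p ^ (t - 1)) \<otimes> (inv e) [^] (p ^ (t - 1)))"
    using mult_pow_mod_K[OF bH ieH, of "t - 1"] t2 by auto
  have "b [^] (p ^ (t - 1)) \<otimes> (inv e) [^] (p ^ (t - 1)) = k"
    using ik Kc cc ec by (simp add: nat_pow_inv e m_assoc del: One_nat_def)
  then have "(b \<otimes> inv e) [^] (p ^ (t - 1)) \<in> K" using k' ik K(1) by (simp add: subgroup.m_closed)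
  then have "order_mod (b \<otimes> inv e) < order_mod b" using order_mod_le[of "b \<otimes> inv e" "t - 1"] t0 by (simp add: t_s_def)
  moreover have "b \<otimes> inv e \<in> H" using bH ieH H_subgroup by (simp add: subgroup.m_closed)
  ultimately have "\<beta> (b \<otimes> inv e) c = 1" using least[of "b \<otimes> inv e"] c by (metis not_less)
  moreover have "\<beta> e c = 1" unfolding e_def using cc by (simp add: \<beta>_pow_left)
  ultimately show False using c bc cc ec by (simp add: \<beta>_mult_left \<beta>_inv_left)
qed

end

section \<open>The index of the maximal subgroup\<close>

context central_char_ext
begin

lemma finite_sub: "A \<subseteq> carrier G \<Longrightarrow> finite A" using fin finite_subset by auto

lemma finites: "finite R" "finite K" "finite H" "finite M"
  by (auto intro!: finite_sub intro: Rc Kc Hc)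

lemma card_pos: "card R > 0" "card K > 0" "card H > 0" "card M > 0"
  using finites subgroup.one_closed[OF R_subgroup] subgroup.one_closed[OF K(1)]
    subgroup.one_closed[OF H_subgroup] subgroup.one_closed[OF M_subgroup] by (auto simp: card_gt_0_iff)

lemma card_R_le: "card R \<le> card (\<nu> ` R) * card M"
proof (rule card_le_card_fibres[OF R_subgroup finites(4)])
  fix x y assume "x \<in> R" "y \<in> R" "\<nu> x = \<nu> y"
  then show "x \<otimes> inv y \<in> M"
    using R_subgroup lin_chars_nonzero[OF R_subgroup \<nu>_char]
    by (auto simp: subgroup.m_closed subgroup.m_inv_closed lin_chars_mult[OF \<nu>_char] lin_chars_inv_eq[OF R_subgroup \<nu>_char])
qed (use finites in auto)

text \<open>An element \<open>g\<close> is sent to the character \<open>\<beta> x g\<close> of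
  \<open>x \<in> K\<close>, which is trivial on \<open>M\<close>. Elements with the same image agree
  modulo \<open>H\<close>, and the number of characters of \<open>K\<close> trivial on
  \<open>M\<close> is the index of \<open>M\<close> in \<open>K\<close>.\<close>

lemma card_G_le: "card (carrier G) * card M \<le> card H * card K"
proof -
  have MK: "M \<subseteq> K" using M_sub_K by auto
  have "commut G b c \<in> M" if "b \<in> K" "c \<in> K" for b c
    using that subgroup_commut_closed[OF K(1)] commut_Z[of b c] Z_sub_R Kc K_R[of "commut G b c"] by auto
  note E = card_ext_chars_trivial[OF fin M_subgroup K(1) MK this]
  let ?E = "ext_chars G M (\<lambda>x. if x \<in> M then 1 else 0) K"
  let ?f = "\<lambda>g x. if x \<in> K then \<beta> x g else 0"
  have "card (carrier G) \<le> card ?E * card H"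
  proof (rule card_le_card_fibres[OF subgroup_self finites(3) E(1)])
    show "?f ` carrier G \<subseteq> ?E"
    proof (rule image_subsetI)
      fix g assume g: "g \<in> carrier G"
      have "?f g \<in> lin_chars G K"
        using g subgroup.m_closed[OF K(1)] subgroup.one_closed[OF K(1)] by (auto simp: lin_chars_def \<beta>_mult_left Kc)
      moreover have "?f g m = 1" if "m \<in> M" for m using that g M_sub_K \<beta>_R by auto
      ultimately show "?f g \<in> ?E" by (simp add: ext_chars_def)
    qed
  next
    fix g h assume gh: "g \<in> carrier G" "h \<in> carrier G" "?f g = ?f h"
    have "\<beta> k (g \<otimes> inv h) = 1" if k: "k \<in> K" for k
    proof -
      have e: "\<beta> k g = \<beta> k h" using fun_cong[OF gh(3), of k] k by simp
      have "\<beta> k (g \<otimes> inv h) = \<beta> k g * \<beta> k (inv h)" using gh k Kc by (simp add: \<beta>_mult_right)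
      also have "\<dots> = \<beta> k (h \<otimes> inv h)" unfolding e using gh k Kc by (simp only: \<beta>_mult_right inv_closed)
      finally show ?thesis using gh k Kc by simp
    qed
    then show "g \<otimes> inv h \<in> H" using gh by (simp add: H_def)
  qed (use fin in auto)
  then have "card (carrier G) * card M \<le> card ?E * card H * card M" by simp
  also have "\<dots> = card H * (card ?E * card M)" by (simp only: mult_ac)
  also have "\<dots> = card H * card K" by (simp only: E(2))
  finally show ?thesis .
qed

lemma R_conj: "g \<in> carrier G \<Longrightarrow> r \<in> R \<Longrightarrow> g \<otimes> r \<otimes> inv g \<in> R \<and> \<nu> (g \<otimes> r \<otimes> inv g) = \<nu> r"
proof -
  assume g: "g \<in> carrier G" "r \<in> R"
  have c: "commut G g r \<in> Z" using g Rc commut_Z by auto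
  have "\<nu> (commut G g r) = 1" using \<nu>_Z[OF c] \<beta>_R(2)[OF g(2,1)] by (simp add: \<beta>_def)
  then show ?thesis
    using c g Rc Z_sub_R R_subgroup by (auto simp: conj_eq_commut_mult lin_chars_mult[OF \<nu>_char] subgroup.m_closed)
qed

text \<open>The twisted sum over the coset \<open>h R\<close> is invariant under conjugation, which multiplies it
  by the nontrivial scalar \<open>\<beta> g h\<close>.\<close>
lemma coset_sum_eq_0:
  assumes h: "h \<in> carrier G" "h \<notin> R"
  shows "(\<Sum>r\<in>R. \<psi> (h \<otimes> r) * cnj (\<nu> r)) = 0"
proof -
  let ?F = "\<lambda>h. \<Sum>r\<in>R. \<psi> (h \<otimes> r) * cnj (\<nu> r)"
  obtain g where g: "g \<in> carrier G" "\<beta> h g \<noteq> 1" using h by (auto simp: R_def)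
  then have gh: "\<beta> g h \<noteq> 1" using \<beta>_swap[of h g] h by simp
  let ?c = "commut G g h"
  have c: "?c \<in> Z" using g h commut_Z by auto
  then have cR: "?c \<in> R" "?c \<in> carrier G" using Z_sub_R Zc by auto
  have bij: "bij_betw (\<lambda>r. g \<otimes> r \<otimes> inv g) R R"
  proof (rule bij_betw_byWitness[of _ "\<lambda>r. inv g \<otimes> r \<otimes> g"])
    show "(\<lambda>r. g \<otimes> r \<otimes> inv g) ` R \<subseteq> R" using R_conj[OF g(1)] by auto
    show "(\<lambda>r. inv g \<otimes> r \<otimes> g) ` R \<subseteq> R" using R_conj[of "inv g"] g by auto
  qed (use g Rc in \<open>auto simp: m_assoc cancel_l1 cancel_l2\<close>)
  have bij2: "bij_betw (\<lambda>r. ?c \<otimes> r) R R"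
    using cR R_subgroup Rc
    by (intro bij_betw_byWitness[of _ "\<lambda>r. inv ?c \<otimes> r"])
      (auto simp: cancel_l1 cancel_l2 subgroup.m_closed subgroup.m_inv_closed)
  have "?F h = (\<Sum>r\<in>R. \<psi> ((g \<otimes> h \<otimes> inv g) \<otimes> (g \<otimes> r \<otimes> inv g)) * cnj (\<nu> (g \<otimes> r \<otimes> inv g)))"
  proof (intro sum.cong refl)
    fix r assume r: "r \<in> R"
    have "(g \<otimes> h \<otimes> inv g) \<otimes> (g \<otimes> r \<otimes> inv g) = g \<otimes> (h \<otimes> r) \<otimes> inv g"
      using g h r Rc by (simp add: m_assoc cancel_l2)
    then show "\<psi> (h \<otimes> r) * cnj (\<nu> r) = \<psi> ((g \<otimes> h \<otimes> inv g) \<otimes> (g \<otimes> r \<otimes> inv g)) * cnj (\<nu> (g \<otimes> r \<otimes> inv g))"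
      using \<psi>_conj[of g "h \<otimes> r"] R_conj[OF g(1) r] g h r Rc by simp
  qed
  also have "\<dots> = ?F (g \<otimes> h \<otimes> inv g)"
    by (rule sum.reindex_bij_betw[OF bij, of "\<lambda>r. \<psi> ((g \<otimes> h \<otimes> inv g) \<otimes> r) * cnj (\<nu> r)"])
  also have "\<dots> = (\<Sum>r\<in>R. \<psi> (h \<otimes> (?c \<otimes> r)) * (cnj (\<nu> (?c \<otimes> r)) * \<nu> ?c))"
  proof (intro sum.cong refl)
    fix r assume r: "r \<in> R"
    have "g \<otimes> h \<otimes> inv g \<otimes> r = h \<otimes> (?c \<otimes> r)"
      using g h r Rc Z_central[OF c h(1)] by (simp add: conj_eq_commut_mult m_assoc[symmetric])
    moreover have "cnj (\<nu> (?c \<otimes> r)) * \<nu> ?c = cnj (\<nu> r) * (\<nu> ?c * cnj (\<nu> ?c))"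
      using lin_chars_mult[OF \<nu>_char cR(1) r] by simp
    ultimately show "\<psi> (g \<otimes> h \<otimes> inv g \<otimes> r) * cnj (\<nu> r) = \<psi> (h \<otimes> (?c \<otimes> r)) * (cnj (\<nu> (?c \<otimes> r)) * \<nu> ?c)"
      using lin_chars_cnj[OF R_subgroup \<nu>_char cR(1) fin] by simp
  qed
  also have "\<dots> = (\<Sum>r\<in>R. \<psi> (h \<otimes> r) * (cnj (\<nu> r) * \<nu> ?c))"
    by (rule sum.reindex_bij_betw[OF bij2, of "\<lambda>r. \<psi> (h \<otimes> r) * (cnj (\<nu> r) * \<nu> ?c)"])
  also have "\<dots> = \<nu> ?c * ?F h" by (simp add: sum_distrib_left mult_ac)
  finally have "(1 - \<nu> ?c) * ?F h = 0" by (simp add: algebra_simps)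
  moreover have "\<nu> ?c \<noteq> 1" using gh \<nu>_Z[OF c] by (simp add: \<beta>_def)
  ultimately show ?thesis by simp
qed

text \<open>As \<open>H\<close> is isotropic, \<open>\<nu>\<close> extends to a character
  \<open>\<mu>\<close> of \<open>H\<close> that occurs in \<open>\<psi>\<close>. By
  \<open>coset_sum_eq_0\<close> the inner product over \<open>H\<close> is concentrated on
  \<open>R\<close>, so \<open>card H\<close> times the multiplicity of \<open>\<mu>\<close> equals
  \<open>card R\<close> times that of \<open>\<nu>\<close>, and the former multiplicity is at least
  1.\<close>

lemma mult_R_ge: "real (card H) \<le> real (card R) * Re (char_mult \<psi> R \<nu>)"
proof -
  have comm: "commut G b c \<in> R \<and> \<nu> (commut G b c) = 1" if "b \<in> H" "c \<in> H" for b c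
    using that H_isotropic[OF that] commut_Z[of b c] Hc Z_sub_R \<nu>_Z[of "commut G b c"] by (auto simp: \<beta>_def)
  obtain \<mu> where \<mu>: "\<mu> \<in> ext_chars G R \<nu> H" "char_mult \<psi> H \<mu> \<noteq> 0"
    using ext_exists[OF R_subgroup H_subgroup R_sub_H \<nu>_char \<nu>(2) comm] by blast
  have \<mu>H: "\<mu> \<in> lin_chars G H" and \<mu>R: "r \<in> R \<Longrightarrow> \<mu> r = \<nu> r" for r using \<mu> by (auto simp: ext_chars_def)
  let ?f = "\<lambda>h. \<psi> h * cnj (\<mu> h)" and ?g = "\<lambda>r. \<psi> r * cnj (\<nu> r)"
  let ?S = "sum ?f H" and ?T = "sum ?g R"
  have tr: "bij_betw (\<lambda>h. h \<otimes> r) A A" if "subgroup A G" "r \<in> A" for A r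
    using that subgroup.mem_carrier[OF that(1)]
    by (intro bij_betw_byWitness[of _ "\<lambda>h. h \<otimes> inv r"]) (auto simp: m_assoc subgroup.m_closed subgroup.m_inv_closed)
  have tl: "bij_betw (\<lambda>h. r \<otimes> h) A A" if "subgroup A G" "r \<in> A" for A r
    using that subgroup.mem_carrier[OF that(1)]
    by (intro bij_betw_byWitness[of _ "\<lambda>h. inv r \<otimes> h"])
      (auto simp: cancel_l1 cancel_l2 subgroup.m_closed subgroup.m_inv_closed)
  \<comment> \<open>Averaging over translations by \<open>R\<close> breaks the sum over
    \<open>H\<close> into twisted sums over cosets of \<open>R\<close>, of which only those with
    \<open>h \<in> R\<close> survive.\<close>
  have "of_nat (card R) * ?S = (\<Sum>r\<in>R. \<Sum>h\<in>H. ?f (h \<otimes> r))"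
    using sum.reindex_bij_betw[OF tr[OF H_subgroup], of _ ?f] R_sub_H by (simp add: subset_iff)
  also have "\<dots> = (\<Sum>h\<in>H. cnj (\<mu> h) * (\<Sum>r\<in>R. \<psi> (h \<otimes> r) * cnj (\<nu> r)))"
    using R_sub_H by (subst sum.swap) (auto simp: sum_distrib_left \<mu>R lin_chars_mult[OF \<mu>H] subset_iff mult_ac intro!: sum.cong)
  also have "\<dots> = (\<Sum>h\<in>R. cnj (\<mu> h) * (\<Sum>r\<in>R. \<psi> (h \<otimes> r) * cnj (\<nu> r)))"
    using R_sub_H finites coset_sum_eq_0 Hc by (intro sum.mono_neutral_right) auto
  also have "\<dots> = (\<Sum>h\<in>R. ?T)"
  proof (intro sum.cong refl)
    fix h assume h: "h \<in> R"
    have "cnj (\<mu> h) * (\<Sum>r\<in>R. \<psi> (h \<otimes> r) * cnj (\<nu> r)) = (\<Sum>r\<in>R. ?g (h \<otimes> r))"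
      using h by (auto simp: sum_distrib_left \<mu>R lin_chars_mult[OF \<nu>_char] mult_ac intro!: sum.cong)
    also have "\<dots> = ?T" by (rule sum.reindex_bij_betw[OF tl[OF R_subgroup h]])
    finally show "cnj (\<mu> h) * (\<Sum>r\<in>R. \<psi> (h \<otimes> r) * cnj (\<nu> r)) = ?T" .
  qed
  finally have "?S = ?T" using card_pos by simp
  then have "of_nat (card R) * char_mult \<psi> R \<nu> = of_nat (card H) * char_mult \<psi> H \<mu>"
    using card_pos by (simp add: char_mult_def)
  then have "Re (of_nat (card R) * char_mult \<psi> R \<nu>) = Re (of_nat (card H) * char_mult \<psi> H \<mu>)" by (simp only:)
  then have "real (card R) * Re (char_mult \<psi> R \<nu>) = real (card H) * Re (char_mult \<psi> H \<mu>)" by simp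
  also have "\<dots> \<ge> real (card H) * 1"
    using nat_Re(3)[OF \<psi>_mult[OF H_subgroup \<mu>H] \<mu>(2)] by (intro mult_left_mono) auto
  finally show ?thesis by simp
qed

text \<open>With \<open>c\<close> and \<open>d = c * q\<close> the orders of \<open>\<theta>\<close>
  and \<open>\<nu>\<close>, the powers of \<open>\<nu>\<close> with exponents
  \<open>1 + i * c\<close> for \<open>i < q\<close> are distinct extensions of
  \<open>\<theta>\<close>. As \<open>\<theta>\<close> is nontrivial, \<open>p\<close> divides
  \<open>c\<close>, so these exponents are coprime to \<open>p\<close> and all the powers have the
  multiplicity of \<open>\<nu>\<close>. The multiplicities of all extensions add up to that of
  \<open>\<theta>\<close>.\<close>

lemma mult_Z_ge:
  "real (card (\<nu> ` R)) * Re (char_mult \<psi> R \<nu>) \<le> real (card (\<theta> ` Z)) * Re (char_mult \<psi> Z \<theta>)"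
proof -
  define c d where "c = card (\<theta> ` Z)" "d = card (\<nu> ` R)"
  have c0: "c > 0" and c: "\<theta> ` Z = {w. w ^ c = 1}" using lin_char_image[OF Z \<theta>(1) fin] by (auto simp: c_d_def)
  have d0: "d > 0" and d: "\<nu> ` R = {w. w ^ d = 1}" using lin_char_image[OF R_subgroup \<nu>_char fin] by (auto simp: c_d_def)
  have "\<theta> ` Z \<subseteq> \<nu> ` R" using Z_sub_R \<nu>_Z by (force simp: image_iff)
  then have "c dvd d" using roots_unity_subset_imp_dvd c0 unfolding c d by blast
  then obtain q where q: "d = c * q" by auto
  have pc: "p dvd c"
  proof (rule ccontr)
    assume "\<not> p dvd c"
    then have cop: "coprime (p ^ a) c" using p(1) prime_imp_coprime by auto
    obtain z where z: "z \<in> Z" "\<theta> z \<noteq> 1" using nontriv by auto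
    have "\<theta> z ^ (p ^ a) = 1"
      using lin_chars_pow[OF Z \<theta>(1) z(1), of "p ^ a"] exponent[OF Zc[OF z(1)]] lin_chars_one[OF \<theta>(1)] by simp
    moreover have "\<theta> z ^ c = 1" using c z(1) by auto
    ultimately show False using complex_eq_1_if_coprime_powers[OF _ _ cop] z by blast
  qed
  have cop: "coprime (1 + i * c) (p ^ a)" for i
  proof -
    have "\<not> p dvd 1 + i * c" using pc p(1) by (metis dvd_add_left_iff dvd_mult nat_dvd_1_iff_1 not_prime_1)
    then have "coprime p (1 + i * c)" by (rule prime_imp_coprime[OF p(1)])
    then show ?thesis by (simp add: coprime_commute)
  qed
  let ?n = "\<lambda>i x. \<nu> x ^ (1 + i * c)"
  have inj: "inj_on ?n {..<q}"
  proof (rule linorder_inj_onI)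
    fix i j assume ij: "i < j" "i \<in> {..<q}" "j \<in> {..<q}"
    let ?w = "cis (2 * pi / real d)"
    have "?w \<in> \<nu> ` R" unfolding d using cis_root_power_n[OF d0] by simp
    then obtain r where r: "r \<in> R" "\<nu> r = ?w" by auto
    have jc: "1 + j * c = (1 + i * c) + (j - i) * c" using ij by (simp flip: add_mult_distrib)
    show "?n i \<noteq> ?n j"
    proof
      assume "?n i = ?n j"
      then have "?w ^ (1 + i * c) = ?w ^ (1 + j * c)" using r by metis
      then have "?w ^ (1 + i * c) * ?w ^ ((j - i) * c) = ?w ^ (1 + i * c)" unfolding jc by (simp only: power_add)
      then have "?w ^ ((j - i) * c) = 1" by simp
      moreover have "(j - i) * c < d" unfolding q using ij c0 by (subst mult.commute) auto
      ultimately show False using cis_root_power_neq_1[of "(j - i) * c" d] ij c0 by auto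
    qed
  qed auto
  have comm: "commut G b c \<in> Z \<and> \<theta> (commut G b c) = 1" if "b \<in> R" "c \<in> R" for b c
    using \<beta>_R(1)[OF that(1), of c] that Rc commut_Z by (auto simp: \<beta>_def)
  note S = sum_ext_chars[OF fin Z R_subgroup Z_sub_R \<theta>(1) comm, of \<psi>]
  let ?E = "ext_chars G Z \<theta> R"
  have sub: "?n ` {..<q} \<subseteq> ?E"
  proof clarify
    fix i
    have "\<theta> z ^ (1 + i * c) = \<theta> z" if "z \<in> Z" for z
    proof -
      have "\<theta> z ^ c = 1" using c that by auto
      then show ?thesis by (simp add: power_mult mult.commute[of i])
    qed
    then show "?n i \<in> ?E" using lin_chars_power[OF \<nu>_char, of "1 + i * c"] \<nu>_Z by (auto simp: ext_chars_def)
  qed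
  have val: "char_mult \<psi> R (?n i) = char_mult \<psi> R \<nu>" for i
    using exponent \<psi>_pow Rc by (intro char_mult_power[OF R_subgroup \<nu>_char _ _ cop]) auto
  have "real q * Re (char_mult \<psi> R \<nu>) = (\<Sum>\<chi>\<in>?n ` {..<q}. Re (char_mult \<psi> R \<chi>))"
    by (simp add: sum.reindex[OF inj] val del: One_nat_def)
  also have "\<dots> \<le> (\<Sum>\<chi>\<in>?E. Re (char_mult \<psi> R \<chi>))"
    using S sub nat_Re(1)[OF \<psi>_mult[OF R_subgroup]] by (intro sum_mono2) (auto simp: ext_chars_def)
  also have "\<dots> = Re (char_mult \<psi> Z \<theta>)" using S by (metis Re_sum)
  finally have "real c * (real q * Re (char_mult \<psi> R \<nu>)) \<le> real c * Re (char_mult \<psi> Z \<theta>)"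
    by (intro mult_left_mono) auto
  then show ?thesis by (simp add: c_d_def[symmetric] q mult.assoc)
qed

text \<open>The preceding estimates lead from \<open>H\<close> to \<open>R\<close>, from
  \<open>R\<close> to the image of \<open>\<nu>\<close>, and from there to \<open>\<theta>\<close>;
  the common factor \<open>card M\<close> cancels.\<close>

lemma index_K_le: "real (card (carrier G)) \<le> real (card K) * (real (card (\<theta> ` Z)) * Re (char_mult \<psi> Z \<theta>))"
proof -
  let ?m = "Re (char_mult \<psi> R \<nu>)"
  have m0: "?m \<ge> 0" using nat_Re(1)[OF \<psi>_mult[OF R_subgroup \<nu>_char]] .
  have "real (card (carrier G)) * real (card M) \<le> real (card H) * real (card K)"
    using card_G_le by (simp only: of_nat_mult[symmetric] of_nat_le_iff)
  also have "\<dots> \<le> (real (card R) * ?m) * real (card K)" using mult_R_ge by (intro mult_right_mono) auto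
  also have "\<dots> \<le> (real (card (\<nu> ` R) * card M) * ?m) * real (card K)"
    using card_R_le m0 by (intro mult_right_mono) (simp_all only: of_nat_le_iff of_nat_0_le_iff)
  also have "\<dots> = (real (card (\<nu> ` R)) * ?m) * (real (card M) * real (card K))" by simp
  also have "\<dots> \<le> (real (card (\<theta> ` Z)) * Re (char_mult \<psi> Z \<theta>)) * (real (card M) * real (card K))"
    using mult_Z_ge by (intro mult_right_mono) auto
  finally have "real (card M) * real (card (carrier G)) \<le> real (card M) * (real (card K) * (real (card (\<theta> ` Z)) * Re (char_mult \<psi> Z \<theta>)))"
    by (simp add: mult_ac)
  then show ?thesis using card_pos by simp
qed

end

context central_char
begin

theorem exists_subgroup_small_index:
  "\<exists>K. subgroup K G \<and> (\<forall>z\<in>K \<inter> Z. \<theta> z = 1) \<and>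
     real (card (carrier G)) \<le> real (card K) * (real (card (\<theta> ` Z)) * Re (char_mult \<psi> Z \<theta>))"
proof -
  have comm: "commut G b c \<in> Z \<and> \<theta> (commut G b c) = 1" if "b \<in> R" "c \<in> R" for b c
    using \<beta>_R(1)[OF that(1), of c] that Rc commut_Z by (auto simp: \<beta>_def)
  obtain \<nu> where \<nu>: "\<nu> \<in> ext_chars G Z \<theta> R" "char_mult \<psi> R \<nu> \<noteq> 0"
    using ext_exists[OF Z R_subgroup Z_sub_R \<theta> comm] by blast
  let ?M = "{r \<in> R. \<nu> r = 1}"
  define S where "S = {K. subgroup K G \<and> K \<inter> R = ?M}"
  have "subgroup ?M G"
    using R_subgroup \<nu>(1)
    by (intro finite_subgroupI[OF fin])
      (auto simp: Rc ext_chars_def lin_chars_mult lin_chars_one subgroup.m_closed subgroup.one_closed)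
  then have "?M \<in> S" by (auto simp: S_def)
  moreover have "finite S"
    by (rule finite_subset[of _ "Pow (carrier G)"]) (auto simp: S_def fin dest: subgroup.subset)
  ultimately obtain K where K: "K \<in> S" "\<And>K'. K' \<in> S \<Longrightarrow> K \<subseteq> K' \<Longrightarrow> K' = K"
    using finite_has_maximal[of S] by blast
  interpret central_char_ext G p a Z \<psi> \<theta> \<nu> K
    by (rule central_char_ext.intro, rule central_char_axioms, rule central_char_ext_axioms.intro)
      (use \<nu> K in \<open>auto simp: S_def\<close>)
  have "subgroup K G" using K(1) by (simp add: S_def)
  moreover have "\<forall>z\<in>K \<inter> Z. \<theta> z = 1" using K_Z by blast
  ultimately show ?thesis using index_K_le by blast
qed

end

section \<open>Galois invariance of rational power sums\<close>

text \<open>Membership exhibits \<open>x\<close> as an eigenvalue of an integer matrix and is visibly preserved by the ring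
  operations.\<close>
definition lattice_stab :: "nat \<Rightarrow> complex set" where
  "lattice_stab N = {x. \<exists>A :: nat \<Rightarrow> nat \<Rightarrow> int. \<forall>i<N.
     x * cis (2 * pi / real N) ^ i = (\<Sum>j<N. of_int (A i j) * cis (2 * pi / real N) ^ j)}"

lemma lattice_stabI:
  assumes "\<And>i. i < N \<Longrightarrow> \<exists>a :: nat \<Rightarrow> int. x * cis (2 * pi / real N) ^ i = (\<Sum>j<N. of_int (a j) * cis (2 * pi / real N) ^ j)"
  shows "x \<in> lattice_stab N"
proof -
  have "\<forall>i. \<exists>a :: nat \<Rightarrow> int. i < N \<longrightarrow> x * cis (2 * pi / real N) ^ i = (\<Sum>j<N. of_int (a j) * cis (2 * pi / real N) ^ j)"
    using assms by blast
  from choice[OF this] show ?thesis unfolding lattice_stab_def by blast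
qed

lemma lattice_stab_of_int: "of_int k \<in> lattice_stab N"
proof (rule lattice_stabI)
  fix i assume i: "i < N"
  have "(\<Sum>j<N. of_int (if j = i then k else 0) * cis (2 * pi / real N) ^ j) =
    (\<Sum>j<N. if j = i then of_int k * cis (2 * pi / real N) ^ j else 0)"
    by (intro sum.cong) auto
  then show "\<exists>a. of_int k * cis (2 * pi / real N) ^ i = (\<Sum>j<N. of_int (a j) * cis (2 * pi / real N) ^ j)"
    using i by (intro exI[of _ "\<lambda>j. if j = i then k else 0"]) simp
qed

lemma lattice_stab_root:
  assumes "w ^ N = 1" "N > 0"
  shows "w \<in> lattice_stab N"
proof (rule lattice_stabI)
  let ?z = "cis (2 * pi / real N)"
  fix i assume i: "i < N"
  have "w \<in> (\<lambda>k. cis (2 * pi * real k / real N)) ` {..<N}"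
    using bij_betw_roots_unity[OF assms(2)] assms(1) by (auto simp: bij_betw_def)
  then obtain k where "w = ?z ^ k" by (auto simp: Complex.DeMoivre mult_ac)
  then have "w * ?z ^ i = ?z ^ (k + i)" by (simp add: power_add)
  also have "\<dots> = (?z ^ N) ^ ((k + i) div N) * ?z ^ ((k + i) mod N)"
    by (simp flip: power_mult power_add)
  finally have e: "w * ?z ^ i = ?z ^ ((k + i) mod N)" using cis_root_power_n[OF assms(2)] by simp
  have "(\<Sum>j<N. of_int (if j = (k + i) mod N then 1 else 0) * ?z ^ j) = (\<Sum>j<N. if j = (k + i) mod N then ?z ^ j else 0)"
    by (intro sum.cong) auto
  then show "\<exists>a. w * ?z ^ i = (\<Sum>j<N. of_int (a j) * ?z ^ j)"
    unfolding e using assms(2) by (intro exI[of _ "\<lambda>j. if j = (k + i) mod N then 1 else 0"]) simp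
qed

lemma lattice_stab_add:
  assumes "x \<in> lattice_stab N" "y \<in> lattice_stab N"
  shows "x + y \<in> lattice_stab N"
proof -
  let ?z = "cis (2 * pi / real N)"
  obtain A B :: "nat \<Rightarrow> nat \<Rightarrow> int" where
    "\<forall>i<N. x * ?z ^ i = (\<Sum>j<N. of_int (A i j) * ?z ^ j)" "\<forall>i<N. y * ?z ^ i = (\<Sum>j<N. of_int (B i j) * ?z ^ j)"
    using assms unfolding lattice_stab_def by blast
  then have "\<forall>i<N. (x + y) * ?z ^ i = (\<Sum>j<N. of_int (A i j + B i j) * ?z ^ j)"
    by (simp add: distrib_right sum.distrib)
  then show ?thesis unfolding lattice_stab_def by (intro CollectI exI[of _ "\<lambda>i j. A i j + B i j"])
qed

lemma lattice_stab_mult: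
  assumes "x \<in> lattice_stab N" "y \<in> lattice_stab N"
  shows "x * y \<in> lattice_stab N"
proof -
  let ?z = "cis (2 * pi / real N)"
  obtain A B :: "nat \<Rightarrow> nat \<Rightarrow> int" where
    A: "\<forall>i<N. x * ?z ^ i = (\<Sum>j<N. of_int (A i j) * ?z ^ j)" and
    B: "\<forall>i<N. y * ?z ^ i = (\<Sum>j<N. of_int (B i j) * ?z ^ j)"
    using assms unfolding lattice_stab_def by blast
  have "x * y * ?z ^ i = (\<Sum>k<N. of_int (\<Sum>j<N. B i j * A j k) * ?z ^ k)" if "i < N" for i
  proof -
    have "x * y * ?z ^ i = x * (y * ?z ^ i)" by simp
    also have "\<dots> = (\<Sum>j<N. of_int (B i j) * (x * ?z ^ j))"
      using B that by (simp add: sum_distrib_left mult_ac)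
    also have "\<dots> = (\<Sum>j<N. \<Sum>k<N. of_int (B i j) * (of_int (A j k) * ?z ^ k))"
      using A by (simp add: sum_distrib_left)
    also have "\<dots> = (\<Sum>k<N. of_int (\<Sum>j<N. B i j * A j k) * ?z ^ k)"
      by (subst sum.swap) (simp add: sum_distrib_right mult.assoc)
    finally show ?thesis .
  qed
  then show ?thesis unfolding lattice_stab_def
    by (intro CollectI exI[of _ "\<lambda>i k. \<Sum>j<N. B i j * A j k"]) blast
qed

lemma lattice_stab_power: "x \<in> lattice_stab N \<Longrightarrow> x ^ n \<in> lattice_stab N"
  using lattice_stab_of_int[of 1 N] by (induction n) (auto intro: lattice_stab_mult)

lemma lattice_stab_sum:
  assumes "\<And>i. i \<in> I \<Longrightarrow> f i \<in> lattice_stab N"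
  shows "sum f I \<in> lattice_stab N"
  using assms lattice_stab_of_int[of 0 N]
  by (induction I rule: infinite_finite_induct) (auto intro: lattice_stab_add)

text \<open>The vector of powers of the root of unity is an eigenvector of the integer matrix for
  the eigenvalue \<open>x\<close>; it is nonzero as its first entry is 1. So \<open>x\<close> is a
  root of a monic integer polynomial, and a rational algebraic integer is an integer.\<close>

lemma lattice_stab_rational:
  assumes x: "x \<in> lattice_stab N" "x \<in> \<rat>" and N: "N > 0"
  shows "x \<in> \<int>"
proof -
  let ?z = "cis (2 * pi / real N)"
  obtain A :: "nat \<Rightarrow> nat \<Rightarrow> int" where A: "\<forall>i<N. x * ?z ^ i = (\<Sum>j<N. of_int (A i j) * ?z ^ j)"
    using x(1) unfolding lattice_stab_def by blast
  define M where "M = mat N N (\<lambda>(i, j). A i j)"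
  let ?M = "map_mat of_int M :: complex mat"
  have M: "M \<in> carrier_mat N N" "?M \<in> carrier_mat N N" by (auto simp: M_def)
  let ?v = "vec N (\<lambda>i. ?z ^ i)"
  have "?M *\<^sub>v ?v = x \<cdot>\<^sub>v ?v"
    using A by (intro eq_vecI) (auto simp: M_def scalar_prod_def atLeast0LessThan)
  moreover have "?v \<noteq> 0\<^sub>v N"
  proof
    assume "?v = 0\<^sub>v N"
    then have "?v $ 0 = 0\<^sub>v N $ 0" by simp
    then show False using N by simp
  qed
  ultimately have "eigenvector ?M ?v x" using M by (auto simp: eigenvector_def)
  then have "eigenvalue ?M x" by (auto simp: eigenvalue_def)
  then have "poly (char_poly ?M) x = 0" using eigenvalue_root_char_poly[OF M(2)] by simp
  moreover have "char_poly ?M = map_poly of_int (char_poly M)"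
    by (rule of_int_hom.char_poly_hom[OF M(1)])
  moreover have "lead_coeff (char_poly M) = 1" using degree_monic_char_poly[OF M(1)] by simp
  ultimately have "algebraic_int x" unfolding algebraic_int_altdef_ipoly by auto
  then show ?thesis using x(2) rational_algebraic_int_is_int by blast
qed

text \<open>A congruence modulo \<open>q\<close> in the ring \<open>lattice_stab N\<close>: the
  inner binomial coefficients are divisible by the prime \<open>q\<close>.\<close>

lemma lattice_stab_frobenius_add:
  assumes q: "prime (q::nat)" and a: "a \<in> lattice_stab N" and b: "b \<in> lattice_stab N"
  shows "\<exists>c\<in>lattice_stab N. (a + b) ^ q = a ^ q + b ^ q + of_nat q * c"
proof -
  have q1: "q > 1" using q by (rule prime_gt_1_nat)
  let ?t = "\<lambda>k. of_nat (q choose k) * a ^ k * b ^ (q - k)"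
  let ?c = "\<Sum>k\<in>{0<..<q}. of_int (int ((q choose k) div q)) * a ^ k * b ^ (q - k)"
  have "{..q} = {0, q} \<union> {0<..<q}" using q1 by auto
  then have "(a + b) ^ q = sum ?t ({0, q} \<union> {0<..<q})" unfolding binomial_ring by (simp only:)
  also have "\<dots> = sum ?t {0, q} + sum ?t {0<..<q}" by (rule sum.union_disjoint) auto
  finally have "(a + b) ^ q = ?t 0 + ?t q + (\<Sum>k\<in>{0<..<q}. ?t k)" using q1 by simp
  also have "(\<Sum>k\<in>{0<..<q}. ?t k) = of_nat q * ?c"
    unfolding sum_distrib_left
  proof (intro sum.cong refl)
    fix k assume "k \<in> {0<..<q}"
    then have "q dvd (q choose k)" using dvd_choose_prime[of k q] q by auto
    then have "(q choose k) = q * ((q choose k) div q)" by simp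
    then have "(of_nat (q choose k) :: complex) = of_nat q * of_nat ((q choose k) div q)" by (metis of_nat_mult)
    then show "?t k = of_nat q * (of_int (int ((q choose k) div q)) * a ^ k * b ^ (q - k))" by simp
  qed
  finally have "(a + b) ^ q = a ^ q + b ^ q + of_nat q * ?c" using q1 by simp
  moreover have "?c \<in> lattice_stab N"
    by (intro lattice_stab_sum lattice_stab_mult lattice_stab_power lattice_stab_of_int a b)
  ultimately show ?thesis by blast
qed

lemma lattice_stab_frobenius_sum:
  assumes q: "prime (q::nat)" and "finite I" and "\<And>i. i \<in> I \<Longrightarrow> f i \<in> lattice_stab N"
  shows "\<exists>c\<in>lattice_stab N. sum f I ^ q = (\<Sum>i\<in>I. f i ^ q) + of_nat q * c"
  using assms(2,3)
proof (induction I rule: finite_induct)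
  case empty
  then show ?case using q lattice_stab_of_int[of 0 N] prime_gt_0_nat by (auto intro!: bexI[of _ 0])
next
  case (insert x I)
  obtain c where c: "c \<in> lattice_stab N" "sum f I ^ q = (\<Sum>i\<in>I. f i ^ q) + of_nat q * c" using insert by auto
  obtain d where d: "d \<in> lattice_stab N" "(f x + sum f I) ^ q = f x ^ q + sum f I ^ q + of_nat q * d"
    using lattice_stab_frobenius_add[OF q, of "f x" N "sum f I"] insert lattice_stab_sum[of I f N] by auto
  then show ?case using insert c by (intro bexI[of _ "c + d"]) (auto simp: algebra_simps intro: lattice_stab_add)
qed

text \<open>Let \<open>m\<close> and \<open>n\<close> be the two sums, natural numbers bounded by
  \<open>card I\<close>. Modulo \<open>q\<close>, the Frobenius congruence makes
  \<open>m ^ q\<close> congruent to \<open>n\<close>, and Fermat makes it congruent to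
  \<open>m\<close>. The quotient of \<open>m - n\<close> by \<open>q\<close> is rational and lies in
  \<open>lattice_stab N\<close>, hence is an integer, and \<open>q\<close> is too large for it to be
  nonzero.\<close>

lemma power_sum_prime:
  fixes w :: "'i \<Rightarrow> complex"
  assumes I: "finite I" and w: "\<And>i. i \<in> I \<Longrightarrow> w i ^ N = 1" and N: "N > 0"
    and nat: "\<And>t. (\<Sum>i\<in>I. w i ^ t) \<in> \<nat>" and q: "prime q" "q > 2 * card I"
  shows "(\<Sum>i\<in>I. w i ^ q) = (\<Sum>i\<in>I. w i)"
proof -
  obtain m n where m: "(\<Sum>i\<in>I. w i) = of_nat m" and n: "(\<Sum>i\<in>I. w i ^ q) = of_nat n"
    using nat[of 1] nat[of q] by (auto elim!: Nats_cases)
  have bound: "k \<le> card I" if "(\<Sum>i\<in>I. w i ^ t) = of_nat k" for k t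
  proof -
    have "norm (w i) = 1" if "i \<in> I" for i
      using power_eq_1_iff[OF w[OF that]] N by simp
    then have "norm (\<Sum>i\<in>I. w i ^ t) \<le> (\<Sum>i\<in>I. 1)"
      by (intro order.trans[OF norm_sum] sum_mono) (simp add: norm_power)
    then show ?thesis using that by simp
  qed
  obtain c where c: "c \<in> lattice_stab N" "of_nat m ^ q = of_nat n + of_nat q * c"
    using lattice_stab_frobenius_sum[OF q(1) I, of w N] lattice_stab_root w N m n by metis
  \<comment> \<open>Fermat's little theorem, read off from the Frobenius congruence for a sum of
    \<open>m\<close> ones.\<close>
  obtain d where d: "d \<in> lattice_stab N" "of_nat m ^ q = of_nat m + of_nat q * d"
    using lattice_stab_frobenius_sum[OF q(1), of "{..<m}" "\<lambda>_. 1" N] lattice_stab_of_int[of 1 N] by auto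
  have q0: "q > 0" using q(1) by (rule prime_gt_0_nat)
  have e: "of_nat q * (c - d) = of_int (int m - int n)" using c d by (simp add: algebra_simps)
  then have "c - d = of_int (int m - int n) / of_nat q" using q0 by (simp add: field_simps)
  then have "c - d \<in> \<rat>" by simp
  moreover have "c - d \<in> lattice_stab N"
    using lattice_stab_add[OF c(1) lattice_stab_mult[OF lattice_stab_of_int[of "-1"] d(1)]] by simp
  ultimately have "c - d \<in> \<int>" using lattice_stab_rational N by blast
  then obtain k where "c - d = of_int k" by (auto elim: Ints_cases)
  then have "(of_int (int q * k) :: complex) = of_int (int m - int n)" using e by simp
  then have "int q * k = int m - int n" using of_int_eq_iff by blast
  moreover have "\<bar>int m - int n\<bar> < int q"
    using bound[of 1 m] bound[of q n] m n q(2) by simp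
  ultimately have "m = n" using q0 by (metis dvd_imp_le_int dvd_triv_left linorder_not_le right_minus_eq of_nat_eq_iff abs_of_nat)
  then show ?thesis using m n by simp
qed

text \<open>The prime factors of \<open>j\<close> are removed one by one. Naturalness is assumed for
  all exponents \<open>t\<close> so that the family of q-th powers satisfies the same
  hypotheses.\<close>

lemma power_sum_large_factors:
  fixes w :: "'i \<Rightarrow> complex"
  assumes "finite I" "\<And>i. i \<in> I \<Longrightarrow> w i ^ N = 1" "N > 0" "\<And>t. (\<Sum>i\<in>I. w i ^ t) \<in> \<nat>"
    and "j > 0" "\<And>q. prime q \<Longrightarrow> q dvd j \<Longrightarrow> q > 2 * card I"
  shows "(\<Sum>i\<in>I. w i ^ j) = (\<Sum>i\<in>I. w i)"
  using assms
proof (induction j arbitrary: w rule: less_induct)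
  case (less j)
  show ?case
  proof (cases "j = 1")
    case False
    then obtain q r where q: "prime q" "j = q * r" using prime_factor_nat[of j] by (auto elim: dvdE)
    then have r: "r < j" "r > 0" using less.prems(5) prime_gt_1_nat[of q] by auto
    have "(\<Sum>i\<in>I. w i ^ j) = (\<Sum>i\<in>I. (w i ^ q) ^ r)" by (simp add: q power_mult)
    also have "\<dots> = (\<Sum>i\<in>I. w i ^ q)"
    proof (rule less.IH[OF r(1) less.prems(1) _ less.prems(3)])
      show "(w i ^ q) ^ N = 1" if "i \<in> I" for i
        using less.prems(2)[OF that] by (metis mult.commute power_mult power_one)
      show "(\<Sum>i\<in>I. (w i ^ q) ^ t) \<in> \<nat>" for t using less.prems(4)[of "q * t"] by (simp add: power_mult)
      show "s > 2 * card I" if "prime s" "s dvd r" for s using less.prems(6)[OF that(1)] that q by simp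
    qed (fact r)
    also have "\<dots> = (\<Sum>i\<in>I. w i)"
      using less.prems q by (intro power_sum_prime) auto
    finally show ?thesis .
  qed simp
qed

text \<open>The exponent \<open>j\<close> is replaced by one in the same residue class modulo \<open>N\<close> that has only large
  prime factors.\<close>
theorem power_sum_coprime:
  fixes w :: "'i \<Rightarrow> complex"
  assumes I: "finite I" and w: "\<And>i. i \<in> I \<Longrightarrow> w i ^ N = 1" and N: "N > 0"
    and nat: "\<And>t. (\<Sum>i\<in>I. of_nat (m i) * w i ^ t) \<in> \<nat>" and j: "coprime j N"
  shows "(\<Sum>i\<in>I. of_nat (m i) * w i ^ j) = (\<Sum>i\<in>I. of_nat (m i) * w i)"
proof -
  \<comment> \<open>Multiplicities become repeated indices.\<close>
  define J where "J = (SIGMA i:I. {..<m i})"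
  have J: "finite J" using I by (simp add: J_def)
  have sum: "(\<Sum>x\<in>J. w (fst x) ^ t) = (\<Sum>i\<in>I. of_nat (m i) * w i ^ t)" for t
    using sum.Sigma[of I "\<lambda>i. {..<m i}" "\<lambda>i k. w i ^ t"] I by (simp add: J_def case_prod_beta)
  \<comment> \<open>A prime \<open>r \<le> 2 * card J\<close> divides exactly one of
    \<open>j\<close> and \<open>N * D\<close>: if it divides \<open>j\<close>, it divides neither
    \<open>N\<close> nor \<open>D\<close>; otherwise it is a factor of \<open>D\<close>. So no such
    prime divides the sum \<open>k\<close>.\<close>
  define D where "D = \<Prod>{r. prime r \<and> r \<le> 2 * card J \<and> \<not> r dvd j}"
  have fin: "finite {r. prime r \<and> r \<le> 2 * card J \<and> \<not> r dvd j}"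
    by (rule finite_subset[of _ "{..2 * card J}"]) auto
  have D0: "D > 0" unfolding D_def using prime_gt_0_nat by (intro prod_pos) auto
  define k where "k = j + N * D"
  have big: "r > 2 * card J" if r: "prime r" "r dvd k" for r
  proof (rule ccontr)
    assume "\<not> r > 2 * card J"
    then have le: "r \<le> 2 * card J" by simp
    show False
    proof (cases "r dvd j")
      case True
      then have "r dvd N * D" using r(2) unfolding k_def by (simp add: dvd_add_right_iff)
      moreover have "\<not> r dvd N" using True j r(1) by (meson coprime_common_divisor not_prime_unit)
      ultimately have "r dvd D" using r(1) by (simp add: prime_dvd_mult_iff)
      then obtain s where "prime s" "\<not> s dvd j" "r dvd s"
        unfolding D_def using r(1) fin by (auto simp: prime_dvd_prod_iff)
      then show False using True r(1) primes_dvd_imp_eq by blast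
    next
      case False
      then have "r dvd D" unfolding D_def using le r fin by (intro dvd_prodI) auto
      then have "r dvd j" using r(2) unfolding k_def by (simp add: dvd_add_left_iff)
      then show False using False by simp
    qed
  qed
  have "(\<Sum>x\<in>J. w (fst x) ^ k) = (\<Sum>x\<in>J. w (fst x))"
  proof (rule power_sum_large_factors[OF J])
    show "w (fst x) ^ N = 1" if "x \<in> J" for x using w that by (auto simp: J_def)
    show "(\<Sum>x\<in>J. w (fst x) ^ t) \<in> \<nat>" for t using nat by (simp add: sum)
    show "k > 0" using N D0 by (simp add: k_def)
  qed (use N big in auto)
  then have "(\<Sum>i\<in>I. of_nat (m i) * w i ^ k) = (\<Sum>i\<in>I. of_nat (m i) * w i)"
    using sum[of k] sum[of 1] by simp
  moreover have "w i ^ k = w i ^ j" if "i \<in> I" for i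
    using w[OF that] by (simp add: k_def power_add power_mult)
  ultimately show ?thesis by simp
qed

section \<open>An inequality for sums over totatives\<close>

lemma sum_powers_root:
  fixes u :: complex
  assumes "u ^ p = 1" "u \<noteq> 1" "p dvd n"
  shows "(\<Sum>j\<in>{0<..n}. u ^ j) = 0"
proof -
  have n: "u ^ n = 1" using assms by (auto simp: power_mult)
  have "{0<..n} = Suc ` {..<n}" by (auto simp: image_iff) (metis Suc_pred lessThan_iff Suc_le_eq)
  then have "(\<Sum>j\<in>{0<..n}. u ^ j) = (\<Sum>j<n. u ^ Suc j)" by (simp add: sum.reindex)
  also have "\<dots> = u * (\<Sum>j<n. u ^ j)" by (simp add: sum_distrib_left)
  also have "(1 - u) * (\<Sum>j<n. u ^ j) = 1 - u ^ n" by (rule one_diff_power_eq[symmetric])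
  then have "(\<Sum>j<n. u ^ j) = 0" using assms n by simp
  finally show ?thesis by simp
qed

text \<open>The sum over the full range vanishes, and the omitted multiples of \<open>p\<close>
  contribute \<open>p ^ n\<close> ones.\<close>

lemma sum_totatives_prime_power:
  fixes u :: complex
  assumes p: "prime p" and u: "u ^ p = 1" "u \<noteq> 1"
  shows "(\<Sum>j\<in>totatives (p ^ Suc n). u ^ j) = - of_nat (p ^ n)"
proof -
  have p0: "p > 0" using p by (rule prime_gt_0_nat)
  have inj: "inj_on ((*) p) {0<..p ^ n}" using p0 by (auto simp: inj_on_def)
  have "(\<Sum>j\<in>totatives (p ^ Suc n). u ^ j) = (\<Sum>j\<in>{0<..p ^ Suc n}. u ^ j) - (\<Sum>j\<in>(*) p ` {0<..p ^ n}. u ^ j)"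
    unfolding totatives_prime_power_Suc[OF p] using p0 by (intro sum_diff) auto
  also have "(\<Sum>j\<in>{0<..p ^ Suc n}. u ^ j) = 0" by (rule sum_powers_root[OF u]) simp
  also have "(\<Sum>j\<in>(*) p ` {0<..p ^ n}. u ^ j) = of_nat (p ^ n)"
    by (subst sum.reindex[OF inj]) (simp add: power_mult u)
  finally show ?thesis by simp
qed

text \<open>The powers of \<open>u\<close> depend on \<open>j\<close> modulo
  \<open>p ^ Suc n\<close> and those of \<open>w\<close> on \<open>j\<close> modulo
  \<open>N\<close>, so the Chinese remainder theorem factors the sum.\<close>

lemma sum_totatives_mult:
  fixes u w :: complex
  assumes p: "prime p" and u: "u ^ p = 1" "u \<noteq> 1" and N: "coprime p N" "N > 0" and w: "w ^ N = 1"
  shows "(\<Sum>j\<in>totatives (p ^ Suc n * N). (u * w) ^ j) = - of_nat (p ^ n) * (\<Sum>b\<in>totatives N. w ^ b)"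
proof (cases "N = 1")
  case True
  then show ?thesis using w sum_totatives_prime_power[OF p u, of n] by simp
next
  case False
  let ?q = "p ^ Suc n"
  have q: "1 < ?q" using p prime_gt_1_nat[of p] by (intro one_less_power) auto
  have uq: "u ^ ?q = 1" using u by (simp add: power_mult)
  have md: "x ^ (j mod k) = x ^ j" if "x ^ k = 1" for x :: complex and j k
  proof -
    have "x ^ j = x ^ (k * (j div k) + j mod k)" by simp
    also have "\<dots> = x ^ (j mod k)" using that by (simp only: power_add power_mult) simp
    finally show ?thesis by simp
  qed
  have bij: "bij_betw (\<lambda>x. (x mod ?q, x mod N)) (totatives (?q * N)) (totatives ?q \<times> totatives N)"
    using q N False by (intro bij_betw_totatives) auto
  have "(\<Sum>j\<in>totatives (?q * N). (u * w) ^ j) = (\<Sum>j\<in>totatives (?q * N). (\<lambda>(a, b). u ^ a * w ^ b) (j mod ?q, j mod N))"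
    by (simp only: md[OF uq] md[OF w] power_mult_distrib prod.case)
  also have "\<dots> = (\<Sum>(a, b)\<in>totatives ?q \<times> totatives N. u ^ a * w ^ b)"
    by (rule sum.reindex_bij_betw[OF bij])
  also have "\<dots> = (\<Sum>a\<in>totatives ?q. u ^ a) * (\<Sum>b\<in>totatives N. w ^ b)"
    by (simp add: sum_product sum.cartesian_product)
  finally show ?thesis using sum_totatives_prime_power[OF p u, of n] by simp
qed

text \<open>Adjoining a prime power \<open>a\<close> multiplies the right side by
  \<open>totient a\<close>. As that side is at least 3, it grows by at least
  \<open>3 * (totient a - 1)\<close>, and this is at least \<open>a\<close> because
  \<open>totient a \<ge> 2\<close> and \<open>3 * totient a \<ge> 2 * a\<close>. The prime power 3
  gives equality in the last estimates, which explains the bound on \<open>Y\<close>.\<close>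

lemma totient_prod_ge:
  fixes x :: "nat \<Rightarrow> nat"
  assumes "finite T" "\<And>p. p \<in> T \<Longrightarrow> prime p \<and> odd p \<and> x p > 0" and Y: "Y \<ge> (3::real)"
  shows "Y + (\<Sum>p\<in>T. real (p ^ x p)) \<le> Y * real (totient (\<Prod>p\<in>T. p ^ x p))"
  using assms(1,2)
proof (induction T rule: finite_induct)
  case (insert p T)
  let ?P = "\<Prod>p\<in>T. p ^ x p" and ?a = "p ^ x p"
  have p: "prime p" "odd p" "x p > 0" using insert by auto
  have "p \<noteq> 2" using p(2) by auto
  then have p3: "p \<ge> 3" using prime_ge_2_nat[OF p(1)] by simp
  have "coprime (p ^ x p) ?P"
  proof (intro prod_coprime_right)
    fix r assume "r \<in> T"
    then have "coprime p r" using insert p(1) primes_coprime[of p r] by auto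
    then show "coprime (p ^ x p) (r ^ x r)" by simp
  qed
  then have t: "totient (?a * ?P) = totient ?a * totient ?P" by (rule totient_mult_coprime)
  have ta: "totient ?a = p ^ (x p - 1) * (p - 1)" using p by (simp add: totient_prime_power)
  obtain m where m: "x p = Suc m" using p(3) by (cases "x p") auto
  have pm: "real p ^ m \<ge> 1" using p3 by simp
  define \<phi> where "\<phi> = real (totient ?a)"
  have f: "\<phi> = real p ^ m * (real p - 1)" using ta m p3 by (simp add: \<phi>_def of_nat_diff)
  have "1 * 2 \<le> real p ^ m * (real p - 1)" using pm p3 by (intro mult_mono) auto
  then have f2: "\<phi> \<ge> 2" using f by simp
  have "real p ^ m * (2 * real p) \<le> real p ^ m * (3 * (real p - 1))" using pm p3 by (intro mult_left_mono) auto
  then have fa: "2 * real ?a \<le> 3 * \<phi>" using f m by (simp add: algebra_simps)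
  let ?Y = "Y * real (totient ?P)"
  have IH: "Y + (\<Sum>p\<in>T. real (p ^ x p)) \<le> ?Y" using insert by auto
  moreover have "0 \<le> (\<Sum>p\<in>T. real (p ^ x p))" by (intro sum_nonneg) auto
  ultimately have Y3: "?Y \<ge> 3" using Y by linarith
  have "3 * (\<phi> - 1) \<le> ?Y * (\<phi> - 1)" using Y3 f2 by (intro mult_right_mono) auto
  then have "?Y + real ?a \<le> ?Y * \<phi>" using fa f2 by (simp add: right_diff_distrib)
  then have "Y + ((\<Sum>p\<in>T. real (p ^ x p)) + real ?a) \<le> ?Y * \<phi>" using IH by linarith
  then show ?case using insert t by (simp add: \<phi>_def mult_ac add_ac)
qed simp

lemma prod_multiplicity_dvd:
  assumes "finite T" "\<And>p. p \<in> T \<Longrightarrow> prime p"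
  shows "(\<Prod>p\<in>T. p ^ multiplicity p (N::nat)) dvd N"
  using assms
proof (induction T rule: finite_induct)
  case (insert p T)
  have "coprime (p ^ multiplicity p N) (\<Prod>r\<in>T. r ^ multiplicity r N)"
  proof (intro prod_coprime_right)
    fix r assume "r \<in> T"
    then have "coprime p r" using insert primes_coprime[of p r] by auto
    then show "coprime (p ^ multiplicity p N) (r ^ multiplicity r N)" by simp
  qed
  then show ?case using insert by (auto intro!: divides_mult multiplicity_dvd)
qed simp

text \<open>Let \<open>p ^ Suc n\<close> be the p-part of \<open>N\<close>. Summing out
  \<open>u\<close> turns the right side into \<open>totient N\<close> plus \<open>p ^ n\<close>
  times the real part of the totative sum of \<open>w\<close> for the remaining part of
  \<open>N\<close>. This is at least \<open>p ^ Suc n * totient P\<close>: directly for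
  \<open>w = 1\<close>, and by the bound 1 on the norms of the powers of \<open>w\<close> otherwise.
  Then \<open>totient_prod_ge\<close> with \<open>Y = p ^ Suc n\<close> takes care of the other
  primes of \<open>T\<close>.\<close>

theorem sum_totatives_ge:
  fixes u w :: complex
  assumes N: "odd N" and T: "finite T" "\<And>p. p \<in> T \<Longrightarrow> prime p \<and> p dvd N"
    and p: "p \<in> T" and u: "u ^ p = 1" "u \<noteq> 1"
    and w: "w ^ (N div (\<Prod>p\<in>T. p ^ multiplicity p N)) = 1"
  shows "(\<Sum>p\<in>T. real (p ^ multiplicity p N)) \<le> (\<Sum>j\<in>totatives N. 1 - Re ((u * w) ^ j))"
proof -
  let ?x = "\<lambda>p. multiplicity p N"
  define P where "P = (\<Prod>p\<in>T - {p}. p ^ ?x p)"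
  define M where "M = N div (\<Prod>p\<in>T. p ^ ?x p)"
  have N0: "N > 0" using N by (cases N) auto
  have pp: "prime p" "p dvd N" using T p by auto
  have odd: "odd r" if "r dvd N" for r using N that by (auto dest: dvd_trans)
  have "p \<noteq> 2" using odd[OF pp(2)] by auto
  then have p3: "p \<ge> 3" using prime_ge_2_nat[OF pp(1)] by simp
  have pos: "?x r > 0" if "r \<in> T" for r
    using T(2)[OF that] N0 by (auto simp: prime_multiplicity_gt_zero_iff)
  obtain n where n: "?x p = Suc n" using pos[OF p] by (cases "?x p") auto
  let ?q = "p ^ Suc n"
  have prodT: "(\<Prod>p\<in>T. p ^ ?x p) = ?q * P" using T p by (simp add: P_def prod.remove n)
  have "?q * P dvd N" using prod_multiplicity_dvd[OF T(1), of N] T(2) unfolding prodT by blast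
  then have Neq: "N = ?q * P * M" unfolding M_def prodT by simp
  have P0: "P > 0" and M0: "M > 0" using N0 Neq by auto
  have coM: "coprime p M"
  proof (rule prime_imp_coprime[OF pp(1)], rule)
    assume "p dvd M"
    then obtain m where "M = p * m" by auto
    then have "N = p ^ Suc (Suc n) * (P * m)" using Neq by simp
    then have "p ^ Suc (Suc n) dvd N" by (metis dvd_triv_left)
    then have "Suc (Suc n) \<le> ?x p" using pp N0 by (subst (asm) power_dvd_iff_le_multiplicity) auto
    then show False using n by simp
  qed
  have coP': "coprime r (\<Prod>s\<in>S. s ^ ?x s)" if "r \<in> T" "S \<subseteq> T - {r}" for r S
  proof (intro prod_coprime_right)
    fix s assume "s \<in> S"
    then have "coprime r s" using that T primes_coprime[of r s] by blast
    then show "coprime r (s ^ ?x s)" by simp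
  qed
  have coP: "coprime p P" unfolding P_def by (rule coP'[OF p]) simp
  have coPM: "coprime P M"
    unfolding P_def
  proof (intro prod_coprime_left)
    fix r assume r: "r \<in> T - {p}"
    have "\<not> r dvd M"
    proof
      assume "r dvd M"
      then have "r ^ ?x r * r dvd (\<Prod>p\<in>T. p ^ ?x p) * M"
        using r T by (intro mult_dvd_mono dvd_prodI) auto
      then have "r ^ Suc (?x r) dvd N" using Neq prodT by (simp add: mult.commute)
      then show False using multiplicity_geI[of N r "Suc (?x r)"] T(2)[of r] r N0 not_prime_unit by auto
    qed
    then show "coprime (r ^ ?x r) M" using r T prime_imp_coprime[of r M] by auto
  qed
  have coq: "coprime ?q (P * M)" using coP coM by simp
  have wN: "w ^ (P * M) = 1" using w by (simp add: M_def[symmetric] power_mult mult.commute[of P])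
  have Neq': "N = ?q * (P * M)" using Neq by simp
  have tq: "real (totient ?q) = real p ^ n * (real p - 1)"
    using totient_prime_power_Suc[OF pp(1), of n] p3 by (simp only:) (simp add: of_nat_diff)
  have tN: "real (totient N) = real (totient ?q) * (real (totient P) * real (totient M))"
    unfolding Neq' totient_mult_coprime[OF coq] totient_mult_coprime[OF coPM] by simp
  have "(\<Sum>j\<in>totatives N. 1 - Re ((u * w) ^ j)) = real (totient N) - Re (\<Sum>j\<in>totatives N. (u * w) ^ j)"
    by (simp add: sum_subtractf totient_def)
  also have "(\<Sum>j\<in>totatives N. (u * w) ^ j) = - of_nat (p ^ n) * (\<Sum>b\<in>totatives (P * M). w ^ b)"
    unfolding Neq' using coP coM P0 M0 wN by (intro sum_totatives_mult[OF pp(1) u]) auto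
  finally have S: "(\<Sum>j\<in>totatives N. 1 - Re ((u * w) ^ j)) =
      real (totient N) + real (p ^ n) * Re (\<Sum>b\<in>totatives (P * M). w ^ b)" by simp
  have tPM: "real (card (totatives (P * M))) = real (totient P) * real (totient M)"
    using totient_mult_coprime[OF coPM] by (simp add: totient_def)
  have "real ?q * real (totient P) \<le> (\<Sum>j\<in>totatives N. 1 - Re ((u * w) ^ j))"
  proof (cases "w = 1")
    case True
    have "1 * 1 \<le> real (totient M)" using M0 by (simp add: Suc_le_eq)
    then have "real ?q * (real (totient P) * 1) \<le> real ?q * (real (totient P) * real (totient M))"
      by (intro mult_left_mono) auto
    also have "\<dots> = (\<Sum>j\<in>totatives N. 1 - Re ((u * w) ^ j))"
    proof -
      have "Re (\<Sum>b\<in>totatives (P * M). w ^ b) = real (totient P) * real (totient M)"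
        using tPM True by simp
      then show ?thesis unfolding S tN tq by (simp add: algebra_simps)
    qed
    finally show ?thesis by simp
  next
    case False
    have "M \<noteq> 1" using False w by (auto simp: M_def[symmetric])
    then have M1: "M > 1" using M0 by simp
    have "odd M" using odd[of M] Neq by (metis dvd_triv_right)
    \<comment> \<open>Estimating the sum over \<open>w\<close> by norms turns the factor
      \<open>p - 1\<close> of the totient into \<open>p - 2\<close>, which \<open>totient M\<close>
      must make up for. If \<open>p = 3\<close>, then \<open>M\<close> is prime to 6 and has a prime
      factor at least 5, so \<open>totient M \<ge> 4\<close>; for larger \<open>p\<close> the value
      2 is enough.\<close>
    have tM: "real p \<le> (real p - 2) * real (totient M)"
    proof (cases "p = 3")
      case True
      obtain r where r: "prime r" "r dvd M" using prime_factor_nat \<open>M \<noteq> 1\<close> by blast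
      have "r \<noteq> 2" using r \<open>odd M\<close> by auto
      moreover have "r \<noteq> 3" using r coM True by (metis coprime_common_divisor dvd_refl not_prime_unit)
      moreover have "r \<noteq> 4" using r(1) prime_product[of 2 2] by auto
      ultimately have "r \<ge> 5" using prime_ge_2_nat[OF r(1)] by linarith
      moreover have "r - 1 \<le> totient M"
        using totient_dvd[OF r(2)] totient_prime[OF r(1)] M0 dvd_imp_le[of "totient r" "totient M"] by simp
      ultimately show ?thesis using True by simp
    next
      case False
      have "M > 2" using M1 \<open>odd M\<close> by (cases "M = 2") auto
      then have "2 \<le> real (totient M)" using totient_gt_1[of M] by simp
      then have "(real p - 2) * 2 \<le> (real p - 2) * real (totient M)" using p3 by (intro mult_left_mono) auto
      moreover have "p \<ge> 4" using False p3 by simp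
      ultimately show ?thesis by simp
    qed
    have nw: "norm w = 1" using power_eq_1_iff[OF wN] P0 M0 by simp
    have "Re (\<Sum>b\<in>totatives (P * M). - (w ^ b)) \<le> norm (\<Sum>b\<in>totatives (P * M). - (w ^ b))" by (rule complex_Re_le_cmod)
    also have "\<dots> \<le> (\<Sum>b\<in>totatives (P * M). 1)"
      by (intro order.trans[OF norm_sum] sum_mono) (simp add: norm_power nw)
    finally have ge: "- (real (totient P) * real (totient M)) \<le> Re (\<Sum>b\<in>totatives (P * M). w ^ b)"
      by (simp add: sum_negf tPM[symmetric])
    have "real ?q * real (totient P) = (real p ^ n * real (totient P)) * real p" by simp
    also have "\<dots> \<le> (real p ^ n * real (totient P)) * ((real p - 2) * real (totient M))"
      using tM by (intro mult_left_mono) auto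
    also have "\<dots> = real (totient N) + real (p ^ n) * (- (real (totient P) * real (totient M)))"
      unfolding tN tq by (simp add: algebra_simps)
    also have "\<dots> \<le> real (totient N) + real (p ^ n) * Re (\<Sum>b\<in>totatives (P * M). w ^ b)"
      using ge by (intro add_left_mono mult_left_mono) auto
    finally show ?thesis unfolding S .
  qed
  moreover have "real ?q + (\<Sum>p\<in>T - {p}. real (p ^ ?x p)) \<le> real ?q * real (totient P)"
    unfolding P_def
  proof (rule totient_prod_ge)
    have "real p * 1 \<le> real p * real p ^ n" using p3 by (intro mult_left_mono) auto
    then have "3 \<le> real p * real p ^ n" using p3 by linarith
    then show "3 \<le> real ?q" by simp
  qed (use T pos odd in auto)
  moreover have "(\<Sum>p\<in>T. real (p ^ ?x p)) = real ?q + (\<Sum>p\<in>T - {p}. real (p ^ ?x p))"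
    using T p by (simp add: sum.remove n)
  ultimately show ?thesis by linarith
qed

section \<open>Traces of matrix representations\<close>

text \<open>Membership in the unit group is traded for plain matrix equations; the image of
  \<open>inv g\<close> provides the inverse of \<open>\<rho> g\<close>.\<close>

lemma matrix_rep_iff:
  fixes \<rho> :: "'a \<Rightarrow> 'k::field mat"
  assumes "group G"
  shows "matrix_rep G n \<rho> \<longleftrightarrow> n > 0 \<and> (\<forall>g\<in>carrier G. \<rho> g \<in> carrier_mat n n) \<and>
    (\<forall>g\<in>carrier G. \<forall>h\<in>carrier G. \<rho> (g \<otimes>\<^bsub>G\<^esub> h) = \<rho> g * \<rho> h) \<and> \<rho> \<one>\<^bsub>G\<^esub> = 1\<^sub>m n" (is "?L \<longleftrightarrow> ?Q")
proof -
  let ?M = "ring_mat TYPE('k) n ()"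
  have U: "group (units_of ?M)" by (intro monoid.units_group ring.is_monoid ring_mat)
  show ?thesis
  proof
    assume L: ?L
    interpret group_hom G "units_of ?M" \<rho>
      using L U assms by (intro group_hom.intro group_hom_axioms.intro) (auto simp: matrix_rep_def)
    have "\<rho> g \<in> Units ?M" if "g \<in> carrier G" for g
      using hom_closed[OF that] by (simp add: units_of_def)
    then have c: "\<forall>g\<in>carrier G. \<rho> g \<in> carrier_mat n n" by (auto simp: Units_def ring_mat_simps)
    show ?Q
      using L c hom_mult hom_one by (auto simp: matrix_rep_def units_of_def ring_mat_simps)
  next
    assume Q: ?Q
    interpret group G by fact
    have "\<rho> g \<in> Units ?M" if "g \<in> carrier G" for g
    proof -
      have "\<rho> g * \<rho> (inv\<^bsub>G\<^esub> g) = 1\<^sub>m n" "\<rho> (inv\<^bsub>G\<^esub> g) * \<rho> g = 1\<^sub>m n"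
        using Q that by (metis inv_closed r_inv l_inv)+
      then show ?thesis using Q that by (auto simp: Units_def ring_mat_simps)
    qed
    then show ?L using Q by (auto simp: matrix_rep_def hom_def units_of_def ring_mat_simps)
  qed
qed

lemma mat_trace_mult_comm:
  fixes A :: "'k::comm_semiring_0 mat"
  assumes "A \<in> carrier_mat n m" "B \<in> carrier_mat m n"
  shows "mat_trace (A * B) = mat_trace (B * A)"
proof -
  have "mat_trace (A * B) = (\<Sum>i<n. \<Sum>j<m. A $$ (i, j) * B $$ (j, i))"
    using assms by (auto simp: mat_trace_def scalar_prod_def atLeast0LessThan intro!: sum.cong)
  also have "\<dots> = (\<Sum>j<m. \<Sum>i<n. B $$ (j, i) * A $$ (i, j))"
    by (subst sum.swap) (simp add: mult.commute)
  also have "\<dots> = mat_trace (B * A)"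
    using assms by (auto simp: mat_trace_def scalar_prod_def atLeast0LessThan intro!: sum.cong)
  finally show ?thesis .
qed

lemma mat_trace_similar:
  fixes A :: "'k::comm_ring_1 mat"
  assumes "A \<in> carrier_mat n n" "P \<in> carrier_mat n n" "Q \<in> carrier_mat n n" "Q * P = 1\<^sub>m n"
  shows "mat_trace (P * A * Q) = mat_trace A"
proof -
  have "mat_trace (P * A * Q) = mat_trace (Q * (P * A))"
    using assms by (intro mat_trace_mult_comm[of _ n n]) auto
  also have "Q * (P * A) = (Q * P) * A" using assms by (intro assoc_mult_mat[symmetric]) auto
  finally show ?thesis using assms by simp
qed

text \<open>A Schur decomposition gives a similar upper triangular idempotent \<open>B\<close>. Its
  diagonal entries are 0 or 1, and the trace counts the ones.\<close>

lemma idempotent_mat_trace: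
  fixes E :: "complex mat"
  assumes E: "E \<in> carrier_mat n n" and idem: "E * E = E"
  shows "mat_trace E \<in> \<nat>" "mat_trace E = 0 \<Longrightarrow> E = 0\<^sub>m n n"
proof -
  obtain es where es: "char_poly E = (\<Prod>a\<leftarrow>es. [:- a, 1:])" using char_poly_factorized[OF E] by auto
  obtain B P Q where "schur_decomposition E es = (B, P, Q)" by (cases "schur_decomposition E es") auto
  then have sim: "similar_mat_wit E B P Q" and up: "upper_triangular B" using schur_decomposition[OF E es] by auto
  note s = similar_mat_witD2[OF E sim]
  have c: "B \<in> carrier_mat n n" "P \<in> carrier_mat n n" "Q \<in> carrier_mat n n" using s by auto
  have PQ: "P * Q = 1\<^sub>m n" "Q * P = 1\<^sub>m n" and Eeq: "E = P * B * Q" using s by auto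
  have Beq: "B = Q * E * P"
  proof -
    have "Q * E * P = Q * (P * B * Q) * P" by (simp only: Eeq[symmetric])
    also have "\<dots> = (Q * P) * B * (Q * P)" using c by (simp add: assoc_mult_mat[of _ n n _ n _ n])
    finally show ?thesis using c PQ by simp
  qed
  have "B * B = Q * E * P * (Q * E * P)" by (simp only: Beq[symmetric])
  also have "\<dots> = Q * (E * (P * Q) * E) * P" using c E by (simp add: assoc_mult_mat[of _ n n _ n _ n])
  also have "\<dots> = B" using E PQ idem by (simp add: Beq)
  finally have BB: "B * B = B" .
  have ent: "B $$ (i, j) = (\<Sum>k<n. B $$ (i, k) * B $$ (k, j))" if "i < n" "j < n" for i j
  proof -
    have "B $$ (i, j) = (B * B) $$ (i, j)" by (simp only: BB)
    also have "\<dots> = (\<Sum>k<n. B $$ (i, k) * B $$ (k, j))"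
      using that c by (simp add: scalar_prod_def atLeast0LessThan)
    finally show ?thesis .
  qed
  have low: "B $$ (i, j) = 0" if "j < i" "i < n" for i j using up that c by auto
  have diag: "B $$ (i, i) = 0 \<or> B $$ (i, i) = 1" if "i < n" for i
  proof -
    have "B $$ (i, i) = (\<Sum>k<n. B $$ (i, k) * B $$ (k, i))" by (rule ent[OF that that])
    also have "\<dots> = (\<Sum>k<n. if k = i then B $$ (i, i) * B $$ (i, i) else 0)"
    proof (intro sum.cong refl)
      fix k assume "k \<in> {..<n}"
      then show "B $$ (i, k) * B $$ (k, i) = (if k = i then B $$ (i, i) * B $$ (i, i) else 0)"
        using low[of k i] low[of i k] that by (cases k i rule: linorder_cases) auto
    qed
    finally have "B $$ (i, i) * (1 - B $$ (i, i)) = 0" using that by (simp add: algebra_simps)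
    then show ?thesis by auto
  qed
  have tr: "mat_trace E = (\<Sum>i<n. B $$ (i, i))"
    unfolding Eeq using mat_trace_similar[OF c(1,2,3) PQ(2)] c by (simp add: mat_trace_def)
  also have "\<dots> = (\<Sum>i<n. of_nat (if B $$ (i, i) = 1 then 1 else 0))"
    using diag by (intro sum.cong) auto
  finally have tr2: "mat_trace E = of_nat (\<Sum>i<n. if B $$ (i, i) = 1 then 1 else 0)" by simp
  show "mat_trace E \<in> \<nat>" unfolding tr2 by (rule of_nat_in_Nats)
  assume "mat_trace E = 0"
  then have "(\<Sum>i<n. if B $$ (i, i) = 1 then 1 else 0 :: nat) = 0" using tr2 by (metis of_nat_eq_0_iff)
  then have "(if B $$ (i, i) = 1 then 1 else 0 :: nat) = 0" if "i < n" for i using that by simp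
  then have d0: "B $$ (i, i) = 0" if "i < n" for i
    using diag[OF that] that by (metis zero_neq_one)
  \<comment> \<open>With zero diagonal, \<open>B = B * B\<close> expresses an entry through products
    of entries closer to the diagonal, so induction on \<open>j - i\<close> applies.\<close>
  have "B $$ (i, j) = 0" if "i < n" "j < n" for i j
    using that
  proof (induction "j - i" arbitrary: i j rule: less_induct)
    case less
    show ?case
    proof (cases "i < j")
      case False
      then show ?thesis using low[of j i] d0[of i] less.prems by (cases "i = j") auto
    next
      case True
      have "B $$ (i, k) * B $$ (k, j) = 0" if "k < n" for k
      proof (cases "i < k \<and> k < j")
        case True
        then have "B $$ (i, k) = 0" using less that by auto
        then show ?thesis by simp
      next
        case False
        then show ?thesis using low[of k i] low[of j k] d0 less.prems that \<open>i < j\<close>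
          by (metis linorder_neqE_nat mult_eq_0_iff)
      qed
      then have "(\<Sum>k<n. B $$ (i, k) * B $$ (k, j)) = 0" by (intro sum.neutral) simp
      then show ?thesis using ent[OF less.prems] by simp
    qed
  qed
  then have "B = 0\<^sub>m n n" using c by (intro eq_matI) auto
  then show "E = 0\<^sub>m n n" unfolding Eeq using c by simp
qed

section \<open>Projections to the eigenspaces of linear characters\<close>

locale complex_rep = group G for G (structure) +
  fixes n :: nat and \<rho> :: "'a \<Rightarrow> complex mat"
  assumes fin: "finite (carrier G)" and rep: "matrix_rep G n \<rho>"
begin

lemma rep_carrier [simp]: "g \<in> carrier G \<Longrightarrow> \<rho> g \<in> carrier_mat n n"
  and rep_mult: "g \<in> carrier G \<Longrightarrow> h \<in> carrier G \<Longrightarrow> \<rho> (g \<otimes> h) = \<rho> g * \<rho> h"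
  and rep_one: "\<rho> \<one> = 1\<^sub>m n"
  using rep matrix_rep_iff[OF is_group, of n \<rho>] by auto

lemma rep_dim [simp]: "g \<in> carrier G \<Longrightarrow> dim_row (\<rho> g) = n" "g \<in> carrier G \<Longrightarrow> dim_col (\<rho> g) = n"
  using rep_carrier by blast+

lemma rep_character_one: "rep_character \<rho> \<one> = of_nat n"
  by (simp add: rep_character_def rep_one mat_trace_def)

lemma rep_character_conj:
  assumes "g \<in> carrier G" "x \<in> carrier G"
  shows "rep_character \<rho> (g \<otimes> x \<otimes> inv g) = rep_character \<rho> x"
  using assms mat_trace_similar[of "\<rho> x" n "\<rho> g" "\<rho> (inv g)"]
  by (simp add: rep_character_def rep_mult[symmetric] rep_one)

text \<open>The average over \<open>H\<close> of the matrices \<open>\<rho> h\<close> weighted with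
  the conjugates of \<open>\<chi> h\<close>, that is, the projection to the eigenspace of
  \<open>H\<close> for \<open>\<chi>\<close>. The entrywise form lets the trace reduce to
  \<open>char_mult\<close>.\<close>

definition char_proj :: "'a set \<Rightarrow> ('a \<Rightarrow> complex) \<Rightarrow> complex mat" where
  "char_proj H \<chi> = mat n n (\<lambda>(i, j). char_mult (\<lambda>h. \<rho> h $$ (i, j)) H \<chi>)"

lemma trace_char_proj: "H \<subseteq> carrier G \<Longrightarrow> mat_trace (char_proj H \<chi>) = char_mult (rep_character \<rho>) H \<chi>"
proof -
  assume H: "H \<subseteq> carrier G"
  have "mat_trace (char_proj H \<chi>) = (\<Sum>i<n. \<Sum>h\<in>H. \<rho> h $$ (i, i) * cnj (\<chi> h)) / of_nat (card H)"
    by (simp add: mat_trace_def char_proj_def char_mult_def sum_divide_distrib)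
  also have "(\<Sum>i<n. \<Sum>h\<in>H. \<rho> h $$ (i, i) * cnj (\<chi> h)) = (\<Sum>h\<in>H. rep_character \<rho> h * cnj (\<chi> h))"
    using H by (subst sum.swap) (auto simp: rep_character_def mat_trace_def sum_distrib_right subset_iff intro!: sum.cong)
  finally show ?thesis by (simp add: char_mult_def)
qed

lemma rep_mult_char_proj:
  assumes H: "subgroup H G" and \<chi>: "\<chi> \<in> lin_chars G H" and g: "g \<in> H"
  shows "\<rho> g * char_proj H \<chi> = \<chi> g \<cdot>\<^sub>m char_proj H \<chi>"
proof (rule eq_matI)
  have Hc: "h \<in> carrier G" if "h \<in> H" for h using subgroup.mem_carrier[OF H that] .
  have bij: "bij_betw (\<lambda>h. g \<otimes> h) H H"
    using g H Hc by (intro bij_betw_byWitness[of _ "\<lambda>h. inv g \<otimes> h"])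
      (auto simp: cancel_l1 cancel_l2 subgroup.m_closed subgroup.m_inv_closed)
  fix i j assume "i < dim_row (\<chi> g \<cdot>\<^sub>m char_proj H \<chi>)" "j < dim_col (\<chi> g \<cdot>\<^sub>m char_proj H \<chi>)"
  then have ij: "i < n" "j < n" by (auto simp: char_proj_def)
  have "(\<rho> g * char_proj H \<chi>) $$ (i, j) = (\<Sum>k<n. \<rho> g $$ (i, k) * ((\<Sum>h\<in>H. \<rho> h $$ (k, j) * cnj (\<chi> h)) / of_nat (card H)))"
    using ij g Hc by (simp add: char_proj_def scalar_prod_def atLeast0LessThan char_mult_def)
  also have "\<dots> = (\<Sum>h\<in>H. (\<Sum>k<n. \<rho> g $$ (i, k) * \<rho> h $$ (k, j)) * cnj (\<chi> h)) / of_nat (card H)"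
    by (simp add: sum_divide_distrib sum_distrib_left sum_distrib_right mult.assoc) (rule sum.swap)
  also have "(\<Sum>h\<in>H. (\<Sum>k<n. \<rho> g $$ (i, k) * \<rho> h $$ (k, j)) * cnj (\<chi> h)) = (\<Sum>h\<in>H. \<rho> (g \<otimes> h) $$ (i, j) * (\<chi> g * cnj (\<chi> (g \<otimes> h))))"
  proof (intro sum.cong refl)
    fix h assume h: "h \<in> H"
    have "(\<Sum>k<n. \<rho> g $$ (i, k) * \<rho> h $$ (k, j)) = \<rho> (g \<otimes> h) $$ (i, j)"
      using ij g h Hc by (simp add: rep_mult scalar_prod_def atLeast0LessThan)
    moreover have "\<chi> g * cnj (\<chi> (g \<otimes> h)) = \<chi> g * cnj (\<chi> g) * cnj (\<chi> h)"
      using lin_chars_mult[OF \<chi> g h] by simp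
    ultimately show "(\<Sum>k<n. \<rho> g $$ (i, k) * \<rho> h $$ (k, j)) * cnj (\<chi> h) = \<rho> (g \<otimes> h) $$ (i, j) * (\<chi> g * cnj (\<chi> (g \<otimes> h)))"
      using lin_chars_cnj[OF H \<chi> g fin] by simp
  qed
  also have "\<dots> = (\<Sum>h\<in>H. \<rho> h $$ (i, j) * (\<chi> g * cnj (\<chi> h)))"
    by (rule sum.reindex_bij_betw[OF bij, of "\<lambda>h. \<rho> h $$ (i, j) * (\<chi> g * cnj (\<chi> h))"])
  also have "\<dots> / of_nat (card H) = (\<chi> g \<cdot>\<^sub>m char_proj H \<chi>) $$ (i, j)"
    using ij by (simp add: char_proj_def char_mult_def sum_distrib_left mult_ac)
  finally show "(\<rho> g * char_proj H \<chi>) $$ (i, j) = (\<chi> g \<cdot>\<^sub>m char_proj H \<chi>) $$ (i, j)" .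
qed (use subgroup.mem_carrier[OF H g] in \<open>auto simp: char_proj_def\<close>)

lemma char_proj_idem:
  assumes H: "subgroup H G" and \<chi>: "\<chi> \<in> lin_chars G H"
  shows "char_proj H \<chi> * char_proj H \<chi> = char_proj H \<chi>"
proof (rule eq_matI)
  let ?E = "char_proj H \<chi>"
  have Hc: "h \<in> carrier G" if "h \<in> H" for h using subgroup.mem_carrier[OF H that] .
  have c0: "card H > 0" using finite_subset[OF subgroup.subset[OF H] fin] subgroup.one_closed[OF H] by (auto simp: card_gt_0_iff)
  fix i j assume "i < dim_row ?E" "j < dim_col ?E"
  then have ij: "i < n" "j < n" by (auto simp: char_proj_def)
  have E: "?E $$ (i, k) = (\<Sum>h\<in>H. \<rho> h $$ (i, k) * cnj (\<chi> h)) / of_nat (card H)" if "k < n" for k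
    using ij that by (simp add: char_proj_def char_mult_def)
  have "(?E * ?E) $$ (i, j) = (\<Sum>k<n. ?E $$ (i, k) * ?E $$ (k, j))"
    using ij by (simp add: char_proj_def scalar_prod_def atLeast0LessThan)
  also have "\<dots> = (\<Sum>k<n. \<Sum>h\<in>H. cnj (\<chi> h) * (\<rho> h $$ (i, k) * ?E $$ (k, j))) / of_nat (card H)"
    by (simp add: E sum_divide_distrib sum_distrib_right sum_distrib_left mult_ac)
  also have "(\<Sum>k<n. \<Sum>h\<in>H. cnj (\<chi> h) * (\<rho> h $$ (i, k) * ?E $$ (k, j))) = (\<Sum>h\<in>H. cnj (\<chi> h) * (\<rho> h * ?E) $$ (i, j))"
    using ij Hc by (subst sum.swap) (auto simp: char_proj_def scalar_prod_def atLeast0LessThan sum_distrib_left intro!: sum.cong)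
  also have "\<dots> = (\<Sum>h\<in>H. ?E $$ (i, j))"
  proof (intro sum.cong refl)
    fix h assume h: "h \<in> H"
    have "cnj (\<chi> h) * (\<rho> h * ?E) $$ (i, j) = cnj (\<chi> h) * (\<chi> h * ?E $$ (i, j))"
      unfolding rep_mult_char_proj[OF H \<chi> h] using ij by (simp add: char_proj_def)
    also have "\<dots> = (\<chi> h * cnj (\<chi> h)) * ?E $$ (i, j)" by simp
    finally show "cnj (\<chi> h) * (\<rho> h * ?E) $$ (i, j) = ?E $$ (i, j)" using lin_chars_cnj[OF H \<chi> h fin] by simp
  qed
  finally show "(?E * ?E) $$ (i, j) = ?E $$ (i, j)" using c0 by simp
qed (auto simp: char_proj_def)

lemma char_proj_carrier: "char_proj H \<chi> \<in> carrier_mat n n" by (simp add: char_proj_def)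

theorem char_mult_nat:
  assumes H: "subgroup H G" and \<chi>: "\<chi> \<in> lin_chars G H"
  shows "char_mult (rep_character \<rho>) H \<chi> \<in> \<nat>"
  using idempotent_mat_trace(1)[OF char_proj_carrier char_proj_idem[OF assms]]
    trace_char_proj[OF subgroup.subset[OF H]] by simp

text \<open>The projection to the fixed vectors has trace \<open>n\<close>, hence is the identity.\<close>
theorem kernel_rep_character:
  assumes H: "subgroup H G" and n: "\<And>h. h \<in> H \<Longrightarrow> rep_character \<rho> h = of_nat n" and g: "g \<in> H"
  shows "\<rho> g = 1\<^sub>m n"
proof -
  let ?\<chi> = "\<lambda>x. if x \<in> H then 1 else 0 :: complex"
  let ?E = "char_proj H ?\<chi>"
  have \<chi>: "?\<chi> \<in> lin_chars G H" using H by (rule indicator_lin_char)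
  have c0: "card H > 0" using finite_subset[OF subgroup.subset[OF H] fin] subgroup.one_closed[OF H] by (auto simp: card_gt_0_iff)
  have E: "?E \<in> carrier_mat n n" by (rule char_proj_carrier)
  have "mat_trace ?E = of_nat n"
    unfolding trace_char_proj[OF subgroup.subset[OF H]] char_mult_def using n c0 by simp
  moreover have "mat_trace (1\<^sub>m n - ?E) = of_nat n - mat_trace ?E"
    using E by (simp add: mat_trace_def sum_subtractf)
  ultimately have tr: "mat_trace (1\<^sub>m n - ?E) = 0" by simp
  have "(1\<^sub>m n - ?E) * (1\<^sub>m n - ?E) = 1\<^sub>m n * (1\<^sub>m n - ?E) - ?E * (1\<^sub>m n - ?E)"
    using E by (intro minus_mult_distrib_mat) auto
  also have "?E * (1\<^sub>m n - ?E) = ?E * 1\<^sub>m n - ?E * ?E" using E by (intro mult_minus_distrib_mat) auto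
  also have "\<dots> = 0\<^sub>m n n" using E char_proj_idem[OF H \<chi>] by simp
  finally have "(1\<^sub>m n - ?E) * (1\<^sub>m n - ?E) = 1\<^sub>m n - ?E" using E by (auto intro!: eq_matI)
  then have "1\<^sub>m n - ?E = 0\<^sub>m n n" using tr E by (intro idempotent_mat_trace(2)) auto
  have "?E = 1\<^sub>m n"
  proof (rule eq_matI)
    fix i j assume ij: "i < dim_row (1\<^sub>m n)" "j < dim_col (1\<^sub>m n :: complex mat)"
    have "(1\<^sub>m n - ?E) $$ (i, j) = 0\<^sub>m n n $$ (i, j)" by (simp only: \<open>1\<^sub>m n - ?E = 0\<^sub>m n n\<close>)
    then show "?E $$ (i, j) = 1\<^sub>m n $$ (i, j)" using ij E by simp
  qed (use E in auto)
  then show ?thesis using rep_mult_char_proj[OF H \<chi> g] g subgroup.mem_carrier[OF H g] by auto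
qed

end

section \<open>Permutation representations\<close>

text \<open>The set \<open>\<Omega>\<close> is numbered by an initial segment of
  \<open>{1..n}\<close>, and all further points are fixed; so \<open>n\<close> may exceed the size
  of \<open>\<Omega>\<close>.\<close>

lemma mon_sym_group_if_faithful_action:
  fixes G (structure)
  assumes G: "group G" and fin: "finite \<Omega>" and card: "card \<Omega> \<le> n"
    and act: "\<And>x w. x \<in> carrier G \<Longrightarrow> w \<in> \<Omega> \<Longrightarrow> a x w \<in> \<Omega>"
    and act_mult: "\<And>x y w. x \<in> carrier G \<Longrightarrow> y \<in> carrier G \<Longrightarrow> w \<in> \<Omega> \<Longrightarrow> a (x \<otimes> y) w = a x (a y w)"
    and act_one: "\<And>w. w \<in> \<Omega> \<Longrightarrow> a \<one> w = w"
    and faithful: "\<And>x. x \<in> carrier G \<Longrightarrow> (\<And>w. w \<in> \<Omega> \<Longrightarrow> a x w = w) \<Longrightarrow> x = \<one>"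
  shows "mon G (sym_group n) \<noteq> {}"
proof -
  interpret group G by fact
  define N where "N = card \<Omega>"
  have "\<exists>f. bij_betw f \<Omega> {1..N}" by (rule finite_same_card_bij[OF fin]) (simp_all add: N_def)
  then obtain f where f: "bij_betw f \<Omega> {1..N}" by blast
  define g where "g = inv_into \<Omega> f"
  have g: "i \<in> {1..N} \<Longrightarrow> g i \<in> \<Omega>" "i \<in> {1..N} \<Longrightarrow> f (g i) = i" "w \<in> \<Omega> \<Longrightarrow> g (f w) = w" "w \<in> \<Omega> \<Longrightarrow> f w \<in> {1..N}" for i w
    using inv_into_into[of i f \<Omega>] f_inv_into_f[of i f \<Omega>] bij_betw_imp_surj_on[OF f]
      bij_betw_inv_into_left[OF f, of w] bij_betwE[OF f] unfolding g_def by auto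
  define \<phi> where "\<phi> x i = (if i \<in> {1..N} then f (a x (g i)) else i)" for x i
  have in_N: "\<phi> x i \<in> {1..N}" if "x \<in> carrier G" "i \<in> {1..N}" for x i
    using that g(4)[OF act[OF that(1) g(1)[OF that(2)]]] by (simp add: \<phi>_def)
  have mult: "\<phi> (x \<otimes> y) = \<phi> x \<circ> \<phi> y" if xy: "x \<in> carrier G" "y \<in> carrier G" for x y
  proof
    fix i show "\<phi> (x \<otimes> y) i = (\<phi> x \<circ> \<phi> y) i"
    proof (cases "i \<in> {1..N}")
      case True
      then have "\<phi> y i \<in> {1..N}" using in_N xy by blast
      then have "\<phi> x (\<phi> y i) = f (a x (g (\<phi> y i)))" by (simp only: \<phi>_def[of x] if_True)
      also have "g (\<phi> y i) = a y (g i)" using True g act xy by (simp only: \<phi>_def if_True)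
      finally show ?thesis using True act_mult[OF xy g(1)[OF True]] by (simp add: \<phi>_def[of "x \<otimes> y"])
    qed (auto simp: \<phi>_def)
  qed
  have one: "\<phi> \<one> = id" using act_one g by (auto simp: \<phi>_def fun_eq_iff)
  have perm: "\<phi> x permutes {1..n}" if x: "x \<in> carrier G" for x
  proof (rule permutes_subset[of _ "{1..N}"])
    have "\<phi> x (\<phi> (inv x) i) = i" "\<phi> (inv x) (\<phi> x i) = i" for i
      using fun_cong[OF mult[of x "inv x"], of i] fun_cong[OF mult[of "inv x" x], of i] one x by simp_all
    then have "bij_betw (\<phi> x) {1..N} {1..N}"
      using in_N[OF x] in_N[of "inv x"] x by (intro bij_betw_byWitness[of _ "\<phi> (inv x)"]) auto
    then show "\<phi> x permutes {1..N}" by (rule bij_imp_permutes) (simp only: \<phi>_def if_False)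
  qed (use card in \<open>auto simp: N_def\<close>)
  have "inj_on \<phi> (carrier G)"
  proof (rule inj_onI)
    fix x y assume xy: "x \<in> carrier G" "y \<in> carrier G" "\<phi> x = \<phi> y"
    have "\<phi> (x \<otimes> inv y) = \<phi> y \<circ> \<phi> (inv y)" using mult[of x "inv y"] xy by simp
    also have "\<dots> = \<phi> (y \<otimes> inv y)" using mult[of y "inv y"] xy by simp
    finally have e: "\<phi> (x \<otimes> inv y) = id" using one xy by simp
    have "x \<otimes> inv y = \<one>"
    proof (rule faithful)
      fix w assume w: "w \<in> \<Omega>"
      have "\<phi> (x \<otimes> inv y) (f w) = f w" using e by simp
      then have "f (a (x \<otimes> inv y) w) = f w" using g(3)[OF w] g(4)[OF w] by (simp only: \<phi>_def if_True)
      then show "a (x \<otimes> inv y) w = w"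
        using g(3)[OF w] g(3)[OF act[of "x \<otimes> inv y", OF _ w]] xy by simp
    qed (use xy in simp)
    then show "x = y" using xy inv_equality[of x "inv y"] by simp
  qed
  moreover have "\<phi> \<in> hom G (sym_group n)"
    using perm mult by (auto simp: hom_def sym_group_def)
  ultimately show ?thesis by (auto simp: mon_def)
qed

text \<open>The group acts on the disjoint union of its coset spaces, tagged by \<open>j\<close> so
  that equal subgroups count separately. An element acts trivially only if all its conjugates lie in
  all \<open>K j\<close>.\<close>

theorem mon_sym_group_if_subgroup_family:
  fixes G (structure) and K :: "'i \<Rightarrow> 'a set"
  assumes G: "group G" and finG: "finite (carrier G)" and J: "finite J"
    and K: "\<And>j. j \<in> J \<Longrightarrow> subgroup (K j) G"
    and index: "(\<Sum>j\<in>J. card (rcosets (K j))) \<le> n"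
    and core: "\<And>x. x \<in> carrier G \<Longrightarrow> x \<noteq> \<one> \<Longrightarrow>
      \<exists>j\<in>J. \<exists>g\<in>carrier G. g \<otimes> x \<otimes> inv g \<notin> K j"
  shows "mon G (sym_group n) \<noteq> {}"
proof -
  interpret group G by fact
  let ?O = "SIGMA j:J. rcosets (K j)"
  have Kc: "K j \<subseteq> carrier G" if "j \<in> J" for j using subgroup.subset[OF K[OF that]] .
  have cos: "C \<subseteq> carrier G" if "j \<in> J" "C \<in> rcosets (K j)" for j C
    using that Kc rcosets_subset_PowG[OF K[OF that(1)]] by auto
  have fin: "finite (rcosets (K j))" if "j \<in> J" for j
    using finG rcosets_subset_PowG[OF K[OF that]] by (meson finite_Pow_iff finite_subset)
  have assoc: "(C #> x) #> y = C #> (x \<otimes> y)" if "C \<subseteq> carrier G" "x \<in> carrier G" "y \<in> carrier G" for C x y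
    using coset_mult_assoc[OF that] .
  \<comment> \<open>Multiplying right cosets by \<open>inv x\<close> turns the right action into a
    left one.\<close>
  show ?thesis
  proof (rule mon_sym_group_if_faithful_action[where \<Omega> = ?O and a = "\<lambda>x (j, C). (j, C #> inv x)"])
    show "finite ?O" using J fin by (intro finite_SigmaI) auto
    show "card ?O \<le> n" using index J fin by (simp add: card_SigmaI)
    show "(case w of (j, C) \<Rightarrow> (j, C #> inv x)) \<in> ?O" if x: "x \<in> carrier G" and w: "w \<in> ?O" for x w
    proof -
      obtain j g where "w = (j, K j #> g)" "j \<in> J" "g \<in> carrier G" using w by (auto simp: RCOSETS_def)
      then show ?thesis using x Kc by (auto simp: assoc RCOSETS_def)
    qed
    show "(case w of (j, C) \<Rightarrow> (j, C #> inv (x \<otimes> y))) =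
        (case (case w of (j, C) \<Rightarrow> (j, C #> inv y)) of (j, C) \<Rightarrow> (j, C #> inv x))"
      if "x \<in> carrier G" "y \<in> carrier G" "w \<in> ?O" for x y w
      using that cos by (auto simp: assoc inv_mult_group)
    show "(case w of (j, C) \<Rightarrow> (j, C #> inv \<one>)) = w" if "w \<in> ?O" for w
      using that cos by (auto simp: coset_mult_one)
    show "x = \<one>" if x: "x \<in> carrier G" and fixd: "\<And>w. w \<in> ?O \<Longrightarrow> (case w of (j, C) \<Rightarrow> (j, C #> inv x)) = w" for x
    proof (rule ccontr)
      assume "x \<noteq> \<one>"
      then obtain j g where jg: "j \<in> J" "g \<in> carrier G" "g \<otimes> x \<otimes> inv g \<notin> K j" using core x by blast
      have "(j, K j #> g) \<in> ?O" using jg by (auto simp: RCOSETS_def)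
      from fixd[OF this] have "K j #> (g \<otimes> inv x) = K j #> g" using jg x Kc by (simp add: assoc)
      then have "(g \<otimes> inv x) \<in> K j #> g"
        using rcos_self[OF _ K[OF jg(1)], of "g \<otimes> inv x"] jg x by simp
      then obtain k where k: "k \<in> K j" "g \<otimes> inv x = k \<otimes> g" by (auto simp: r_coset_def)
      have kc: "k \<in> carrier G" using k Kc jg by auto
      have "inv k = inv (g \<otimes> inv x \<otimes> inv g)" using k kc jg x by (simp add: m_assoc)
      also have "\<dots> = g \<otimes> x \<otimes> inv g" using jg x by (simp add: inv_mult_group m_assoc)
      finally show False using subgroup.m_inv_closed[OF K[OF jg(1)] k(1)] jg by simp
    qed
  qed (rule G)
qed

theorem rational_rep_if_mon_sym_group:
  fixes G :: "('a, 'b) monoid_scheme" (structure)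
  assumes G: "group G" and mon: "mon G (sym_group n) \<noteq> {}" and n: "n > 0"
  shows "\<exists>\<rho> :: 'a \<Rightarrow> rat mat. faithful_quasi_perm_rep G n \<rho>"
proof -
  interpret group G by fact
  obtain \<phi> where \<phi>: "\<phi> \<in> hom G (sym_group n)" "inj_on \<phi> (carrier G)" using mon by (auto simp: mon_def)
  have perm: "\<phi> g permutes {1..n}" if "g \<in> carrier G" for g
    using \<phi>(1) that by (auto simp: hom_def sym_group_def)
  have mult: "\<phi> (g \<otimes> h) = \<phi> g \<circ> \<phi> h" if "g \<in> carrier G" "h \<in> carrier G" for g h
    using \<phi>(1) that by (auto simp: hom_def sym_group_def)
  have one: "\<phi> \<one> = id"
    using hom_one[OF \<phi>(1) is_group sym_group_is_group] by (simp add: sym_group_def)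
  \<comment> \<open>Matrix indices start at 0 and the permuted points at 1, hence the shift by
    \<open>Suc\<close>.\<close>
  define \<rho> where "\<rho> g = mat n n (\<lambda>(i, j). if \<phi> g (Suc j) = Suc i then 1 else (0 :: rat))" for g
  have "matrix_rep G n \<rho>"
    unfolding matrix_rep_iff[OF G]
  proof (intro conjI ballI)
    show "\<rho> g \<in> carrier_mat n n" for g by (simp add: \<rho>_def)
    show "\<rho> \<one> = 1\<^sub>m n" by (auto simp: \<rho>_def one intro!: eq_matI)
    fix g h assume gh: "g \<in> carrier G" "h \<in> carrier G"
    show "\<rho> (g \<otimes> h) = \<rho> g * \<rho> h"
    proof (rule eq_matI)
      fix i j assume "i < dim_row (\<rho> g * \<rho> h)" "j < dim_col (\<rho> g * \<rho> h)"
      then have ij: "i < n" "j < n" by (auto simp: \<rho>_def)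
      have "\<phi> h (Suc j) \<in> {1..n}" using permutes_in_image[OF perm[OF gh(2)], of "Suc j"] ij by simp
      then obtain k where k: "\<phi> h (Suc j) = Suc k" "k < n" by (cases "\<phi> h (Suc j)") auto
      have "(\<rho> g * \<rho> h) $$ (i, j) = (\<Sum>l<n. \<rho> g $$ (i, l) * \<rho> h $$ (l, j))"
        using ij by (simp add: \<rho>_def scalar_prod_def atLeast0LessThan)
      also have "\<dots> = (\<Sum>l<n. if l = k then (if \<phi> g (Suc l) = Suc i then 1 else 0) else 0)"
        using ij k by (intro sum.cong) (auto simp: \<rho>_def)
      finally show "\<rho> (g \<otimes> h) $$ (i, j) = (\<rho> g * \<rho> h) $$ (i, j)"
        using ij k by (simp add: \<rho>_def mult[OF gh])
    qed (auto simp: \<rho>_def)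
  qed (rule n)
  moreover have "inj_on \<rho> (carrier G)"
  proof (rule inj_onI)
    fix g h assume gh: "g \<in> carrier G" "h \<in> carrier G" "\<rho> g = \<rho> h"
    have "\<phi> g i = \<phi> h i" for i
    proof (cases "i \<in> {1..n}")
      case True
      then obtain j where j: "i = Suc j" "j < n" by (cases i) auto
      obtain k where k: "\<phi> g i = Suc k" "k < n"
        using permutes_in_image[OF perm[OF gh(1)], of i] True by (cases "\<phi> g i") auto
      have "\<rho> g $$ (k, j) = \<rho> h $$ (k, j)" using gh by simp
      then show ?thesis using j k by (auto simp: \<rho>_def split: if_splits)
    next
      case False
      then show ?thesis using permutes_not_in[OF perm[OF gh(1)] False] permutes_not_in[OF perm[OF gh(2)] False] by simp
    qed
    then show "g = h" using \<phi>(2) gh by (auto dest: inj_onD)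
  qed
  moreover have "quasi_permutation_mat (\<rho> g)" for g
  proof -
    have "mat_trace (\<rho> g) = of_nat (\<Sum>i<n. if \<phi> g (Suc i) = Suc i then 1 else 0)"
      unfolding of_nat_sum by (auto simp: mat_trace_def \<rho>_def intro!: sum.cong)
    then show ?thesis unfolding quasi_permutation_mat_def by (simp only: of_nat_in_Nats) (simp add: \<rho>_def)
  qed
  ultimately show ?thesis by (auto simp: faithful_quasi_perm_rep_def faithful_rep_def)
qed

theorem complex_rep_if_rational_rep:
  fixes \<rho> :: "'a \<Rightarrow> rat mat"
  assumes G: "group G" and \<rho>: "faithful_quasi_perm_rep G n \<rho>"
  shows "\<exists>\<rho>' :: 'a \<Rightarrow> complex mat. faithful_quasi_perm_rep G n \<rho>'"
proof -
  let ?r = "\<lambda>g. map_mat of_rat (\<rho> g) :: complex mat"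
  have m: "matrix_rep G n \<rho>" and inj: "inj_on \<rho> (carrier G)" and q: "\<And>g. g \<in> carrier G \<Longrightarrow> quasi_permutation_mat (\<rho> g)"
    using \<rho> by (auto simp: faithful_quasi_perm_rep_def faithful_rep_def)
  note c = m[unfolded matrix_rep_iff[OF G]]
  have "matrix_rep G n ?r"
    using c unfolding matrix_rep_iff[OF G] by (auto simp: of_rat_hom.mat_hom_mult[of _ n n _ n] of_rat_hom.mat_hom_one)
  moreover have "inj_on ?r (carrier G)"
  proof (rule inj_onI)
    fix g h assume gh: "g \<in> carrier G" "h \<in> carrier G" "?r g = ?r h"
    have d: "\<rho> g \<in> carrier_mat n n" "\<rho> h \<in> carrier_mat n n" using c gh by auto
    have "\<rho> g = \<rho> h"
    proof (rule eq_matI)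
      fix i j assume ij: "i < dim_row (\<rho> h)" "j < dim_col (\<rho> h)"
      have "?r g $$ (i, j) = ?r h $$ (i, j)" using gh by simp
      then show "\<rho> g $$ (i, j) = \<rho> h $$ (i, j)" using ij d by simp
    qed (use d in auto)
    then show "g = h" using inj gh by (auto dest: inj_onD)
  qed
  moreover have "quasi_permutation_mat (?r g)" if "g \<in> carrier G" for g
  proof -
    have "mat_trace (?r g) = of_rat (mat_trace (\<rho> g))"
      using c that by (auto simp: mat_trace_def of_rat_sum intro!: sum.cong)
    moreover have "(of_rat x :: complex) \<in> \<nat>" if "x \<in> \<nat>" for x using that by (auto elim!: Nats_cases)
    ultimately show ?thesis using q[OF that] by (auto simp: quasi_permutation_mat_def)
  qed
  ultimately show ?thesis by (auto simp: faithful_quasi_perm_rep_def faithful_rep_def)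
qed

section \<open>VZ-groups have class two\<close>

lemma span_coordinates:
  fixes bs :: "'k::field vec list"
  assumes bs: "set bs \<subseteq> carrier_vec n" "r \<le> length bs"
    and w: "w \<in> LinearCombinations.module.span class_ring (module_vec TYPE('k) n) (set (take r bs))"
  shows "\<exists>c\<in>carrier_vec (length bs). w = mat_of_cols n bs *\<^sub>v c \<and> (\<forall>k. r \<le> k \<and> k < length bs \<longrightarrow> c $ k = 0)"
proof -
  interpret vec_space "TYPE('k)" n .
  have sub: "set (take r bs) \<subseteq> carrier_vec n" using bs set_take_subset[of r bs] by auto
  have "w \<in> span_list (take r bs)" using w span_list_as_span[OF sub] by simp
  then obtain c where c: "w = lincomb_list c (take r bs)" by (auto simp: span_list_def)
  let ?c = "vec (length bs) (\<lambda>k. if k < r then c k else 0)"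
  have len: "length (take r bs) = r" using bs(2) by simp
  have "w = mat_of_cols n (take r bs) *\<^sub>v vec r c"
    unfolding c using sub len by (subst lincomb_list_as_mat_mult) auto
  also have "\<dots> = mat_of_cols n bs *\<^sub>v ?c"
  proof (rule eq_vecI)
    fix i assume i0: "i < dim_vec (mat_of_cols n bs *\<^sub>v ?c)"
    then have i: "i < n" by simp
    have "(mat_of_cols n (take r bs) *\<^sub>v vec r c) $ i = (\<Sum>k<r. bs ! k $ i * c k)"
      using i bs(2) by (auto simp: scalar_prod_def mat_of_cols_index atLeast0LessThan intro!: sum.cong)
    also have "\<dots> = (\<Sum>k<length bs. bs ! k $ i * (if k < r then c k else 0))"
      using bs(2) by (intro sum.mono_neutral_cong_left) auto
    also have "\<dots> = (mat_of_cols n bs *\<^sub>v ?c) $ i"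
      using i by (auto simp: scalar_prod_def mat_of_cols_index atLeast0LessThan intro!: sum.cong)
    finally show "(mat_of_cols n (take r bs) *\<^sub>v vec r c) $ i = (mat_of_cols n bs *\<^sub>v ?c) $ i" .
  qed simp
  finally show ?thesis by (intro bexI[of _ ?c]) auto
qed

text \<open>The columns of \<open>P\<close> are a basis of the whole space that starts with a basis
  of \<open>W\<close>, found as a maximal independent subset of \<open>W\<close> enlarged to a
  maximal independent set. The columns of \<open>Q\<close> are the coordinates of the unit
  vectors.\<close>

lemma exists_adapted_basis:
  fixes W :: "'k::field vec set"
  assumes W: "VectorSpace.subspace class_ring W (module_vec TYPE('k) n)"
    and W0: "W \<noteq> {0\<^sub>v n}" and Wn: "W \<noteq> carrier_vec n"
  shows "\<exists>P Q r. P \<in> carrier_mat n n \<and> Q \<in> carrier_mat n n \<and> P * Q = 1\<^sub>m n \<and> Q * P = 1\<^sub>m n \<and> 0 < r \<and> r < n \<and>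
    (\<forall>j<r. col P j \<in> W) \<and>
    (\<forall>w\<in>W. \<exists>c\<in>carrier_vec n. w = P *\<^sub>v c \<and> (\<forall>k. r \<le> k \<and> k < n \<longrightarrow> c $ k = 0))"
proof -
  interpret vec_space "TYPE('k)" n .
  have sub: "submodule class_ring W V" using W by (simp add: subspace_def)
  have Wc: "W \<subseteq> carrier_vec n" using sub by (auto simp: submodule_def)
  have fb: "finite A \<and> card A \<le> n" if "A \<subseteq> carrier_vec n" "lin_indpt A" for A
    using li_le_dim[OF fin_dim _ that(2)] that(1) by (simp add: dim_is_n)
  have em: "lin_indpt {}" by (auto simp: lin_dep_def)
  have "\<exists>B. finite B \<and> maximal B (\<lambda>S. S \<subseteq> W \<and> lin_indpt S)"
    by (rule maximal_exists[of _ n "{}"]) (use fb Wc em in auto)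
  then obtain B where fB: "finite B" and maxB: "maximal B (\<lambda>S. S \<subseteq> W \<and> lin_indpt S)" by (elim exE conjE)
  note B = fB conjunct1[OF conjunct1[OF maxB[unfolded maximal_def]]] conjunct2[OF conjunct1[OF maxB[unfolded maximal_def]]]
    conjunct2[OF maxB[unfolded maximal_def], rule_format, OF conjI[OF _ conjI]]
  have Bc: "B \<subseteq> carrier_vec n" using B Wc by auto
  have spanW: "W \<subseteq> span B"
  proof
    fix w assume w: "w \<in> W"
    show "w \<in> span B"
    proof (cases "w \<in> B")
      case True then show ?thesis using in_own_span[of B] Bc by auto
    next
      case False
      then have "\<not> lin_indpt (B \<union> {w})" using B(4)[of "B \<union> {w}"] B(2) w by auto
      then show ?thesis using lin_dep_iff_in_span[of B w] Bc B(3) w Wc False by auto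
    qed
  qed
  have Wspan: "span B \<subseteq> W" using span_is_subset[OF B(2) sub] .
  have "\<exists>D. finite D \<and> maximal D (\<lambda>S. S \<subseteq> carrier_vec n \<and> lin_indpt S \<and> B \<subseteq> S)"
    by (rule maximal_exists[of _ n B]) (use fb Bc B in auto)
  then obtain D where fD: "finite D" and maxD: "maximal D (\<lambda>S. S \<subseteq> carrier_vec n \<and> lin_indpt S \<and> B \<subseteq> S)"
    by (elim exE conjE)
  have D: "finite D" "D \<subseteq> carrier_vec n" "lin_indpt D" "B \<subseteq> D"
    using fD maxD by (simp_all add: maximal_def)
  have maxC: "C = D" if "D \<subseteq> C" "C \<subseteq> carrier_vec n" "lin_indpt C" for C
    using maxD that D(4) unfolding maximal_def by (meson order_trans)
  have "maximal D (\<lambda>S. S \<subseteq> carrier_vec n \<and> lin_indpt S)" unfolding maximal_def using D(2,3) maxC by blast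
  then have bas: "basis D" by (rule max_li_is_basis)
  then have cardD: "card D = n" using dim_basis[OF D(1)] dim_is_n by simp
  obtain bs1 where bs1: "set bs1 = B" "distinct bs1" using finite_distinct_list[OF B(1)] by auto
  obtain bs2 where bs2: "set bs2 = D - B" "distinct bs2" using finite_distinct_list[of "D - B"] D(1) by auto
  define bs r where "bs = bs1 @ bs2" and "r = length bs1"
  have "set bs = D" "distinct bs" using bs1 bs2 D(4) by (auto simp: bs_def)
  then have bs: "set bs = D" "length bs = n" "take r bs = bs1" "r \<le> length bs"
    using cardD distinct_card[of bs] by (auto simp: bs_def r_def)
  have r: "r = card B" using bs1 distinct_card[of bs1] by (simp add: r_def)
  let ?P = "mat_of_cols n bs"
  have P: "?P \<in> carrier_mat n n" using bs(2) by auto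
  have coord: "\<exists>c\<in>carrier_vec n. w = ?P *\<^sub>v c \<and> (\<forall>k. s \<le> k \<and> k < n \<longrightarrow> c $ k = 0)"
    if "w \<in> span (set (take s bs))" "s \<le> n" for w s
    using span_coordinates[of bs n s w] that bs D(2) by simp
  have full: "w \<in> span (set (take n bs))" if "w \<in> carrier_vec n" for w
    using bas that bs by (simp add: basis_def)
  have "\<forall>i. \<exists>c. i < n \<longrightarrow> c \<in> carrier_vec n \<and> unit_vec n i = ?P *\<^sub>v c"
    using coord[OF full] by (metis order_refl unit_vec_carrier)
  from choice[OF this] obtain q where q: "\<And>i. i < n \<Longrightarrow> q i \<in> carrier_vec n \<and> unit_vec n i = ?P *\<^sub>v q i" by blast
  let ?Q = "mat n n (\<lambda>(i, j). q j $ i)"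
  have PQ: "?P * ?Q = 1\<^sub>m n"
  proof (rule eq_matI)
    fix i j assume "i < dim_row (1\<^sub>m n :: 'k mat)" "j < dim_col (1\<^sub>m n :: 'k mat)"
    then have ij: "i < n" "j < n" by auto
    have "col ?Q j = q j" using ij q[of j] by (intro eq_vecI) auto
    then have "(?P * ?Q) $$ (i, j) = (?P *\<^sub>v q j) $ i" using ij P by simp
    also have "?P *\<^sub>v q j = unit_vec n j" using q[of j] ij by simp
    finally show "(?P * ?Q) $$ (i, j) = 1\<^sub>m n $$ (i, j)" using ij by (auto simp: unit_vec_def)
  qed (use P in auto)
  then have QP: "?Q * ?P = 1\<^sub>m n" using mat_mult_left_right_inverse[OF P, of ?Q] by simp
  have "r > 0"
  proof (rule ccontr)
    assume "\<not> r > 0"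
    then have "B = {}" using r B(1) by auto
    then have "W \<subseteq> {0\<^sub>v n}" using spanW span_empty by auto
    moreover have "0\<^sub>v n \<in> W" using sub Wspan \<open>B = {}\<close> span_empty by auto
    ultimately show False using W0 by auto
  qed
  moreover have "r < n"
  proof (rule ccontr)
    assume "\<not> r < n"
    then have "B = D" using r cardD D(1,4) by (metis card_mono card_subset_eq le_antisym linorder_not_less)
    then have "carrier_vec n \<subseteq> W" using Wspan bas by (simp add: basis_def)
    then show False using Wn Wc by auto
  qed
  moreover have "\<forall>j<r. col ?P j \<in> W"
  proof (intro allI impI)
    fix j assume j: "j < r"
    then have "bs ! j \<in> B" using bs1 by (metis bs_def nth_append nth_mem r_def)
    then show "col ?P j \<in> W" using j bs B(2) D(2) by (subst col_mat_of_cols) auto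
  qed
  moreover have "\<forall>w\<in>W. \<exists>c\<in>carrier_vec n. w = ?P *\<^sub>v c \<and> (\<forall>k. r \<le> k \<and> k < n \<longrightarrow> c $ k = 0)"
  proof
    fix w assume "w \<in> W"
    then have "w \<in> span (set (take r bs))" using spanW bs(3) bs1(1) by auto
    then show "\<exists>c\<in>carrier_vec n. w = ?P *\<^sub>v c \<and> (\<forall>k. r \<le> k \<and> k < n \<longrightarrow> c $ k = 0)"
      using coord[of w r] bs by simp
  qed
  ultimately show ?thesis using P PQ QP by (intro exI[of _ ?P] exI[of _ ?Q] exI[of _ r]) simp
qed

text \<open>In a basis adapted to an invariant subspace all matrices become block upper triangular.
  The two diagonal blocks afford the subspace and the quotient, and the trace is the sum of their
  traces.\<close>

theorem reducible_rep_splits: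
  fixes \<rho> :: "'a \<Rightarrow> 'k::field mat"
  assumes G: "group G" and \<rho>: "matrix_rep G n \<rho>" and red: "\<not> irreducible_rep G n \<rho>"
  shows "\<exists>\<rho>1 \<rho>2 r. 0 < r \<and> r < n \<and> matrix_rep G r \<rho>1 \<and> matrix_rep G (n - r) \<rho>2 \<and>
    (\<forall>g\<in>carrier G. rep_character \<rho> g = rep_character \<rho>1 g + rep_character \<rho>2 g)"
proof -
  note m = \<rho>[unfolded matrix_rep_iff[OF G]]
  obtain W where W: "VectorSpace.subspace class_ring W (module_vec TYPE('k) n)"
    "\<And>g w. g \<in> carrier G \<Longrightarrow> w \<in> W \<Longrightarrow> \<rho> g *\<^sub>v w \<in> W" "W \<noteq> {0\<^sub>v n}" "W \<noteq> carrier_vec n"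
    using red \<rho> unfolding irreducible_rep_def by blast
  obtain P Q r where P: "P \<in> carrier_mat n n" and Q: "Q \<in> carrier_mat n n" and PQ: "P * Q = 1\<^sub>m n" and QP: "Q * P = 1\<^sub>m n"
    and r: "0 < r" "r < n" and col: "\<And>j. j < r \<Longrightarrow> col P j \<in> W"
    and coord: "\<And>w. w \<in> W \<Longrightarrow> \<exists>c\<in>carrier_vec n. w = P *\<^sub>v c \<and> (\<forall>k. r \<le> k \<and> k < n \<longrightarrow> c $ k = 0)"
    using exists_adapted_basis[OF W(1,3,4)] by blast
  define A where "A g = Q * \<rho> g * P" for g
  have \<rho>c: "\<rho> g \<in> carrier_mat n n" if "g \<in> carrier G" for g using m that by blast
  have Ac: "A g \<in> carrier_mat n n" if "g \<in> carrier G" for g using P Q \<rho>c[OF that] by (simp add: A_def)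
  have A_mult: "A (g \<otimes>\<^bsub>G\<^esub> h) = A g * A h" if gh: "g \<in> carrier G" "h \<in> carrier G" for g h
  proof -
    have "A g * A h = Q * \<rho> g * (P * Q) * \<rho> h * P"
      using P Q \<rho>c[OF gh(1)] \<rho>c[OF gh(2)] by (simp add: A_def assoc_mult_mat[of _ n n _ n _ n])
    also have "\<dots> = Q * (\<rho> g * \<rho> h) * P"
      using P Q \<rho>c[OF gh(1)] \<rho>c[OF gh(2)] by (simp add: PQ assoc_mult_mat[of _ n n _ n _ n])
    also have "\<dots> = A (g \<otimes>\<^bsub>G\<^esub> h)" using m gh by (simp add: A_def)
    finally show ?thesis by simp
  qed
  have A_one: "A \<one>\<^bsub>G\<^esub> = 1\<^sub>m n" using m P Q QP by (simp add: A_def)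
  have low: "A g $$ (k, j) = 0" if g: "g \<in> carrier G" and kj: "r \<le> k" "k < n" "j < r" for g k j
  proof -
    obtain c where c: "c \<in> carrier_vec n" "\<rho> g *\<^sub>v col P j = P *\<^sub>v c" "c $ k = 0"
      using coord[OF W(2)[OF g col[OF kj(3)]]] kj by blast
    have cP: "col P j \<in> carrier_vec n" using P by auto
    have "col (A g) j = Q *\<^sub>v (\<rho> g *\<^sub>v col P j)"
    proof -
      have j: "j < n" using kj by simp
      have "A g = Q * (\<rho> g * P)" using P Q \<rho>c[OF g] by (simp add: A_def assoc_mult_mat[of _ n n _ n _ n])
      then have "col (A g) j = Q *\<^sub>v col (\<rho> g * P) j"
        using col_mult2[OF Q mult_carrier_mat[OF \<rho>c[OF g] P] j] by simp
      then show ?thesis using col_mult2[OF \<rho>c[OF g] P j] by simp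
    qed
    also have "\<dots> = (Q * P) *\<^sub>v c" using P Q c by simp
    also have "\<dots> = c" using QP c by simp
    finally have "col (A g) j $ k = 0" using c by simp
    then show ?thesis using Ac[OF g] kj r by simp
  qed
  have entry: "A (g \<otimes>\<^bsub>G\<^esub> h) $$ (i, j) = (\<Sum>k<n. A g $$ (i, k) * A h $$ (k, j))"
    if "g \<in> carrier G" "h \<in> carrier G" "i < n" "j < n" for g h i j
    using Ac[OF that(1)] Ac[OF that(2)] that by (simp add: A_mult scalar_prod_def atLeast0LessThan)
  let ?r1 = "\<lambda>g. mat r r (\<lambda>(i, j). A g $$ (i, j))"
  let ?r2 = "\<lambda>g. mat (n - r) (n - r) (\<lambda>(i, j). A g $$ (r + i, r + j))"
  have split: "(\<Sum>k<n. f k) = (\<Sum>k<r. f k) + (\<Sum>k<n - r. f (r + k))" for f :: "nat \<Rightarrow> 'k"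
  proof -
    have "(\<Sum>k<r + m. f k) = (\<Sum>k<r. f k) + (\<Sum>k<m. f (r + k))" for m
      by (induction m) (simp_all add: add.assoc)
    from this[of "n - r"] show ?thesis using r by simp
  qed
  have "matrix_rep G r ?r1"
    unfolding matrix_rep_iff[OF G]
  proof (intro conjI ballI)
    show "?r1 \<one>\<^bsub>G\<^esub> = 1\<^sub>m r" using r by (auto simp: A_one intro!: eq_matI)
    fix g h assume gh: "g \<in> carrier G" "h \<in> carrier G"
    show "?r1 (g \<otimes>\<^bsub>G\<^esub> h) = ?r1 g * ?r1 h"
    proof (rule eq_matI)
      fix i j assume "i < dim_row (?r1 g * ?r1 h)" "j < dim_col (?r1 g * ?r1 h)"
      then have ij: "i < r" "j < r" by auto
      have "A (g \<otimes>\<^bsub>G\<^esub> h) $$ (i, j) = (\<Sum>k<r. A g $$ (i, k) * A h $$ (k, j))"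
        using ij r low[OF gh(2)] by (simp add: entry[OF gh] split)
      then show "?r1 (g \<otimes>\<^bsub>G\<^esub> h) $$ (i, j) = (?r1 g * ?r1 h) $$ (i, j)"
        using ij by (simp add: scalar_prod_def atLeast0LessThan)
    qed auto
  qed (use r in auto)
  moreover have "matrix_rep G (n - r) ?r2"
    unfolding matrix_rep_iff[OF G]
  proof (intro conjI ballI)
    show "?r2 \<one>\<^bsub>G\<^esub> = 1\<^sub>m (n - r)" using r by (auto simp: A_one intro!: eq_matI)
    fix g h assume gh: "g \<in> carrier G" "h \<in> carrier G"
    show "?r2 (g \<otimes>\<^bsub>G\<^esub> h) = ?r2 g * ?r2 h"
    proof (rule eq_matI)
      fix i j assume "i < dim_row (?r2 g * ?r2 h)" "j < dim_col (?r2 g * ?r2 h)"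
      then have ij: "i < n - r" "j < n - r" by auto
      have "A (g \<otimes>\<^bsub>G\<^esub> h) $$ (r + i, r + j) = (\<Sum>k<n - r. A g $$ (r + i, r + k) * A h $$ (r + k, r + j))"
        using ij r low[OF gh(1)] by (simp add: entry[OF gh] split)
      then show "?r2 (g \<otimes>\<^bsub>G\<^esub> h) $$ (i, j) = (?r2 g * ?r2 h) $$ (i, j)"
        using ij by (simp add: scalar_prod_def atLeast0LessThan)
    qed auto
  qed (use r in auto)
  moreover have "rep_character \<rho> g = rep_character ?r1 g + rep_character ?r2 g" if g: "g \<in> carrier G" for g
  proof -
    have "rep_character \<rho> g = mat_trace (A g)"
      unfolding rep_character_def A_def using mat_trace_similar[OF \<rho>c[OF g] Q P PQ] by simp
    also have "\<dots> = (\<Sum>k<n. A g $$ (k, k))" using Ac[OF g] by (simp add: mat_trace_def)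
    finally show ?thesis by (simp add: split rep_character_def mat_trace_def)
  qed
  ultimately show ?thesis using r by (intro exI[of _ ?r1] exI[of _ ?r2] exI[of _ r]) simp
qed

context group
begin

lemma rep_character_commut_linear:
  fixes \<rho> :: "'a \<Rightarrow> 'k::field mat"
  assumes \<rho>: "matrix_rep G 1 \<rho>" and xy: "x \<in> carrier G" "y \<in> carrier G"
  shows "rep_character \<rho> (commut G x y) = 1"
proof -
  note m = \<rho>[unfolded matrix_rep_iff[OF is_group]]
  have c: "\<rho> g \<in> carrier_mat 1 1" if "g \<in> carrier G" for g using m that by blast
  have mult: "rep_character \<rho> (g \<otimes> h) = rep_character \<rho> g * rep_character \<rho> h"
    if "g \<in> carrier G" "h \<in> carrier G" for g h
    using m that carrier_matD[OF c[OF that(1)]] carrier_matD[OF c[OF that(2)]]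
    by (simp add: rep_character_def mat_trace_def scalar_prod_def)
  have one: "rep_character \<rho> \<one> = 1" using m by (simp add: rep_character_def mat_trace_def)
  have nz: "rep_character \<rho> g \<noteq> 0" if "g \<in> carrier G" for g
    using mult[of g "inv g"] one that by auto
  have "rep_character \<rho> (commut G x y) * (rep_character \<rho> y * rep_character \<rho> x) = rep_character \<rho> x * rep_character \<rho> y"
    using commut_mult[OF xy] xy by (simp flip: mult)
  then show ?thesis using nz xy by (simp add: mult.commute)
qed

text \<open>The regular representation modulo the trivial one, in the basis \<open>e\<^sub>x - e\<^sub>1\<close> for \<open>x \<noteq> 1\<close>.\<close>
lemma exists_reduced_regular_rep:
  assumes fin: "finite (carrier G)" and c: "c \<in> carrier G" "c \<noteq> \<one>"
  shows "\<exists>n (\<rho> :: 'a \<Rightarrow> complex mat). matrix_rep G n \<rho> \<and> rep_character \<rho> c = - 1"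
proof -
  let ?S = "carrier G - {\<one>}"
  define m where "m = card ?S"
  have fS: "finite ?S" using fin by simp
  have "\<exists>e. bij_betw e {..<m} ?S" by (rule finite_same_card_bij) (use fS in \<open>simp_all add: m_def\<close>)
  then obtain e where e: "bij_betw e {..<m} ?S" by blast
  have "c \<in> ?S" using c by simp
  then have m0: "m > 0" unfolding m_def using fS card_gt_0_iff by blast
  have ec: "e i \<in> carrier G" "e i \<noteq> \<one>" if "i < m" for i using bij_betwE[OF e] that by auto
  have einj: "e i = e j \<longleftrightarrow> i = j" if "i < m" "j < m" for i j
    using bij_betw_imp_inj_on[OF e] that by (auto simp: inj_on_def)
  let ?d = "\<lambda>w y. if w = y then 1 else 0 :: complex"
  \<comment> \<open>The column of \<open>x\<close> writes \<open>g\<close> applied to the basis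
    vector of \<open>x\<close> as the basis vector of \<open>g \<otimes> x\<close> minus that of
    \<open>g\<close>, the basis vector of \<open>\<one>\<close> being read as 0.\<close>
  let ?\<rho> = "\<lambda>g. mat m m (\<lambda>(i, j). ?d (g \<otimes> e j) (e i) - ?d g (e i))"
  \<comment> \<open>The condition \<open>f \<one> = 0\<close> covers the case that \<open>w\<close>
    is \<open>\<one>\<close>, which has no index in the basis.\<close>
  have sum_d: "(\<Sum>k<m. f (e k) * ?d w (e k)) = f w" if w: "w \<in> carrier G" and f: "f \<one> = 0" for f :: "'a \<Rightarrow> complex" and w
  proof -
    have "(\<Sum>k<m. f (e k) * ?d w (e k)) = (\<Sum>y\<in>?S. f y * ?d w y)"
      by (rule sum.reindex_bij_betw[OF e, of "\<lambda>y. f y * ?d w y"])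
    also have "\<dots> = (\<Sum>y\<in>?S. if y = w then f w else 0)" by (intro sum.cong) auto
    also have "\<dots> = f w" using fS w f by (auto simp: sum.delta)
    finally show ?thesis .
  qed
  have "matrix_rep G m ?\<rho>"
    unfolding matrix_rep_iff[OF is_group]
  proof (intro conjI ballI)
    show "?\<rho> \<one> = 1\<^sub>m m" using ec(1) ec(2)[symmetric] by (auto simp: einj intro!: eq_matI)
    fix g h assume gh: "g \<in> carrier G" "h \<in> carrier G"
    show "?\<rho> (g \<otimes> h) = ?\<rho> g * ?\<rho> h"
    proof (rule eq_matI)
      fix i j assume "i < dim_row (?\<rho> g * ?\<rho> h)" "j < dim_col (?\<rho> g * ?\<rho> h)"
      then have ij: "i < m" "j < m" by auto
      let ?f = "\<lambda>y. ?d (g \<otimes> y) (e i) - ?d g (e i)"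
      have "(?\<rho> g * ?\<rho> h) $$ (i, j) = (\<Sum>k<m. ?f (e k) * ?d (h \<otimes> e j) (e k)) - (\<Sum>k<m. ?f (e k) * ?d h (e k))"
        using ij by (simp add: scalar_prod_def atLeast0LessThan right_diff_distrib sum_subtractf)
      also have "\<dots> = ?f (h \<otimes> e j) - ?f h" using sum_d[of _ ?f] gh ec[OF ij(2)] by simp
      finally show "?\<rho> (g \<otimes> h) $$ (i, j) = (?\<rho> g * ?\<rho> h) $$ (i, j)"
        using ij gh ec[OF ij(2)] by (simp add: m_assoc)
    qed auto
  qed (use m0 in auto)
  moreover have "rep_character ?\<rho> c = - 1"
  proof -
    have "rep_character ?\<rho> c = (\<Sum>k<m. - ?d c (e k))"
      unfolding rep_character_def mat_trace_def using c ec by (intro sum.cong) auto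
    also have "\<dots> = - (\<Sum>y\<in>?S. ?d c y)"
      using sum.reindex_bij_betw[OF e, of "\<lambda>y. ?d c y"] by (simp add: sum_negf)
    also have "(\<Sum>y\<in>?S. ?d c y) = 1" using fS c by (simp add: sum.delta')
    finally show ?thesis .
  qed
  ultimately show ?thesis by blast
qed

end

text \<open>A noncentral commutator would have nonnegative trace in every representation, as linear
  characters take the value \<open>1\<close> and nonlinear ones the value \<open>0\<close> there.\<close>
theorem VZ_group_commut_central:
  fixes G :: "('a, 'b) monoid_scheme"
  assumes VZ: "VZ_group G" and fin: "finite (carrier G)" and xy: "x \<in> carrier G" "y \<in> carrier G"
  shows "commut G x y \<in> group_center G"
proof (rule ccontr)
  interpret group G using VZ by (simp add: VZ_group_def)
  let ?c = "commut G x y"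
  assume nc: "?c \<notin> group_center G"
  have cc: "?c \<in> carrier G" using xy by simp
  have nat: "rep_character \<rho> ?c \<in> \<nat>" if "matrix_rep G n \<rho>" for n and \<rho> :: "'a \<Rightarrow> complex mat"
    using that
  proof (induction n arbitrary: \<rho> rule: less_induct)
    case (less n)
    show ?case
    proof (cases "irreducible_rep G n \<rho>")
      case True
      have "n > 0" using less.prems by (simp add: matrix_rep_def)
      then consider "n = 1" | "n > 1" by linarith
      then show ?thesis
      proof cases
        case 1
        then show ?thesis using rep_character_commut_linear[of \<rho>] less.prems xy by simp
      next
        case 2
        then have "rep_character \<rho> ?c = 0" using VZ True nc cc unfolding VZ_group_def by blast
        then show ?thesis by simp
      qed
    next
      case False
      then obtain \<rho>1 \<rho>2 r where r: "0 < r" "r < n" "matrix_rep G r \<rho>1" "matrix_rep G (n - r) \<rho>2"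
        "rep_character \<rho> ?c = rep_character \<rho>1 ?c + rep_character \<rho>2 ?c"
        using reducible_rep_splits[OF is_group less.prems False] cc by blast
      then have "rep_character \<rho>1 ?c \<in> \<nat>" "rep_character \<rho>2 ?c \<in> \<nat>"
        using less.IH[OF r(2,3)] less.IH[OF _ r(4)] by simp_all
      then show ?thesis using r(5) by simp
    qed
  qed
  have "?c \<noteq> \<one>\<^bsub>G\<^esub>" using nc by (auto simp: group_center_def)
  then obtain n and \<rho> :: "'a \<Rightarrow> complex mat" where "matrix_rep G n \<rho>" "rep_character \<rho> ?c = - 1"
    using exists_reduced_regular_rep[OF fin cc] by blast
  then have "(- 1 :: complex) \<in> \<nat>" using nat by metis
  then obtain k :: nat where "(- 1 :: complex) = of_nat k" by (auto elim: Nats_cases)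
  then have "Re (- 1) = Re (of_nat k)" by (simp only:)
  then show False by simp
qed

section \<open>Reduction to p-parts\<close>

context group
begin

lemma eq_one_if_coprime_powers:
  assumes x: "x \<in> carrier G" "x [^] (m::nat) = \<one>" "x [^] (n::nat) = \<one>" and c: "coprime m n"
  shows "x = \<one>"
proof (cases "m = 0")
  case True then show ?thesis using assms by simp
next
  case False
  then obtain u v where uv: "m * u = n * v + 1"
    using bezout_nat[of m n] coprime_imp_gcd_eq_1[OF c] by auto
  have "(x [^] m) [^] u = (x [^] n) [^] v \<otimes> x"
    using x(1) by (simp add: nat_pow_pow uv nat_pow_mult[symmetric])
  then show ?thesis using x by simp
qed

text \<open>\<open>sum_ext_chars\<close> for the trivial subgroup is inversion at
  \<open>\<one>\<close>. It is applied to the translate of \<open>f\<close> by \<open>z\<close>,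
  whose multiplicities are those of \<open>f\<close> times \<open>\<chi> z\<close>.\<close>

lemma fourier_inversion:
  assumes fin: "finite (carrier G)" and A: "subgroup A G"
    and comm: "\<And>x y. x \<in> A \<Longrightarrow> y \<in> A \<Longrightarrow> x \<otimes> y = y \<otimes> x" and z: "z \<in> A"
  shows "finite (lin_chars G A)" "f z = (\<Sum>\<chi>\<in>lin_chars G A. char_mult f A \<chi> * \<chi> z)"
proof -
  let ?e = "\<lambda>x. if x \<in> {\<one>} then 1 else 0 :: complex"
  let ?g = "\<lambda>x. f (x \<otimes> z)"
  have Ac: "x \<in> carrier G" if "x \<in> A" for x using subgroup.mem_carrier[OF A that] .
  have cm: "commut G b c \<in> {\<one>} \<and> ?e (commut G b c) = 1" if "b \<in> A" "c \<in> A" for b c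
    using commut_eq_one_iff[of b c] comm[OF that] Ac that by simp
  have one: "{\<one>} \<subseteq> A" using subgroup.one_closed[OF A] by simp
  have E: "ext_chars G {\<one>} ?e A = lin_chars G A" by (auto simp: ext_chars_def lin_chars_one)
  note S = sum_ext_chars[OF fin triv_subgroup A one indicator_lin_char[OF triv_subgroup] cm, of ?g, unfolded E]
  show "finite (lin_chars G A)" using S by blast
  have bij: "bij_betw (\<lambda>x. x \<otimes> z) A A"
    using z A Ac by (intro bij_betw_byWitness[of _ "\<lambda>x. x \<otimes> inv z"])
      (auto simp: m_assoc subgroup.m_closed subgroup.m_inv_closed)
  have "char_mult ?g A \<chi> = char_mult f A \<chi> * \<chi> z" if \<chi>: "\<chi> \<in> lin_chars G A" for \<chi>
  proof -
    have "(\<Sum>x\<in>A. ?g x * cnj (\<chi> x)) = (\<Sum>x\<in>A. f (x \<otimes> z) * cnj (\<chi> (x \<otimes> z)) * \<chi> z)"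
    proof (intro sum.cong refl)
      fix x assume x: "x \<in> A"
      have "cnj (\<chi> (x \<otimes> z)) * \<chi> z = cnj (\<chi> x) * (\<chi> z * cnj (\<chi> z))"
        using lin_chars_mult[OF \<chi> x z] by simp
      then show "?g x * cnj (\<chi> x) = f (x \<otimes> z) * cnj (\<chi> (x \<otimes> z)) * \<chi> z"
        using lin_chars_cnj[OF A \<chi> z fin] by (simp add: mult.assoc)
    qed
    also have "\<dots> = (\<Sum>x\<in>A. f x * cnj (\<chi> x) * \<chi> z)"
      by (rule sum.reindex_bij_betw[OF bij, of "\<lambda>x. f x * cnj (\<chi> x) * \<chi> z"])
    finally show ?thesis by (simp add: char_mult_def sum_distrib_right)
  qed
  moreover have "char_mult ?g {\<one>} ?e = f z" using Ac z by (simp add: char_mult_def)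
  ultimately show "f z = (\<Sum>\<chi>\<in>lin_chars G A. char_mult f A \<chi> * \<chi> z)" using S by simp
qed

lemma group_center_commute: "z \<in> group_center G \<Longrightarrow> g \<in> carrier G \<Longrightarrow> z \<otimes> g = g \<otimes> z"
  and group_center_closed: "z \<in> group_center G \<Longrightarrow> z \<in> carrier G"
  by (auto simp: group_center_def)

lemma group_center_subgroup: "subgroup (group_center G) G"
proof
  show "group_center G \<subseteq> carrier G" by (auto simp: group_center_def)
  show "\<one> \<in> group_center G" by (simp add: group_center_def)
next
  fix x y assume xy: "x \<in> group_center G" "y \<in> group_center G"
  note c = group_center_closed[OF xy(1)] group_center_closed[OF xy(2)]
  have "x \<otimes> y \<otimes> g = g \<otimes> (x \<otimes> y)" if g: "g \<in> carrier G" for g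
  proof -
    have "x \<otimes> y \<otimes> g = x \<otimes> (y \<otimes> g)" using c g by (simp add: m_assoc)
    also have "\<dots> = x \<otimes> (g \<otimes> y)" by (simp only: group_center_commute[OF xy(2) g])
    also have "\<dots> = (x \<otimes> g) \<otimes> y" using c g by (simp add: m_assoc)
    also have "\<dots> = (g \<otimes> x) \<otimes> y" by (simp only: group_center_commute[OF xy(1) g])
    also have "\<dots> = g \<otimes> (x \<otimes> y)" using c g by (simp add: m_assoc)
    finally show ?thesis .
  qed
  then show "x \<otimes> y \<in> group_center G" using c by (simp add: group_center_def)
next
  fix x assume x: "x \<in> group_center G"
  note xc = group_center_closed[OF x]
  have "inv x \<otimes> g = g \<otimes> inv x" if g: "g \<in> carrier G" for g
  proof -
    have "inv x \<otimes> (x \<otimes> g) \<otimes> inv x = inv x \<otimes> (g \<otimes> x) \<otimes> inv x" by (simp only: group_center_commute[OF x g])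
    then show ?thesis using xc g by (simp add: m_assoc cancel_l2)
  qed
  then show "inv x \<in> group_center G" using xc by (simp add: group_center_def)
qed

end

section \<open>Galois invariance of a character with natural values\<close>

locale nat_character = class2_group G for G (structure) +
  fixes \<psi> :: "'a \<Rightarrow> complex" and Z
  assumes fin: "finite (carrier G)" and odd_order: "odd (Coset.order G)"
    and Z: "subgroup Z G" and Z_central: "\<And>z x. z \<in> Z \<Longrightarrow> x \<in> carrier G \<Longrightarrow> z \<otimes> x = x \<otimes> z"
    and commut_Z: "\<And>x y. x \<in> carrier G \<Longrightarrow> y \<in> carrier G \<Longrightarrow> commut G x y \<in> Z"
    and \<psi>_conj: "\<And>g x. g \<in> carrier G \<Longrightarrow> x \<in> carrier G \<Longrightarrow> \<psi> (g \<otimes> x \<otimes> inv g) = \<psi> x"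
    and \<psi>_nat: "\<And>x. x \<in> carrier G \<Longrightarrow> \<psi> x \<in> \<nat>"
    and \<psi>_mult: "\<And>H \<chi>. subgroup H G \<Longrightarrow> \<chi> \<in> lin_chars G H \<Longrightarrow> char_mult \<psi> H \<chi> \<in> \<nat>"
begin

lemma Zc: "z \<in> Z \<Longrightarrow> z \<in> carrier G" using subgroup.mem_carrier[OF Z] .

lemma order_pos: "Coset.order G > 0" using fin order_gt_0_iff_finite by simp

text \<open>On the cyclic group generated by \<open>x\<close>, \<open>\<psi>\<close> is a sum of roots of unity with multiplicities.\<close>
lemma \<psi>_pow:
  assumes x: "x \<in> carrier G" and j: "coprime j (Coset.order G)"
  shows "\<psi> (x [^] (j::nat)) = \<psi> x"
proof -
  let ?A = "{x [^] i | i :: nat. True}"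
  have A: "subgroup ?A G"
  proof (rule finite_subgroupI[OF fin])
    show "\<one> \<in> ?A" by (rule CollectI, rule exI[of _ 0]) simp
    fix u v assume "u \<in> ?A" "v \<in> ?A"
    then obtain i k where "u = x [^] (i::nat)" "v = x [^] (k::nat)" by auto
    then have "u \<otimes> v = x [^] (i + k)" using x by (simp add: nat_pow_mult)
    then show "u \<otimes> v \<in> ?A" by blast
  qed (use x in auto)
  have comm: "u \<otimes> v = v \<otimes> u" if "u \<in> ?A" "v \<in> ?A" for u v
    using that x by (auto simp: nat_pow_mult add.commute)
  have xA: "x \<in> ?A" by (rule CollectI, rule exI[of _ 1]) (use x in simp)
  have powA: "x [^] (t::nat) \<in> ?A" for t by auto
  let ?X = "lin_chars G ?A"
  \<comment> \<open>The multiplicities are natural numbers inside the complex numbers; the floor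
    makes them usable as the weights in \<open>power_sum_coprime\<close>.\<close>
  let ?m = "\<lambda>\<chi>. nat \<lfloor>Re (char_mult \<psi> ?A \<chi>)\<rfloor>"
  have m: "char_mult \<psi> ?A \<chi> = of_nat (?m \<chi>)" if "\<chi> \<in> ?X" for \<chi>
    using \<psi>_mult[OF A that] by (auto elim: Nats_cases)
  have f: "\<psi> (x [^] t) = (\<Sum>\<chi>\<in>?X. of_nat (?m \<chi>) * \<chi> x ^ t)" for t :: nat
    using fourier_inversion(2)[OF fin A comm powA, of \<psi> t] lin_chars_pow[OF A _ xA] m by simp
  have "(\<Sum>\<chi>\<in>?X. of_nat (?m \<chi>) * \<chi> x ^ j) = (\<Sum>\<chi>\<in>?X. of_nat (?m \<chi>) * \<chi> x)"
  proof (rule power_sum_coprime[OF _ _ order_pos _ j])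
    show "finite ?X" by (rule fourier_inversion(1)[OF fin A comm xA])
    show "\<chi> x ^ Coset.order G = 1" if "\<chi> \<in> ?X" for \<chi>
      using lin_chars_pow[OF A that xA, of "Coset.order G"] pow_order_eq_1[OF x] lin_chars_one[OF that] by simp
    show "(\<Sum>\<chi>\<in>?X. of_nat (?m \<chi>) * \<chi> x ^ t) \<in> \<nat>" for t
      using \<psi>_nat[of "x [^] t"] x by (simp add: f)
  qed
  then show ?thesis using f[of j] f[of 1] x by simp
qed

lemma char_mult_\<psi>_power:
  assumes "subgroup H G" "\<chi> \<in> lin_chars G H" "coprime j (Coset.order G)"
  shows "char_mult \<psi> H (\<lambda>x. \<chi> x ^ j) = char_mult \<psi> H \<chi>"
  using assms pow_order_eq_1 \<psi>_pow subgroup.mem_carrier[OF assms(1)] by (intro char_mult_power) auto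

end

text \<open>For a prime \<open>p\<close> the exponent \<open>e\<close> is chosen such that \<open>x \<mapsto> x\<^sup>e\<close> is the projection of \<open>G\<close>
  to its \<open>p\<close>-part; in a group of class two and odd order this is a homomorphism.\<close>
locale p_part = nat_character +
  fixes p a b e :: nat
  assumes p: "prime p" and order: "Coset.order G = p ^ a * b" and pb: "\<not> p dvd b"
    and e: "[e = 1] (mod p ^ a)" "b dvd e"
begin

lemma coprime_pb: "coprime (p ^ a) b"
  using prime_imp_coprime[OF p pb] by simp

lemma pow_order: "x \<in> carrier G \<Longrightarrow> x [^] (p ^ a * b) = \<one>"
  using pow_order_eq_1 order by simp

abbreviation "\<pi> x \<equiv> x [^] e"

lemma e_square: "p ^ a * b dvd e * (e - 1)"
proof (cases "e = 0")
  case False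
  then have "p ^ a dvd e - 1" using e(1) by (metis cong_altdef_nat Suc_leI cong_sym neq0_conv One_nat_def)
  then show ?thesis using e(2) by (metis mult_dvd_mono mult.commute)
qed simp

text \<open>The defect in the power formula is a commutator raised to
  \<open>e * (e - 1) div 2\<close>. The group order divides \<open>e * (e - 1)\<close> by the choice
  of \<open>e\<close>, and being odd it also divides the half.\<close>

lemma \<pi>_mult: "x \<in> carrier G \<Longrightarrow> y \<in> carrier G \<Longrightarrow> \<pi> (x \<otimes> y) = \<pi> x \<otimes> \<pi> y"
proof -
  assume xy: "x \<in> carrier G" "y \<in> carrier G"
  have "even (e * (e - 1))" by (cases e) auto
  then have "p ^ a * b dvd 2 * (e * (e - 1) div 2)" using e_square by simp
  moreover have "coprime (p ^ a * b) 2" using odd_order order by (simp add: coprime_right_2_iff_odd)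
  ultimately have "p ^ a * b dvd e * (e - 1) div 2" using coprime_dvd_mult_right_iff by blast
  then obtain q where "e * (e - 1) div 2 = p ^ a * b * q" by auto
  then have "commut G y x [^] (e * (e - 1) div 2) = \<one>"
    using xy pow_order[of "commut G y x"] by (simp add: nat_pow_pow[symmetric])
  then show ?thesis using xy by (simp add: mult_pow)
qed

lemma \<pi>_inv: "x \<in> carrier G \<Longrightarrow> \<pi> (inv x) = inv (\<pi> x)"
  by (simp add: nat_pow_inv)

lemma \<pi>_id: "x \<in> carrier G \<Longrightarrow> x [^] (p ^ a) = \<one> \<Longrightarrow> \<pi> x = x"
  using pow_cong[OF _ _ e(1), of x] by simp

lemma \<pi>_exponent: "x \<in> carrier G \<Longrightarrow> (\<pi> x) [^] (p ^ a) = \<one>"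
proof -
  assume x: "x \<in> carrier G"
  obtain q where "e = b * q" using e(2) by auto
  then have "(\<pi> x) [^] (p ^ a) = (x [^] (p ^ a * b)) [^] q" using x by (simp add: nat_pow_pow mult_ac)
  then show ?thesis using pow_order[OF x] by simp
qed

lemma \<pi>_\<pi>: "x \<in> carrier G \<Longrightarrow> \<pi> (\<pi> x) = \<pi> x"
  using \<pi>_id[of "\<pi> x"] \<pi>_exponent by simp

definition P :: "'a set" where "P = {x \<in> carrier G. x [^] (p ^ a) = \<one>}"
definition Q :: "'a set" where "Q = {x \<in> carrier G. \<pi> x = \<one>}"

lemma Pc: "x \<in> P \<Longrightarrow> x \<in> carrier G" and Qc: "x \<in> Q \<Longrightarrow> x \<in> carrier G" by (auto simp: P_def Q_def)

lemma \<pi>_P: "x \<in> P \<Longrightarrow> \<pi> x = x" and \<pi>_in_P: "x \<in> carrier G \<Longrightarrow> \<pi> x \<in> P"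
  using \<pi>_id \<pi>_exponent by (auto simp: P_def)

lemma P_iff: "x \<in> P \<longleftrightarrow> x \<in> carrier G \<and> \<pi> x = x"
  using \<pi>_P \<pi>_in_P Pc by metis

lemma P_subgroup: "subgroup P G"
  by (rule finite_subgroupI[OF fin]) (auto simp: P_iff \<pi>_mult)

lemma Q_exponent: "y \<in> Q \<Longrightarrow> y [^] b = \<one>"
proof -
  assume y: "y \<in> Q"
  have "(y [^] b) [^] (p ^ a) = \<one>" using pow_order[OF Qc[OF y]] Qc[OF y] by (simp add: nat_pow_pow mult.commute)
  then have "\<pi> (y [^] b) = y [^] b" using Qc[OF y] by (intro \<pi>_id) auto
  moreover have "\<pi> (y [^] b) = (\<pi> y) [^] b" using Qc[OF y] by (simp add: nat_pow_pow mult.commute)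
  ultimately show ?thesis using y by (simp add: Q_def)
qed

lemma decomp: "x \<in> carrier G \<Longrightarrow> inv (\<pi> x) \<otimes> x \<in> Q" "x \<in> carrier G \<Longrightarrow> x = \<pi> x \<otimes> (inv (\<pi> x) \<otimes> x)"
  by (auto simp: Q_def \<pi>_mult \<pi>_inv \<pi>_\<pi> cancel_l1)

lemma \<pi>_PQ: "h \<in> P \<Longrightarrow> y \<in> Q \<Longrightarrow> \<pi> (h \<otimes> y) = h"
  using \<pi>_P by (simp add: \<pi>_mult Pc Qc) (simp add: Q_def Pc)

text \<open>For counting: the preimage of \<open>K\<close> under \<open>\<pi>\<close> has
  \<open>card K * card Q\<close> elements, so passing to preimages preserves the index.\<close>

lemma bij_PQ:
  assumes "K \<subseteq> P"
  shows "bij_betw (\<lambda>(h, y). h \<otimes> y) (K \<times> Q) {g \<in> carrier G. \<pi> g \<in> K}"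
  using assms \<pi>_PQ decomp Pc Qc
  by (intro bij_betw_byWitness[of _ "\<lambda>g. (\<pi> g, inv (\<pi> g) \<otimes> g)"]) (auto simp: subset_iff cancel_l2)

end

section \<open>Transfer of characters between the group and its p-part\<close>

locale p_part_char = p_part +
  fixes \<kappa>
  assumes \<kappa>: "\<kappa> \<in> lin_chars G Z"
begin

definition "ZP = Z \<inter> P"
definition "ZQ = Z \<inter> Q"

lemma ZQ: "y \<in> ZQ \<Longrightarrow> y \<in> Z" "y \<in> ZQ \<Longrightarrow> y \<in> Q" "y \<in> ZQ \<Longrightarrow> y \<in> carrier G" "y \<in> ZQ \<Longrightarrow> \<pi> y = \<one>"
  using Zc by (auto simp: ZQ_def Q_def)

lemma ZQ_subgroup: "subgroup ZQ G"
  by (rule finite_subgroupI[OF fin])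
    (auto simp: ZQ_def Q_def Zc \<pi>_mult subgroup.one_closed[OF Z] subgroup.m_closed[OF Z])

lemma ZP_subgroup: "subgroup ZP G"
  unfolding ZP_def by (rule subgroups_Inter_pair[OF Z P_subgroup])

text \<open>The character of \<open>P\<close> on the \<open>\<kappa>\<close>-eigenspace of the central \<open>p'\<close>-elements.\<close>
definition \<psi>P :: "'a \<Rightarrow> complex" where
  "\<psi>P x = (\<Sum>y\<in>ZQ. \<psi> (x \<otimes> y) * cnj (\<kappa> y)) / of_nat (card ZQ)"

definition lift :: "'a set \<Rightarrow> 'a set" where "lift H = {h \<otimes> y | h y. h \<in> H \<and> y \<in> ZQ}"

text \<open>On \<open>H\<close> it is \<open>\<mu>\<close> and on \<open>ZQ\<close> it is
  \<open>\<kappa>\<close>; the two factors of an element are recovered by means of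
  \<open>\<pi>\<close>.\<close>

definition lift_char :: "'a set \<Rightarrow> ('a \<Rightarrow> complex) \<Rightarrow> 'a \<Rightarrow> complex" where
  "lift_char H \<mu> g = (if g \<in> lift H then \<mu> (\<pi> g) * \<kappa> (inv (\<pi> g) \<otimes> g) else 0)"

lemma lift_char_eq:
  assumes "H \<subseteq> P" "h \<in> H" "y \<in> ZQ"
  shows "lift_char H \<mu> (h \<otimes> y) = \<mu> h * \<kappa> y"
proof -
  have "h \<otimes> y \<in> lift H" using assms by (auto simp: lift_def)
  moreover have "\<pi> (h \<otimes> y) = h" using assms ZQ \<pi>_PQ by blast
  moreover have "inv h \<otimes> (h \<otimes> y) = y" using assms Pc ZQ by (auto simp: cancel_l2)
  ultimately show ?thesis by (simp add: lift_char_def)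
qed

lemma lift_mult:
  assumes "H \<subseteq> P" "h \<in> H" "y \<in> ZQ" "h' \<in> H" "y' \<in> ZQ"
  shows "(h \<otimes> y) \<otimes> (h' \<otimes> y') = (h \<otimes> h') \<otimes> (y \<otimes> y')"
proof -
  have c: "h \<in> carrier G" "h' \<in> carrier G" "y \<in> carrier G" "y' \<in> carrier G" using assms Pc ZQ by auto
  have "(h \<otimes> y) \<otimes> (h' \<otimes> y') = h \<otimes> (y \<otimes> h') \<otimes> y'" using c by (simp add: m_assoc)
  also have "y \<otimes> h' = h' \<otimes> y" using Z_central[OF ZQ(1)] assms c by simp
  finally show ?thesis using c by (simp add: m_assoc)
qed

lemma lift_subgroup:
  assumes H: "subgroup H G" "H \<subseteq> P"
  shows "subgroup (lift H) G"
proof (rule finite_subgroupI[OF fin])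
  show "lift H \<subseteq> carrier G" using H Pc ZQ by (auto simp: lift_def)
  have "\<one> = \<one> \<otimes> \<one>" by simp
  then show "\<one> \<in> lift H" using subgroup.one_closed[OF H(1)] subgroup.one_closed[OF ZQ_subgroup] unfolding lift_def by blast
  fix u v assume uv: "u \<in> lift H" "v \<in> lift H"
  obtain h y where 1: "h \<in> H" "y \<in> ZQ" "u = h \<otimes> y" using uv unfolding lift_def by blast
  obtain h' y' where 2: "h' \<in> H" "y' \<in> ZQ" "v = h' \<otimes> y'" using uv unfolding lift_def by blast
  have "u \<otimes> v = (h \<otimes> h') \<otimes> (y \<otimes> y')" using lift_mult[OF H(2)] 1 2 by simp
  moreover have "h \<otimes> h' \<in> H" "y \<otimes> y' \<in> ZQ" using 1 2 subgroup.m_closed[OF H(1)] subgroup.m_closed[OF ZQ_subgroup] by auto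
  ultimately show "u \<otimes> v \<in> lift H" unfolding lift_def by blast
qed

lemma lift_char:
  assumes H: "subgroup H G" "H \<subseteq> P" and \<mu>: "\<mu> \<in> lin_chars G H"
  shows "lift_char H \<mu> \<in> lin_chars G (lift H)"
proof -
  have "lift_char H \<mu> (u \<otimes> v) = lift_char H \<mu> u * lift_char H \<mu> v" if uv: "u \<in> lift H" "v \<in> lift H" for u v
  proof -
    obtain h y where 1: "h \<in> H" "y \<in> ZQ" "u = h \<otimes> y" using uv unfolding lift_def by blast
    obtain h' y' where 2: "h' \<in> H" "y' \<in> ZQ" "v = h' \<otimes> y'" using uv unfolding lift_def by blast
    have "u \<otimes> v = (h \<otimes> h') \<otimes> (y \<otimes> y')" using lift_mult[OF H(2)] 1 2 by simp
    moreover have "h \<otimes> h' \<in> H" "y \<otimes> y' \<in> ZQ" using 1 2 subgroup.m_closed[OF H(1)] subgroup.m_closed[OF ZQ_subgroup] by auto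
    ultimately show ?thesis
      using 1 2 by (simp add: lift_char_eq[OF H(2)] lin_chars_mult[OF \<mu>] lin_chars_mult[OF \<kappa>] ZQ)
  qed
  moreover have "lift_char H \<mu> \<one> = 1"
    using lift_char_eq[OF H(2) subgroup.one_closed[OF H(1)] subgroup.one_closed[OF ZQ_subgroup], of \<mu>]
    by (simp add: lin_chars_one[OF \<mu>] lin_chars_one[OF \<kappa>])
  ultimately show ?thesis by (auto simp: lin_chars_def lift_char_def)
qed

text \<open>The function \<open>\<psi>P\<close> is given only by a formula. Rewriting the sum over
  \<open>lift H\<close> as a double sum over \<open>H\<close> and \<open>ZQ\<close> identifies its
  multiplicities with multiplicities in \<open>\<psi>\<close>, which are known to be
  natural.\<close>

lemma char_mult_lift:
  assumes H: "subgroup H G" "H \<subseteq> P" and \<mu>: "\<mu> \<in> lin_chars G H"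
  shows "char_mult \<psi> (lift H) (lift_char H \<mu>) = char_mult \<psi>P H \<mu>"
proof -
  have inj: "inj_on (\<lambda>(h, y). h \<otimes> y) (H \<times> ZQ)"
    using bij_betw_imp_inj_on[OF bij_PQ[OF H(2)]] by (rule inj_on_subset) (auto simp: ZQ)
  have img: "lift H = (\<lambda>(h, y). h \<otimes> y) ` (H \<times> ZQ)" unfolding lift_def by auto
  have card: "card (lift H) = card H * card ZQ" unfolding img by (simp add: card_image[OF inj] card_cartesian_product)
  have "(\<Sum>g\<in>lift H. \<psi> g * cnj (lift_char H \<mu> g)) = (\<Sum>(h, y)\<in>H \<times> ZQ. \<psi> (h \<otimes> y) * cnj (lift_char H \<mu> (h \<otimes> y)))"
    unfolding img sum.reindex[OF inj] by (simp add: case_prod_unfold)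
  also have "\<dots> = (\<Sum>(h, y)\<in>H \<times> ZQ. \<psi> (h \<otimes> y) * cnj (\<kappa> y) * cnj (\<mu> h))"
    by (intro sum.cong refl) (auto simp: lift_char_eq[OF H(2)] mult_ac)
  also have "\<dots> = (\<Sum>h\<in>H. (\<Sum>y\<in>ZQ. \<psi> (h \<otimes> y) * cnj (\<kappa> y)) * cnj (\<mu> h))"
    unfolding sum.cartesian_product[symmetric] by (simp add: sum_distrib_right)
  finally have "(\<Sum>g\<in>lift H. \<psi> g * cnj (lift_char H \<mu> g)) = (\<Sum>h\<in>H. (\<Sum>y\<in>ZQ. \<psi> (h \<otimes> y) * cnj (\<kappa> y)) * cnj (\<mu> h))" .
  moreover have "(\<Sum>h\<in>H. \<psi>P h * cnj (\<mu> h)) = (\<Sum>h\<in>H. (\<Sum>y\<in>ZQ. \<psi> (h \<otimes> y) * cnj (\<kappa> y)) * cnj (\<mu> h)) / of_nat (card ZQ)"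
    by (subst sum_divide_distrib) (simp add: \<psi>P_def)
  ultimately show ?thesis by (simp add: char_mult_def card mult.commute)
qed

definition "\<theta>P = (\<lambda>x. if x \<in> ZP then \<kappa> x else 0)"

lemma \<theta>P: "\<theta>P \<in> lin_chars G ZP"
  unfolding \<theta>P_def by (rule lin_chars_subgroup[OF \<kappa> ZP_subgroup]) (auto simp: ZP_def)

lemma \<pi>_ZP: "z \<in> Z \<Longrightarrow> \<pi> z \<in> ZP" "z \<in> Z \<Longrightarrow> inv (\<pi> z) \<otimes> z \<in> ZQ"
  using Zc \<pi>_in_P decomp subgroup_pow_closed[OF Z] subgroup.m_closed[OF Z] subgroup.m_inv_closed[OF Z]
  by (auto simp: ZP_def ZQ_def)

lemma lift_ZP: "lift ZP = Z"
proof
  show "lift ZP \<subseteq> Z" using subgroup.m_closed[OF Z] ZQ by (auto simp: lift_def ZP_def)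
  show "Z \<subseteq> lift ZP" using \<pi>_ZP decomp(2) Zc unfolding lift_def by blast
qed

lemma lift_char_ZP: "lift_char ZP \<theta>P = \<kappa>"
proof
  fix z show "lift_char ZP \<theta>P z = \<kappa> z"
  proof (cases "z \<in> Z")
    case True
    have "lift_char ZP \<theta>P (\<pi> z \<otimes> (inv (\<pi> z) \<otimes> z)) = \<kappa> (\<pi> z) * \<kappa> (inv (\<pi> z) \<otimes> z)"
      using \<pi>_ZP[OF True] by (subst lift_char_eq) (auto simp: \<theta>P_def ZP_def)
    also have "\<dots> = \<kappa> (\<pi> z \<otimes> (inv (\<pi> z) \<otimes> z))"
      using \<pi>_ZP[OF True] by (simp add: lin_chars_mult[OF \<kappa>] ZP_def ZQ)
    finally show ?thesis using decomp(2)[OF Zc[OF True]] by simp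
  qed (simp add: lift_char_def lift_ZP lin_chars_outside[OF \<kappa>])
qed

lemma char_mult_ZP: "char_mult \<psi>P ZP \<theta>P = char_mult \<psi> Z \<kappa>"
  using char_mult_lift[OF ZP_subgroup _ \<theta>P] by (simp add: lift_ZP lift_char_ZP) (simp add: ZP_def)

lemma \<psi>P_mult: "subgroup H G \<Longrightarrow> H \<subseteq> P \<Longrightarrow> \<mu> \<in> lin_chars G H \<Longrightarrow> char_mult \<psi>P H \<mu> \<in> \<nat>"
  using \<psi>_mult[OF lift_subgroup lift_char] by (simp add: char_mult_lift)

lemma \<psi>P_conj: "g \<in> P \<Longrightarrow> x \<in> P \<Longrightarrow> \<psi>P (g \<otimes> x \<otimes> inv g) = \<psi>P x"
proof -
  assume gx: "g \<in> P" "x \<in> P"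
  have "\<psi> (g \<otimes> x \<otimes> inv g \<otimes> y) = \<psi> (x \<otimes> y)" if y: "y \<in> ZQ" for y
  proof -
    have "g \<otimes> (x \<otimes> y) \<otimes> inv g = g \<otimes> x \<otimes> (y \<otimes> inv g)" using gx Pc ZQ(3)[OF y] by (simp add: m_assoc)
    also have "y \<otimes> inv g = inv g \<otimes> y" using Z_central[OF ZQ(1)[OF y]] gx Pc by simp
    finally have "g \<otimes> x \<otimes> inv g \<otimes> y = g \<otimes> (x \<otimes> y) \<otimes> inv g" using gx Pc ZQ(3)[OF y] by (simp add: m_assoc)
    then show ?thesis using \<psi>_conj[of g "x \<otimes> y"] gx Pc ZQ(3)[OF y] by simp
  qed
  then show ?thesis by (simp add: \<psi>P_def)
qed

text \<open>The exponent \<open>j\<close> is replaced by some \<open>i\<close> with the same residue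
  modulo \<open>p ^ a\<close> and residue 1 modulo \<open>b\<close>. The i-th power acts as the j-th
  power on \<open>P\<close>, fixes \<open>ZQ\<close> elementwise, and leaves \<open>\<psi>\<close>
  unchanged because \<open>i\<close> is coprime to the group order.\<close>

lemma \<psi>P_pow:
  assumes x: "x \<in> P" and j: "coprime j (p ^ a)"
  shows "\<psi>P (x [^] (j::nat)) = \<psi>P x"
proof -
  obtain i where i: "[i = j] (mod p ^ a)" "[i = 1] (mod b)"
    using binary_chinese_remainder_nat[OF coprime_pb] by blast
  have "coprime i (p ^ a)" using i(1) j by (metis cong_imp_coprime cong_sym)
  moreover have "coprime i b" using i(2) by (metis cong_imp_coprime cong_sym coprime_1_left)
  ultimately have ci: "coprime i (Coset.order G)" by (simp add: order)
  have "\<psi> (x [^] j \<otimes> y) = \<psi> (x \<otimes> y)" if y: "y \<in> ZQ" for y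
  proof -
    have yc: "y \<in> carrier G" and xc: "x \<in> carrier G" using ZQ y x Pc by auto
    have "(x \<otimes> y) [^] i = x [^] i \<otimes> y [^] i"
      using Z_central[OF ZQ(1)[OF y] xc] xc yc by (simp add: pow_mult_distrib)
    also have "x [^] i = x [^] j" using pow_cong[OF xc _ i(1)] x by (simp add: P_def)
    also have "y [^] i = y" using pow_cong[OF yc Q_exponent[OF ZQ(2)[OF y]] i(2)] yc by simp
    finally show ?thesis using \<psi>_pow[OF _ ci, of "x \<otimes> y"] xc yc by simp
  qed
  then show ?thesis by (simp add: \<psi>P_def)
qed

text \<open>The values on \<open>ZP\<close> are exactly the values of \<open>\<kappa>\<close> of
  p-power order: such a value is unchanged by raising to the power \<open>e\<close>, so it is also
  attained at the image of its argument under \<open>\<pi>\<close>.\<close>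

lemma image_ZP: "card (\<theta>P ` ZP) = p ^ multiplicity p (card (\<kappa> ` Z))"
proof -
  let ?N = "card (\<kappa> ` Z)" let ?k = "multiplicity p ?N"
  have N: "?N > 0" "\<kappa> ` Z = {w. w ^ ?N = 1}" using lin_char_image[OF Z \<kappa> fin] by auto
  have p0: "p > 0" using p by (rule prime_gt_0_nat)
  obtain N' where N': "?N = p ^ ?k * N'" using multiplicity_dvd[of p ?N] by (auto elim: dvdE)
  have "\<not> p dvd N'"
  proof
    assume "p dvd N'"
    then have "p ^ Suc ?k dvd ?N" by (subst N') (auto simp: mult.commute)
    then show False using p N(1) by (subst (asm) power_dvd_iff_le_multiplicity) auto
  qed
  then have cop: "coprime N' (p ^ a)" using prime_imp_coprime[OF p] by (simp add: coprime_commute)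
  have pow1: "\<kappa> z ^ (p ^ a * b) = 1" if "z \<in> Z" for z
    using lin_chars_pow[OF Z \<kappa> that, of "p ^ a * b"] pow_order[OF Zc[OF that]] lin_chars_one[OF \<kappa>] by simp
  have "?N dvd p ^ a * b"
    by (rule roots_unity_subset_imp_dvd) (use N pow1 in auto)
  then have "p ^ ?k dvd p ^ a * b" using multiplicity_dvd dvd_trans by blast
  moreover have "coprime (p ^ ?k) b" using prime_imp_coprime[OF p pb] by simp
  ultimately have pk: "p ^ ?k dvd p ^ a" using coprime_dvd_mult_left_iff by blast
  have "\<theta>P ` ZP = {w. w ^ (p ^ ?k) = 1}"
  proof (intro equalityI subsetI)
    fix w assume "w \<in> \<theta>P ` ZP"
    then obtain z where z: "z \<in> Z" "z \<in> P" "w = \<kappa> z" by (auto simp: ZP_def \<theta>P_def)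
    have "w ^ (p ^ a) = 1"
      using lin_chars_pow[OF Z \<kappa> z(1), of "p ^ a"] z lin_chars_one[OF \<kappa>] by (simp add: P_def)
    then have 1: "(w ^ (p ^ ?k)) ^ (p ^ a) = 1" by (metis mult.commute power_mult power_one)
    have "w ^ ?N = 1" using N z by blast
    then have "(w ^ (p ^ ?k)) ^ N' = 1" using N' by (metis power_mult)
    then show "w \<in> {w. w ^ (p ^ ?k) = 1}" using complex_eq_1_if_coprime_powers[OF _ 1 cop] by simp
  next
    fix w :: complex assume w: "w \<in> {w. w ^ (p ^ ?k) = 1}"
    then have "w ^ (p ^ ?k * N') = 1" by (simp add: power_mult)
    then have "w \<in> \<kappa> ` Z" using N(2) N' by auto
    then obtain z where z: "z \<in> Z" "w = \<kappa> z" by auto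
    have "[e = 1] (mod p ^ ?k)" using e(1) pk by (rule cong_dvd_modulus_nat)
    moreover have we: "w ^ m = w ^ (m mod p ^ ?k)" for m
    proof -
      have "w ^ m = w ^ (p ^ ?k * (m div p ^ ?k) + m mod p ^ ?k)" by simp
      also have "\<dots> = w ^ (m mod p ^ ?k)" using w by (simp only: power_add power_mult) simp
      finally show ?thesis .
    qed
    ultimately have "w ^ e = w" using we[of e] we[of 1] by (simp add: cong_def)
    then have "\<kappa> (\<pi> z) = w" using lin_chars_pow[OF Z \<kappa> z(1)] z by simp
    then show "w \<in> \<theta>P ` ZP" using \<pi>_ZP(1)[OF z(1)] by (force simp: \<theta>P_def image_iff)
  qed
  then show ?thesis using p0 by (simp add: card_roots_unity_eq)
qed

text \<open>The subgroup found inside \<open>P\<close> is pulled back along \<open>\<pi>\<close>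
  with the same index. Elements of order \<open>p\<close> belong to \<open>P\<close>, so for them
  membership in the preimage means membership in the original subgroup.\<close>

theorem exists_subgroup:
  assumes nz: "char_mult \<psi> Z \<kappa> \<noteq> 0" and s: "s \<in> Z" "s [^] p = \<one>" "\<kappa> s \<noteq> 1"
  shows "\<exists>K. subgroup K G \<and> (\<forall>z\<in>K \<inter> Z. z [^] p = \<one> \<longrightarrow> \<kappa> z = 1) \<and>
    real (card (carrier G)) \<le> real (card K) * (real (p ^ multiplicity p (card (\<kappa> ` Z))) * Re (char_mult \<psi> Z \<kappa>))"
proof -
  let ?P = "G\<lparr>carrier := P\<rparr>"
  have sc: "s \<in> carrier G" using s Zc by auto
  have "s \<noteq> \<one>" using s lin_chars_one[OF \<kappa>] by auto
  have "p dvd p ^ a * b"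
  proof (rule ccontr)
    assume "\<not> p dvd p ^ a * b"
    then have "coprime p (p ^ a * b)" by (rule prime_imp_coprime[OF p])
    then show False using eq_one_if_coprime_powers[OF sc s(2) pow_order[OF sc]] \<open>s \<noteq> \<one>\<close> by blast
  qed
  then have a0: "a > 0" using pb by (cases a) auto
  have podd: "odd p" using odd_order order a0 by (auto simp: dvd_trans)
  have inP: "z \<in> P" if z: "z \<in> carrier G" "z [^] p = \<one>" for z
  proof -
    obtain c where "a = Suc c" using a0 by (cases a) auto
    then have "z [^] (p ^ a) = \<one>" using z nat_pow_pow[OF z(1), of p "p ^ c"] by simp
    then show ?thesis using z by (simp add: P_def)
  qed
  have grp: "group ?P" by (rule subgroup_imp_group[OF P_subgroup])
  have pow: "x [^]\<^bsub>?P\<^esub> (k::nat) = x [^] k" for x k using nat_pow_consistent[of x k P] by simp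
  have inv: "inv\<^bsub>?P\<^esub> x = inv x" if "x \<in> P" for x using m_inv_consistent[OF P_subgroup that] .
  have comm: "commut ?P x y = commut G x y" if "x \<in> P" "y \<in> P" for x y using that by (simp add: commut_def inv)
  have lin: "lin_chars ?P H = lin_chars G H" for H by (simp add: lin_chars_def)
  have sub: "subgroup H G" "H \<subseteq> P" if "subgroup H ?P" for H
    using incl_subgroup[OF P_subgroup that] subgroup.subset[OF that] by auto
  interpret A: central_char ?P p a ZP \<psi>P \<theta>P
  proof (intro central_char.intro class2_group.intro class2_group_axioms.intro central_char_axioms.intro)
    show "group ?P" by (rule grp)
    show "commut ?P x y \<otimes>\<^bsub>?P\<^esub> z = z \<otimes>\<^bsub>?P\<^esub> commut ?P x y"
      if "x \<in> carrier ?P" "y \<in> carrier ?P" "z \<in> carrier ?P" for x y z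
      using that commut_central Pc by (simp add: comm)
    show "finite (carrier ?P)" using fin Pc by (simp add: finite_subset[OF subgroup.subset[OF P_subgroup]])
    show "prime p" by (rule p)
    show "odd p" by (rule podd)
    show "x [^]\<^bsub>?P\<^esub> (p ^ a) = \<one>\<^bsub>?P\<^esub>" if "x \<in> carrier ?P" for x unfolding pow using that by (simp add: P_def)
    show "subgroup ZP ?P" by (rule subgroup_incl[OF ZP_subgroup P_subgroup]) (auto simp: ZP_def)
    show "z \<otimes>\<^bsub>?P\<^esub> x = x \<otimes>\<^bsub>?P\<^esub> z" if "z \<in> ZP" "x \<in> carrier ?P" for z x
      using that Z_central Pc by (simp add: ZP_def)
    show "commut ?P x y \<in> ZP" if "x \<in> carrier ?P" "y \<in> carrier ?P" for x y
      using that commut_Z Pc subgroup_commut_closed[OF P_subgroup] by (simp add: comm ZP_def)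
    show "\<psi>P (g \<otimes>\<^bsub>?P\<^esub> x \<otimes>\<^bsub>?P\<^esub> inv\<^bsub>?P\<^esub> g) = \<psi>P x" if "g \<in> carrier ?P" "x \<in> carrier ?P" for g x
      using that \<psi>P_conj by (simp add: inv)
    show "\<psi>P (x [^]\<^bsub>?P\<^esub> j) = \<psi>P x" if "x \<in> carrier ?P" "coprime j (p ^ a)" for x and j :: nat
      using that \<psi>P_pow[of x j] by (simp add: pow)
    show "char_mult \<psi>P H \<chi> \<in> \<nat>" if "subgroup H ?P" "\<chi> \<in> lin_chars ?P H" for H \<chi>
      using \<psi>P_mult sub[OF that(1)] that(2) by (simp add: lin)
    show "\<theta>P \<in> lin_chars ?P ZP" using \<theta>P by (simp add: lin)
    show "char_mult \<psi>P ZP \<theta>P \<noteq> 0" using nz by (simp add: char_mult_ZP)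
    show "\<exists>z\<in>ZP. \<theta>P z \<noteq> 1" using s inP[OF sc] by (intro bexI[of _ s]) (auto simp: ZP_def \<theta>P_def)
  qed
  obtain K where K: "subgroup K ?P" "\<forall>z\<in>K \<inter> ZP. \<theta>P z = 1"
    "real (card P) \<le> real (card K) * (real (card (\<theta>P ` ZP)) * Re (char_mult \<psi>P ZP \<theta>P))"
    using A.exists_subgroup_small_index by auto
  let ?K = "{g \<in> carrier G. \<pi> g \<in> K}"
  have KG: "subgroup K G" "K \<subseteq> P" using sub[OF K(1)] by auto
  have cK: "card ?K = card K * card Q"
    using bij_betw_same_card[OF bij_PQ[OF KG(2)]] by (simp add: card_cartesian_product)
  have "{g \<in> carrier G. \<pi> g \<in> P} = carrier G" using \<pi>_in_P by auto
  then have cG: "card (carrier G) = card P * card Q"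
    using bij_betw_same_card[OF bij_PQ[of P]] by (simp add: card_cartesian_product)
  have "subgroup ?K G"
    by (rule finite_subgroupI[OF fin])
      (auto simp: \<pi>_mult subgroup.one_closed[OF KG(1)] subgroup.m_closed[OF KG(1)])
  moreover have "\<forall>z\<in>?K \<inter> Z. z [^] p = \<one> \<longrightarrow> \<kappa> z = 1"
  proof (intro ballI impI)
    fix z assume z: "z \<in> ?K \<inter> Z" "z [^] p = \<one>"
    then have zP: "z \<in> P" using inP by auto
    then have "z \<in> K \<inter> ZP" using z \<pi>_P by (auto simp: ZP_def)
    then show "\<kappa> z = 1" using K(2) by (auto simp: \<theta>P_def)
  qed
  moreover have "real (card (carrier G)) \<le> real (card ?K) * (real (p ^ multiplicity p (card (\<kappa> ` Z))) * Re (char_mult \<psi> Z \<kappa>))"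
  proof -
    have "real (card P) * real (card Q) \<le> real (card K) * (real (card (\<theta>P ` ZP)) * Re (char_mult \<psi>P ZP \<theta>P)) * real (card Q)"
      using K(3) by (intro mult_right_mono) auto
    then show ?thesis by (simp add: cG cK image_ZP char_mult_ZP mult_ac)
  qed
  ultimately show ?thesis by blast
qed

end

context nat_character
begin

theorem exists_subgroup_for_prime:
  assumes \<kappa>: "\<kappa> \<in> lin_chars G Z" "char_mult \<psi> Z \<kappa> \<noteq> 0"
    and p: "prime p" and s: "s \<in> Z" "s [^] p = \<one>" "\<kappa> s \<noteq> 1"
  shows "\<exists>K. subgroup K G \<and> (\<forall>z\<in>K \<inter> Z. z [^] p = \<one> \<longrightarrow> \<kappa> z = 1) \<and>
    real (card (carrier G)) \<le> real (card K) * (real (p ^ multiplicity p (card (\<kappa> ` Z))) * Re (char_mult \<psi> Z \<kappa>))"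
proof -
  define a where "a = multiplicity p (Coset.order G)"
  obtain b where b: "Coset.order G = p ^ a * b" "\<not> p dvd b"
    using multiplicity_decompose'[of "Coset.order G" p] order_pos p not_prime_unit unfolding a_def by blast
  have cop: "coprime (p ^ a) b" using prime_imp_coprime[OF p b(2)] by simp
  obtain e where e: "[e = 1] (mod p ^ a)" "[e = 0] (mod b)"
    using binary_chinese_remainder_nat[OF cop] by blast
  interpret p_part_char G \<psi> Z p a b e \<kappa>
    by (rule p_part_char.intro, rule p_part.intro, rule nat_character_axioms, rule p_part_axioms.intro)
      (use p b e \<kappa> in \<open>auto simp: cong_0_iff p_part_char_axioms_def\<close>)
  show ?thesis using exists_subgroup[OF assms(2) s] .
qed

end

section \<open>Selection of a faithful family of subgroups\<close>

text \<open>To \<open>j\<close> is added \<open>N\<close> times the product \<open>D\<close> of the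
  primes of \<open>M\<close> that do not divide \<open>j\<close>. Each prime divisor of
  \<open>M\<close> then divides exactly one of the two summands \<open>j\<close> and
  \<open>N * D\<close>.\<close>

lemma exists_coprime_lift:
  assumes j: "coprime j N" and N: "N dvd M" and M: "M > (0::nat)"
  shows "\<exists>i>0. [i = j] (mod N) \<and> coprime i M"
proof -
  let ?R = "{r. prime r \<and> r dvd M \<and> \<not> r dvd j}"
  have fin: "finite ?R" by (rule finite_subset[of _ "{..M}"]) (use M dvd_imp_le in auto)
  define D where "D = \<Prod>?R"
  have D0: "D > 0" unfolding D_def using prime_gt_0_nat by (intro prod_pos) auto
  have N0: "N > 0" using N M by (auto intro: Nat.gr0I)
  let ?i = "j + N * D"
  have npd: "\<not> r dvd ?i" if r: "prime r" "r dvd M" for r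
  proof
    assume "r dvd ?i"
    show False
    proof (cases "r dvd j")
      case True
      then have "r dvd N * D" using \<open>r dvd ?i\<close> by (simp add: dvd_add_right_iff)
      moreover have "\<not> r dvd N" using True j r(1) by (meson coprime_common_divisor not_prime_unit)
      ultimately have "r dvd D" using r(1) by (simp add: prime_dvd_mult_iff)
      then obtain s where "prime s" "\<not> s dvd j" "r dvd s"
        unfolding D_def using r(1) fin by (auto simp: prime_dvd_prod_iff)
      then show False using True r(1) primes_dvd_imp_eq by blast
    next
      case False
      then have "r dvd D" unfolding D_def using r fin by (intro dvd_prodI) auto
      then show False using False \<open>r dvd ?i\<close> by (simp add: dvd_add_left_iff)
    qed
  qed
  have "coprime ?i M"
  proof (rule coprimeI)
    fix d assume d: "d dvd ?i" "d dvd M"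
    show "is_unit d"
    proof (rule ccontr)
      assume "\<not> is_unit d"
      then obtain r where "prime r" "r dvd d" using prime_factor_nat[of d] by auto
      then show False using npd[of r] d dvd_trans by blast
    qed
  qed
  moreover have "[?i = j] (mod N)" by (simp add: cong_def)
  ultimately show ?thesis using N0 D0 by (intro exI[of _ ?i]) simp
qed

section \<open>Galois classes of the characters of the centre\<close>

locale faithful_nat_character = nat_character +
  fixes n :: nat
  assumes \<psi>_one: "\<psi> \<one> = of_nat n"
    and \<psi>_kernel: "\<And>H. subgroup H G \<Longrightarrow> (\<And>h. h \<in> H \<Longrightarrow> \<psi> h = of_nat n) \<Longrightarrow> H = {\<one>}"
    and Z_center: "\<And>x. x \<in> carrier G \<Longrightarrow> (\<And>g. g \<in> carrier G \<Longrightarrow> x \<otimes> g = g \<otimes> x) \<Longrightarrow> x \<in> Z"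
begin

abbreviation "X \<equiv> lin_chars G Z"
abbreviation "m \<chi> \<equiv> Re (char_mult \<psi> Z \<chi>)"
abbreviation "N \<chi> \<equiv> card (\<chi> ` Z)"
definition "W = {\<chi> \<in> X. char_mult \<psi> Z \<chi> \<noteq> 0}"

lemma Z_comm: "x \<in> Z \<Longrightarrow> y \<in> Z \<Longrightarrow> x \<otimes> y = y \<otimes> x" using Z_central Zc by auto

lemma finite_X: "finite X"
  using fourier_inversion(1)[OF fin Z Z_comm] subgroup.one_closed[OF Z] by blast

lemma m_nonneg: "\<chi> \<in> X \<Longrightarrow> m \<chi> \<ge> 0" and m_eq: "\<chi> \<in> X \<Longrightarrow> char_mult \<psi> Z \<chi> = of_real (m \<chi>)"
  using \<psi>_mult[OF Z, of \<chi>] by (auto elim!: Nats_cases)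

lemma \<psi>_Z: "z \<in> Z \<Longrightarrow> \<psi> z = (\<Sum>\<chi>\<in>X. of_real (m \<chi>) * \<chi> z)"
proof -
  assume z: "z \<in> Z"
  have "\<psi> z = (\<Sum>\<chi>\<in>X. char_mult \<psi> Z \<chi> * \<chi> z)" by (rule fourier_inversion(2)[OF fin Z Z_comm z])
  also have "\<dots> = (\<Sum>\<chi>\<in>X. of_real (m \<chi>) * \<chi> z)" by (intro sum.cong refl) (simp add: m_eq[symmetric])
  finally show ?thesis .
qed

lemma sum_m: "(\<Sum>\<chi>\<in>X. m \<chi>) = real n"
proof -
  have "of_nat n = (\<Sum>\<chi>\<in>X. of_real (m \<chi>) * \<chi> \<one>)" using \<psi>_Z[OF subgroup.one_closed[OF Z]] \<psi>_one by simp
  also have "\<dots> = (\<Sum>\<chi>\<in>X. of_real (m \<chi>))" by (intro sum.cong refl) (simp add: lin_chars_one)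
  finally have "complex_of_real (\<Sum>\<chi>\<in>X. m \<chi>) = complex_of_real (real n)" by simp
  then show ?thesis by (simp only: of_real_eq_iff)
qed

text \<open>The common kernel of the characters in \<open>W\<close> is a subgroup on which
  \<open>\<psi>\<close> is constantly \<open>n\<close>, hence trivial by faithfulness.\<close>

lemma W_separates: "s \<in> Z \<Longrightarrow> s \<noteq> \<one> \<Longrightarrow> \<exists>\<chi>\<in>W. \<chi> s \<noteq> 1"
proof (rule ccontr)
  assume s: "s \<in> Z" "s \<noteq> \<one>" "\<not> (\<exists>\<chi>\<in>W. \<chi> s \<noteq> 1)"
  let ?H = "{h \<in> Z. \<forall>\<chi>\<in>W. \<chi> h = 1}"
  have H: "subgroup ?H G"
    by (rule finite_subgroupI[OF fin])
      (auto simp: W_def Zc subgroup.one_closed[OF Z] subgroup.m_closed[OF Z] lin_chars_one lin_chars_mult)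
  have "\<psi> h = of_nat n" if h: "h \<in> ?H" for h
  proof -
    have "\<psi> h = (\<Sum>\<chi>\<in>X. of_real (m \<chi>) * \<chi> h)" using \<psi>_Z h by simp
    also have "\<dots> = (\<Sum>\<chi>\<in>X. of_real (m \<chi>))"
    proof (intro sum.cong refl)
      fix \<chi> assume \<chi>: "\<chi> \<in> X"
      then have "char_mult \<psi> Z \<chi> = 0 \<or> \<chi> h = 1" using h by (auto simp: W_def)
      then show "of_real (m \<chi>) * \<chi> h = of_real (m \<chi>)" by auto
    qed
    also have "\<dots> = of_real (\<Sum>\<chi>\<in>X. m \<chi>)" by simp
    finally show ?thesis by (simp only: sum_m) simp
  qed
  then have "?H = {\<one>}" by (rule \<psi>_kernel[OF H])
  moreover have "s \<in> ?H" using s by auto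
  ultimately show False using s by auto
qed

text \<open>The orbit of \<open>\<chi>\<close> under the Galois group of the cyclotomic field of
  roots of unity of exponent the group order. Positive exponents preserve the value 0 outside
  \<open>Z\<close>.\<close>

definition galois_class :: "('a \<Rightarrow> complex) \<Rightarrow> ('a \<Rightarrow> complex) set" where
  "galois_class \<chi> = {\<lambda>x. \<chi> x ^ j | j. coprime j (Coset.order G) \<and> j > 0}"

lemma X_order: "\<chi> \<in> X \<Longrightarrow> z \<in> Z \<Longrightarrow> \<chi> z ^ Coset.order G = 1"
  using lin_chars_pow[OF Z, of \<chi> z "Coset.order G"] pow_order_eq_1[OF Zc] lin_chars_one[of \<chi> G Z] by simp

lemma X_power_cong:
  assumes \<chi>: "\<chi> \<in> X" and ij: "[i = j] (mod k)" "i > 0" "j > 0" and k: "\<And>z. z \<in> Z \<Longrightarrow> \<chi> z ^ k = 1"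
  shows "(\<lambda>x. \<chi> x ^ i) = (\<lambda>x. \<chi> x ^ j)"
proof
  fix x show "\<chi> x ^ i = \<chi> x ^ j"
  proof (cases "x \<in> Z")
    case True
    have "\<chi> x ^ l = \<chi> x ^ (l mod k)" for l
    proof -
      have "\<chi> x ^ l = \<chi> x ^ (k * (l div k) + l mod k)" by simp
      also have "\<dots> = \<chi> x ^ (l mod k)" using k[OF True] by (simp only: power_add power_mult) simp
      finally show ?thesis .
    qed
    from this[of i] this[of j] ij(1) show ?thesis by (simp add: cong_def)
  next
    case False then show ?thesis using ij lin_chars_outside[OF \<chi>] by (simp add: zero_power)
  qed
qed

lemma galois_refl: "\<chi> \<in> galois_class \<chi>"
  unfolding galois_class_def by (intro CollectI exI[of _ 1]) auto

lemma galois_subset: "\<chi> \<in> X \<Longrightarrow> galois_class \<chi> \<subseteq> X"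
  using lin_chars_power by (auto simp: galois_class_def)

lemma galois_trans: "\<chi>' \<in> galois_class \<chi> \<Longrightarrow> galois_class \<chi>' \<subseteq> galois_class \<chi>"
proof
  fix \<eta> assume 1: "\<chi>' \<in> galois_class \<chi>" and 2: "\<eta> \<in> galois_class \<chi>'"
  obtain i where i: "\<chi>' = (\<lambda>x. \<chi> x ^ i)" "coprime i (Coset.order G)" "i > 0" using 1 unfolding galois_class_def by auto
  obtain j where j: "\<eta> = (\<lambda>x. \<chi>' x ^ j)" "coprime j (Coset.order G)" "j > 0" using 2 unfolding galois_class_def by auto
  have "\<eta> = (\<lambda>x. \<chi> x ^ (i * j))" using i j by (simp add: power_mult)
  moreover have "coprime (i * j) (Coset.order G)" using i j by simp
  ultimately show "\<eta> \<in> galois_class \<chi>" using i j unfolding galois_class_def by (intro CollectI exI[of _ "i * j"]) simp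
qed

lemma galois_sym: "\<chi> \<in> X \<Longrightarrow> \<chi>' \<in> galois_class \<chi> \<Longrightarrow> \<chi> \<in> galois_class \<chi>'"
proof -
  assume \<chi>: "\<chi> \<in> X" and "\<chi>' \<in> galois_class \<chi>"
  then obtain i where i: "\<chi>' = (\<lambda>x. \<chi> x ^ i)" "coprime i (Coset.order G)" "i > 0" unfolding galois_class_def by auto
  obtain k0 where k0: "[i * k0 = 1] (mod Coset.order G)" using cong_solve_coprime_nat[OF i(2)] by auto
  define k where "k = k0 + Coset.order G"
  have k: "[i * k = 1] (mod Coset.order G)" using k0 by (simp add: k_def cong_def distrib_left)
  have kp: "k > 0" using order_pos by (simp add: k_def)
  have "coprime (i * k) (Coset.order G)" using k by (metis cong_imp_coprime cong_sym coprime_1_left)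
  then have ck: "coprime k (Coset.order G)" by simp
  have "(\<lambda>x. \<chi> x ^ (i * k)) = (\<lambda>x. \<chi> x ^ 1)"
    using i kp by (intro X_power_cong[OF \<chi> k]) (auto simp: X_order[OF \<chi>])
  then have "\<chi> = (\<lambda>x. \<chi>' x ^ k)" unfolding i(1) by (simp add: power_mult)
  then show ?thesis using ck kp unfolding galois_class_def by (intro CollectI exI[of _ k]) simp
qed

lemma galois_eq: "\<chi> \<in> X \<Longrightarrow> \<chi>' \<in> galois_class \<chi> \<Longrightarrow> galois_class \<chi>' = galois_class \<chi>"
  using galois_trans galois_sym by blast

lemma galois_mult: "\<chi> \<in> X \<Longrightarrow> \<chi>' \<in> galois_class \<chi> \<Longrightarrow> char_mult \<psi> Z \<chi>' = char_mult \<psi> Z \<chi>"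
  using char_mult_\<psi>_power[OF Z] by (auto simp: galois_class_def)

lemma N_pos: "\<chi> \<in> X \<Longrightarrow> N \<chi> > 0" and N_image: "\<chi> \<in> X \<Longrightarrow> \<chi> ` Z = {w. w ^ N \<chi> = 1}"
  using lin_char_image[OF Z _ fin] by auto

lemma N_dvd: "\<chi> \<in> X \<Longrightarrow> N \<chi> dvd Coset.order G"
  using X_order[of \<chi>] N_image[of \<chi>] N_pos[of \<chi>] by (intro roots_unity_subset_imp_dvd) auto

text \<open>The powers with exponents in \<open>totatives (N \<chi>)\<close> are distinct members of the Galois class.\<close>
lemma galois_class_sum_ge:
  assumes \<chi>: "\<chi> \<in> X" and f: "\<And>\<eta>. \<eta> \<in> X \<Longrightarrow> (f \<eta> :: real) \<ge> 0"
  shows "(\<Sum>j\<in>totatives (N \<chi>). f (\<lambda>x. \<chi> x ^ j)) \<le> sum f (galois_class \<chi>)"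
proof -
  let ?p = "\<lambda>j x. \<chi> x ^ j"
  have inj: "inj_on ?p (totatives (N \<chi>))"
  proof (rule linorder_inj_onI)
    fix i j assume ij: "i < j" "i \<in> totatives (N \<chi>)" "j \<in> totatives (N \<chi>)"
    let ?w = "cis (2 * pi / real (N \<chi>))"
    have "?w ^ N \<chi> = 1" using N_pos[OF \<chi>] by (rule cis_root_power_n)
    then have "?w \<in> \<chi> ` Z" using N_image[OF \<chi>] by blast
    then obtain z where z: "?w = \<chi> z" by auto
    have b: "0 < j - i" "j - i < N \<chi>" using ij by (auto simp: in_totatives_iff)
    show "?p i \<noteq> ?p j"
    proof
      assume "?p i = ?p j"
      then have "?w ^ i = ?w ^ j" unfolding z by metis
      moreover have "?w ^ j = ?w ^ i * ?w ^ (j - i)" using ij by (simp flip: power_add)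
      ultimately have "?w ^ (j - i) = 1" by simp
      then show False using cis_root_power_neq_1[OF b] by simp
    qed
  qed auto
  have "?p ` totatives (N \<chi>) \<subseteq> galois_class \<chi>"
  proof (rule image_subsetI)
    fix j assume j: "j \<in> totatives (N \<chi>)"
    then obtain i where i: "i > 0" "[i = j] (mod N \<chi>)" "coprime i (Coset.order G)"
      using exists_coprime_lift[OF _ N_dvd[OF \<chi>] order_pos, of j] by (auto simp: in_totatives_iff)
    have "?p i = ?p j"
      using j i N_image[OF \<chi>] by (intro X_power_cong[OF \<chi> i(2)]) (auto simp: in_totatives_iff)
    moreover have "?p i \<in> galois_class \<chi>"
      using i unfolding galois_class_def by (intro CollectI exI[of _ i]) simp
    ultimately show "?p j \<in> galois_class \<chi>" by simp
  qed
  then have "sum f (?p ` totatives (N \<chi>)) \<le> sum f (galois_class \<chi>)"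
    using f galois_subset[OF \<chi>] finite_subset[OF galois_subset[OF \<chi>] finite_X] by (intro sum_mono2) auto
  then show ?thesis by (simp add: sum.reindex[OF inj])
qed

text \<open>The choice depends on the class as a set only, so conjugate characters have the same
  representative and \<open>W0\<close> meets each class at most once.\<close>

definition "rep \<chi> = (SOME \<eta>. \<eta> \<in> galois_class \<chi>)"
definition "W0 = rep ` W"

lemma rep: "rep \<chi> \<in> galois_class \<chi>"
  using someI[of "\<lambda>\<eta>. \<eta> \<in> galois_class \<chi>" \<chi>] galois_refl by (simp add: rep_def)

lemma W0_X: "\<chi> \<in> W0 \<Longrightarrow> \<chi> \<in> X" and W0_nz: "\<chi> \<in> W0 \<Longrightarrow> char_mult \<psi> Z \<chi> \<noteq> 0"
  using rep galois_subset galois_mult by (auto simp: W0_def W_def)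

lemma W0_disjoint:
  assumes "\<chi> \<in> W0" "\<eta> \<in> W0" "\<chi> \<noteq> \<eta>"
  shows "galois_class \<chi> \<inter> galois_class \<eta> = {}"
proof (rule ccontr)
  assume "galois_class \<chi> \<inter> galois_class \<eta> \<noteq> {}"
  then obtain \<xi> where "\<xi> \<in> galois_class \<chi>" "\<xi> \<in> galois_class \<eta>" by auto
  then have eq: "galois_class \<chi> = galois_class \<eta>" using galois_eq W0_X assms by metis
  have fix_rep: "rep \<zeta> = \<zeta>" if z: "\<zeta> \<in> W0" for \<zeta>
  proof -
    obtain \<xi> where x: "\<zeta> = rep \<xi>" "\<xi> \<in> X" using z by (auto simp: W0_def W_def)
    have "galois_class \<zeta> = galois_class \<xi>" unfolding x(1) by (rule galois_eq[OF x(2) rep])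
    then show ?thesis using x(1) by (simp add: rep_def)
  qed
  have "rep \<chi> = rep \<eta>" unfolding rep_def eq ..
  then show False using fix_rep assms by metis
qed

lemma W0_separates: "s \<in> Z \<Longrightarrow> s \<noteq> \<one> \<Longrightarrow> \<exists>\<chi>\<in>W0. \<chi> s \<noteq> 1"
proof -
  assume s: "s \<in> Z" "s \<noteq> \<one>"
  then obtain \<chi> where \<chi>: "\<chi> \<in> W" "\<chi> s \<noteq> 1" using W_separates by blast
  have "\<chi> \<in> galois_class (rep \<chi>)" using galois_sym rep \<chi> by (auto simp: W_def)
  then obtain j where "\<chi> = (\<lambda>x. rep \<chi> x ^ j)" unfolding galois_class_def by blast
  then have "\<chi> s = rep \<chi> s ^ j" by (rule fun_cong)
  then have "rep \<chi> s \<noteq> 1" using \<chi>(2) by auto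
  then show ?thesis using \<chi>(1) by (auto simp: W0_def)
qed

end

section \<open>Minimal separating sets and the embedding\<close>

context faithful_nat_character
begin

definition separating :: "(('a \<Rightarrow> complex) \<times> nat) set \<Rightarrow> bool" where
  "separating B \<longleftrightarrow> (\<forall>p s. prime p \<and> s \<in> Z \<and> s [^] p = \<one> \<and> s \<noteq> \<one> \<longrightarrow> (\<exists>\<chi>. (\<chi>, p) \<in> B \<and> \<chi> s \<noteq> 1))"

text \<open>Without the given pair some \<open>s\<close> of prime order escapes detection. As
  \<open>B\<close> does detect it, the detecting pair must be the removed one, which also identifies
  the order of \<open>s\<close> as \<open>p\<close>. Duality holds only among the pairs of
  \<open>B\<close> with the same prime.\<close>

lemma separating_dual:
  assumes B: "separating B" and min: "\<And>C. C \<subset> B \<Longrightarrow> \<not> separating C" and b: "(\<chi>, p) \<in> B"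
  shows "\<exists>s\<in>Z. s [^] p = \<one> \<and> \<chi> s \<noteq> 1 \<and> (\<forall>\<eta>. (\<eta>, p) \<in> B \<and> \<eta> \<noteq> \<chi> \<longrightarrow> \<eta> s = 1) \<and> prime p"
proof -
  have "\<not> separating (B - {(\<chi>, p)})" using b by (intro min) auto
  then obtain q s where s: "prime q" "s \<in> Z" "s [^] q = \<one>" "s \<noteq> \<one>"
    and none: "\<And>\<eta>. (\<eta>, q) \<in> B - {(\<chi>, p)} \<Longrightarrow> \<eta> s = 1"
    unfolding separating_def by blast
  obtain \<eta> where \<eta>: "(\<eta>, q) \<in> B" "\<eta> s \<noteq> 1" using B s unfolding separating_def by blast
  then have "\<eta> = \<chi>" "q = p" using none[of \<eta>] by auto
  then show ?thesis using s none \<eta> by (intro bexI[of _ s]) auto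
qed

lemma exists_minimal_separating:
  "\<exists>B \<subseteq> W0 \<times> {p. prime p \<and> p dvd Coset.order G}. finite B \<and> separating B \<and> (\<forall>C. C \<subset> B \<longrightarrow> \<not> separating C)"
proof -
  let ?U = "W0 \<times> {p. prime p \<and> p dvd Coset.order G}"
  have "W0 \<subseteq> X" using W0_X by auto
  then have "finite W0" using finite_X by (rule finite_subset)
  moreover have "finite {p. prime p \<and> p dvd Coset.order G}"
    by (rule finite_subset[of _ "{..Coset.order G}"]) (use order_pos dvd_imp_le in auto)
  ultimately have fU: "finite ?U" by simp
  have "separating ?U"
    unfolding separating_def
  proof (intro allI impI)
    fix p :: nat and s assume s: "prime p \<and> s \<in> Z \<and> s [^] p = \<one> \<and> s \<noteq> \<one>"
    have "p dvd Coset.order G"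
    proof (rule ccontr)
      assume "\<not> p dvd Coset.order G"
      then have "coprime p (Coset.order G)" using s by (intro prime_imp_coprime) auto
      then show False using s eq_one_if_coprime_powers[OF Zc, of s p "Coset.order G"] pow_order_eq_1[OF Zc] by blast
    qed
    then show "\<exists>\<chi>. (\<chi>, p) \<in> ?U \<and> \<chi> s \<noteq> 1" using W0_separates[of s] s by blast
  qed
  then have "\<exists>k. \<exists>B\<subseteq>?U. separating B \<and> card B = k" by blast
  then have L: "\<exists>B\<subseteq>?U. separating B \<and> card B = (LEAST k. \<exists>B\<subseteq>?U. separating B \<and> card B = k)" by (rule LeastI_ex)
  then obtain B where B: "B \<subseteq> ?U" "separating B" "card B = (LEAST k. \<exists>B\<subseteq>?U. separating B \<and> card B = k)" by blast
  have fB: "finite B" using B(1) fU by (rule finite_subset)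
  have "\<not> separating C" if C: "C \<subset> B" for C
  proof
    assume "separating C"
    then have "\<exists>B\<subseteq>?U. separating B \<and> card B = card C" using C B(1) by blast
    then have "card B \<le> card C" unfolding B(3) by (rule Least_le)
    then show False using psubset_card_mono[OF fB C] by simp
  qed
  then show ?thesis using B fB by blast
qed

lemma exists_central_product:
  assumes "finite F" "\<And>\<eta>. \<eta> \<in> F \<Longrightarrow> s \<eta> \<in> Z"
  shows "\<exists>z\<in>Z. \<forall>\<chi>\<in>X. \<chi> z = (\<Prod>\<eta>\<in>F. \<chi> (s \<eta>))"
  using assms
proof (induction F rule: finite_induct)
  case empty
  then show ?case using subgroup.one_closed[OF Z] by (intro bexI[of _ \<one>]) (auto simp: lin_chars_one)
next
  case (insert \<eta> F)
  then obtain z where "z \<in> Z" "\<forall>\<chi>\<in>X. \<chi> z = (\<Prod>\<eta>\<in>F. \<chi> (s \<eta>))" by auto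
  then show ?case using insert by (intro bexI[of _ "s \<eta> \<otimes> z"]) (auto simp: lin_chars_mult subgroup.m_closed[OF Z])
qed

text \<open>If \<open>x\<close> is not in \<open>Z\<close>, a nontrivial commutator of
  \<open>x\<close> lies in the normal subgroup \<open>C\<close> and in \<open>Z\<close>. A suitable
  power of a nontrivial element of the intersection has prime order.\<close>

lemma exists_prime_order_central:
  assumes C: "subgroup C G" "\<And>g x. g \<in> carrier G \<Longrightarrow> x \<in> C \<Longrightarrow> g \<otimes> x \<otimes> inv g \<in> C" and x: "x \<in> C" "x \<noteq> \<one>"
  shows "\<exists>(p::nat) s. prime p \<and> s \<in> C \<inter> Z \<and> s [^] p = \<one> \<and> s \<noteq> \<one>"
proof -
  have Cc: "x \<in> carrier G" if "x \<in> C" for x using subgroup.mem_carrier[OF C(1) that] .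
  have "\<exists>y\<in>C \<inter> Z. y \<noteq> \<one>"
  proof (cases "x \<in> Z")
    case False
    then obtain g where g: "g \<in> carrier G" "x \<otimes> g \<noteq> g \<otimes> x" using Z_center[OF Cc[OF x(1)]] by blast
    have "commut G x g = x \<otimes> (g \<otimes> inv x \<otimes> inv g)" using g x Cc by (simp add: commut_def m_assoc)
    also have "\<dots> \<in> C" using x g C by (intro subgroup.m_closed[OF C(1)] C(2) subgroup.m_inv_closed[OF C(1)])
    finally have "commut G x g \<in> C \<inter> Z" using commut_Z g Cc[OF x(1)] by simp
    then show ?thesis using g commut_eq_one_iff[OF Cc[OF x(1)] g(1)] by auto
  qed (use x in auto)
  then obtain y where y: "y \<in> C" "y \<in> Z" "y \<noteq> \<one>" by auto
  have yc: "y \<in> carrier G" using y Cc by auto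
  define d where "d = (LEAST d. d > 0 \<and> y [^] (d::nat) = \<one>)"
  have "Coset.order G > 0 \<and> y [^] Coset.order G = \<one>" using order_pos pow_order_eq_1[OF yc] by simp
  then have d: "d > 0" "y [^] d = \<one>" using LeastI[of "\<lambda>d. d > 0 \<and> y [^] d = \<one>"] unfolding d_def by auto
  have least: "d \<le> k" if "k > 0" "y [^] k = \<one>" for k using that unfolding d_def by (intro Least_le) simp
  have "d \<noteq> 1" using d y yc by auto
  then obtain p where p: "prime p" "p dvd d" using prime_factor_nat by blast
  then obtain q where q: "d = p * q" by auto
  have q0: "q > 0" "q < d" using d q prime_gt_1_nat[OF p(1)] by auto
  let ?s = "y [^] q"
  have "?s [^] p = \<one>" using d q yc by (simp add: nat_pow_pow mult.commute)
  moreover have "?s \<noteq> \<one>" using least[of q] q0 by auto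
  moreover have "?s \<in> C \<inter> Z" using y subgroup_pow_closed[OF C(1)] subgroup_pow_closed[OF Z] by simp
  ultimately show ?thesis using p(1) by blast
qed

theorem exists_mon_sym_group: "mon G (sym_group n) \<noteq> {}"
proof -
  obtain B where B: "B \<subseteq> W0 \<times> {p. prime p \<and> p dvd Coset.order G}" "finite B" "separating B"
    and min: "\<And>C. C \<subset> B \<Longrightarrow> \<not> separating C"
    using exists_minimal_separating by blast
  have BX: "\<chi> \<in> W0" "\<chi> \<in> X" "char_mult \<psi> Z \<chi> \<noteq> 0" "prime p" if "(\<chi>, p) \<in> B" for \<chi> p
    using that B(1) W0_X W0_nz by auto
  have "\<forall>b\<in>B. \<exists>s. s \<in> Z \<and> s [^] snd b = \<one> \<and> fst b s \<noteq> 1 \<and> (\<forall>\<eta>. (\<eta>, snd b) \<in> B \<and> \<eta> \<noteq> fst b \<longrightarrow> \<eta> s = 1)"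
  proof (rule ballI)
    fix b assume "b \<in> B"
    then have "(fst b, snd b) \<in> B" by simp
    then have "\<exists>s\<in>Z. s [^] snd b = \<one> \<and> fst b s \<noteq> 1 \<and> (\<forall>\<eta>. (\<eta>, snd b) \<in> B \<and> \<eta> \<noteq> fst b \<longrightarrow> \<eta> s = 1) \<and> prime (snd b)"
      using separating_dual[OF B(3), of "fst b" "snd b"] min by simp
    then show "\<exists>s. s \<in> Z \<and> s [^] snd b = \<one> \<and> fst b s \<noteq> 1 \<and> (\<forall>\<eta>. (\<eta>, snd b) \<in> B \<and> \<eta> \<noteq> fst b \<longrightarrow> \<eta> s = 1)"
      by (elim bexE conjE) (intro exI conjI)
  qed
  from bchoice[OF this] obtain s where s0: "\<forall>b\<in>B. s b \<in> Z \<and> s b [^] snd b = \<one> \<and> fst b (s b) \<noteq> 1 \<and>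
      (\<forall>\<eta>. (\<eta>, snd b) \<in> B \<and> \<eta> \<noteq> fst b \<longrightarrow> \<eta> (s b) = 1)" by blast
  have s: "s (\<chi>, p) \<in> Z" "s (\<chi>, p) [^] p = \<one>" "\<chi> (s (\<chi>, p)) \<noteq> 1" if "(\<chi>, p) \<in> B" for \<chi> p
    using bspec[OF s0 that] by simp_all
  have s_dual: "\<eta> (s (\<chi>, p)) = 1" if "(\<chi>, p) \<in> B" "(\<eta>, p) \<in> B" "\<eta> \<noteq> \<chi>" for \<chi> \<eta> p
    using bspec[OF s0 that(1)] that(2,3) by simp
  let ?c = "\<lambda>\<chi> p. real (p ^ multiplicity p (N \<chi>)) * m \<chi>"
  have "\<forall>b\<in>B. \<exists>K. subgroup K G \<and> (\<forall>z\<in>K \<inter> Z. z [^] snd b = \<one> \<longrightarrow> fst b z = 1) \<and>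
      real (card (carrier G)) \<le> real (card K) * ?c (fst b) (snd b)"
  proof (rule ballI)
    fix b assume "b \<in> B"
    then have b: "(fst b, snd b) \<in> B" by simp
    show "\<exists>K. subgroup K G \<and> (\<forall>z\<in>K \<inter> Z. z [^] snd b = \<one> \<longrightarrow> fst b z = 1) \<and>
        real (card (carrier G)) \<le> real (card K) * ?c (fst b) (snd b)"
      by (rule exists_subgroup_for_prime[OF BX(2,3,4)[OF b] s[OF b]])
  qed
  from bchoice[OF this] obtain K where K0: "\<forall>b\<in>B. subgroup (K b) G \<and> (\<forall>z\<in>K b \<inter> Z. z [^] snd b = \<one> \<longrightarrow> fst b z = 1) \<and>
      real (card (carrier G)) \<le> real (card (K b)) * ?c (fst b) (snd b)" by blast
  have K: "subgroup (K b) G" if "b \<in> B" for b using K0 that by blast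
  have index: "real (card (rcosets (K b))) \<le> ?c (fst b) (snd b)" if b: "b \<in> B" for b
  proof -
    have "card (K b) > 0"
      using finite_subset[OF subgroup.subset[OF K[OF b]] fin] subgroup.one_closed[OF K[OF b]] by (auto simp: card_gt_0_iff)
    moreover have "real (card (K b)) * real (card (rcosets (K b))) = real (card (carrier G))"
      using lagrange[OF K[OF b]] by (simp add: Coset.order_def mult.commute flip: of_nat_mult)
    ultimately show ?thesis using K0 b by (metis mult_le_cancel_left_pos of_nat_0_less_iff)
  qed
  define F where "F = fst ` B"
  define T where "T \<chi> = {p. (\<chi>, p) \<in> B}" for \<chi>
  have fF: "finite F" using B(2) by (simp add: F_def)
  have fT: "finite (T \<chi>)" for \<chi>
    by (rule finite_subset[of _ "snd ` B"]) (use B(2) in \<open>force simp: T_def\<close>)+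
  have BT: "B = (SIGMA \<chi>:F. T \<chi>)" by (force simp: F_def T_def)
  \<comment> \<open>One prime is selected for each character, even if several pairs contain it;
    \<open>sum_totatives_ge\<close> makes this one prime pay for all of
    \<open>T \<chi>\<close>.\<close>
  define p0 where "p0 \<chi> = (SOME p. p \<in> T \<chi>)" for \<chi>
  have p0: "p0 \<chi> \<in> T \<chi>" if \<chi>: "\<chi> \<in> F" for \<chi>
  proof -
    obtain p where "(\<chi>, p) \<in> B" using \<chi> by (auto simp: F_def)
    then have "p \<in> T \<chi>" by (simp add: T_def)
    then show ?thesis unfolding p0_def by (rule someI)
  qed
  have FX: "\<chi> \<in> X" "\<chi> \<in> W0" if "\<chi> \<in> F" for \<chi> using that BX by (auto simp: F_def)
  obtain z where z: "z \<in> Z" "\<And>\<chi>. \<chi> \<in> X \<Longrightarrow> \<chi> z = (\<Prod>\<eta>\<in>F. \<chi> (s (\<eta>, p0 \<eta>)))"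
    using exists_central_product[OF fF, of "\<lambda>\<eta>. s (\<eta>, p0 \<eta>)"] s(1) p0 by (auto simp: T_def)
  have class_ge: "(\<Sum>p\<in>T \<chi>. ?c \<chi> p) \<le> (\<Sum>\<eta>\<in>galois_class \<chi>. m \<eta> * (1 - Re (\<eta> z)))" if \<chi>: "\<chi> \<in> F" for \<chi>
  proof -
    have X\<chi>: "\<chi> \<in> X" using FX \<chi> by blast
    have chi_root: "\<chi> (s (\<eta>, p)) ^ p = 1" if "(\<eta>, p) \<in> B" for \<eta> p
      using lin_chars_pow[OF Z X\<chi> s(1)[OF that], of p] s(2)[OF that] lin_chars_one[OF X\<chi>] by simp
    have chi_N: "\<chi> y ^ N \<chi> = 1" if "y \<in> Z" for y using N_image[OF X\<chi>] that by blast
    have oddN: "odd (N \<chi>)" using N_dvd[OF X\<chi>] odd_order dvd_trans by blast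
    let ?p = "p0 \<chi>"
    let ?u = "\<chi> (s (\<chi>, ?p))" and ?w = "\<Prod>\<eta>\<in>F - {\<chi>}. \<chi> (s (\<eta>, p0 \<eta>))"
    have pB: "(\<chi>, ?p) \<in> B" using p0[OF \<chi>] by (simp add: T_def)
    have Tp: "prime q \<and> q dvd N \<chi>" if "q \<in> T \<chi>" for q
    proof
      have qB: "(\<chi>, q) \<in> B" using that by (simp add: T_def)
      show "prime q" using BX qB by blast
      show "q dvd N \<chi>"
      proof (rule ccontr)
        assume "\<not> q dvd N \<chi>"
        then have "coprime q (N \<chi>)" by (rule prime_imp_coprime[OF \<open>prime q\<close>])
        then show False using complex_eq_1_if_coprime_powers[OF chi_root[OF qB] chi_N[OF s(1)[OF qB]]] s(3)[OF qB] by blast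
      qed
    qed
    let ?D = "\<Prod>q\<in>T \<chi>. q ^ multiplicity q (N \<chi>)"
    have D: "N \<chi> = ?D * (N \<chi> div ?D)" using prod_multiplicity_dvd[OF fT, of \<chi> "N \<chi>"] Tp by simp
    \<comment> \<open>If the prime of \<open>\<eta>\<close> belongs to \<open>T \<chi>\<close>,
      duality makes the value 1. Otherwise the value is a root of unity of exponent a prime outside
      \<open>T \<chi>\<close>, so its order is coprime to \<open>?D\<close> and divides the
      complementary factor of \<open>N \<chi>\<close>.\<close>
    have "\<chi> (s (\<eta>, p0 \<eta>)) ^ (N \<chi> div ?D) = 1" if \<eta>: "\<eta> \<in> F - {\<chi>}" for \<eta>
    proof -
      let ?q = "p0 \<eta>" let ?v = "\<chi> (s (\<eta>, p0 \<eta>))"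
      have qB: "(\<eta>, ?q) \<in> B" using p0[of \<eta>] \<eta> by (simp add: T_def)
      show ?thesis
      proof (cases "?q \<in> T \<chi>")
        case True
        then have "?v = 1" using s_dual[OF qB, of \<chi>] \<eta> by (auto simp: T_def)
        then show ?thesis by simp
      next
        case False
        have "?v ^ (?D * (N \<chi> div ?D)) = 1" using chi_N[OF s(1)[OF qB]] D by metis
        then have 1: "(?v ^ (N \<chi> div ?D)) ^ ?D = 1" by (metis mult.commute power_mult)
        have 2: "(?v ^ (N \<chi> div ?D)) ^ ?q = 1" using chi_root[OF qB] by (metis mult.commute power_mult power_one)
        have "coprime ?D ?q"
        proof (intro prod_coprime_left)
          fix r assume "r \<in> T \<chi>"
          then have "coprime r ?q" using False Tp BX(4)[OF qB] primes_coprime[of r ?q] by auto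
          then show "coprime (r ^ multiplicity r (N \<chi>)) ?q" by simp
        qed
        then show ?thesis using complex_eq_1_if_coprime_powers[OF 1 2] by blast
      qed
    qed
    then have w: "?w ^ (N \<chi> div ?D) = 1" by (simp add: prod_power_distrib)
    have "\<chi> z = ?u * ?w" using z(2)[OF X\<chi>] fF \<chi> by (simp add: prod.remove)
    then have "(\<Sum>q\<in>T \<chi>. real (q ^ multiplicity q (N \<chi>))) \<le> (\<Sum>j\<in>totatives (N \<chi>). 1 - Re (\<chi> z ^ j))"
      using sum_totatives_ge[OF oddN fT Tp p0[OF \<chi>] chi_root[OF pB] s(3)[OF pB] w] by simp
    then have "m \<chi> * (\<Sum>q\<in>T \<chi>. real (q ^ multiplicity q (N \<chi>))) \<le> m \<chi> * (\<Sum>j\<in>totatives (N \<chi>). 1 - Re (\<chi> z ^ j))"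
      using m_nonneg[OF X\<chi>] by (rule mult_left_mono)
    then have "(\<Sum>p\<in>T \<chi>. ?c \<chi> p) \<le> (\<Sum>j\<in>totatives (N \<chi>). m \<chi> * (1 - Re (\<chi> z ^ j)))"
      by (simp add: sum_distrib_left sum_distrib_right mult.commute)
    also have "\<dots> \<le> (\<Sum>\<eta>\<in>galois_class \<chi>. m \<chi> * (1 - Re (\<eta> z)))"
    proof (rule galois_class_sum_ge[OF X\<chi>])
      fix \<eta> assume "\<eta> \<in> X"
      then have "Re (\<eta> z) \<le> 1" using lin_chars_norm[OF Z _ z(1) fin] complex_Re_le_cmod by metis
      then show "0 \<le> m \<chi> * (1 - Re (\<eta> z))" using m_nonneg[OF X\<chi>] by simp
    qed
    also have "\<dots> = (\<Sum>\<eta>\<in>galois_class \<chi>. m \<eta> * (1 - Re (\<eta> z)))"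
      by (intro sum.cong refl) (simp add: galois_mult[OF X\<chi>])
    finally show ?thesis .
  qed
  have fG: "finite (galois_class \<chi>)" if "\<chi> \<in> F" for \<chi>
    using galois_subset[OF FX(1)[OF that]] finite_X by (rule finite_subset)
  have "(\<Sum>b\<in>B. real (card (rcosets (K b)))) \<le> (\<Sum>b\<in>B. ?c (fst b) (snd b))" by (intro sum_mono index)
  also have "\<dots> = (\<Sum>\<chi>\<in>F. \<Sum>p\<in>T \<chi>. ?c \<chi> p)"
    unfolding BT using fF fT by (subst sum.Sigma) (auto simp: case_prod_unfold)
  also have "\<dots> \<le> (\<Sum>\<chi>\<in>F. \<Sum>\<eta>\<in>galois_class \<chi>. m \<eta> * (1 - Re (\<eta> z)))" by (intro sum_mono class_ge)
  \<comment> \<open>Distinct members of \<open>F\<close> represent disjoint Galois classes, so no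
    character of the centre is charged twice.\<close>
  also have "\<dots> = (\<Sum>\<eta>\<in>(\<Union>\<chi>\<in>F. galois_class \<chi>). m \<eta> * (1 - Re (\<eta> z)))"
    using fF fG W0_disjoint FX by (intro sum.UNION_disjoint[symmetric]) auto
  also have "\<dots> \<le> (\<Sum>\<eta>\<in>X. m \<eta> * (1 - Re (\<eta> z)))"
  proof (rule sum_mono2[OF finite_X])
    show "(\<Union>\<chi>\<in>F. galois_class \<chi>) \<subseteq> X" using galois_subset FX by blast
    fix \<eta> assume "\<eta> \<in> X - (\<Union>\<chi>\<in>F. galois_class \<chi>)"
    then have \<eta>: "\<eta> \<in> X" by simp
    then have "Re (\<eta> z) \<le> 1" using lin_chars_norm[OF Z _ z(1) fin] complex_Re_le_cmod by metis
    then show "0 \<le> m \<eta> * (1 - Re (\<eta> z))" using m_nonneg[OF \<eta>] by simp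
  qed
  also have "\<dots> = real n - Re (\<psi> z)"
    unfolding \<psi>_Z[OF z(1)] sum_m[symmetric] by (simp add: right_diff_distrib sum_subtractf)
  \<comment> \<open>The only place where the sign of a trace matters: \<open>\<psi> z\<close> is
    natural, thus at least 0.\<close>
  also have "\<dots> \<le> real n" using \<psi>_nat[OF Zc[OF z(1)]] by (auto elim!: Nats_cases)
  finally have "real (\<Sum>b\<in>B. card (rcosets (K b))) \<le> real n" by simp
  then have total: "(\<Sum>b\<in>B. card (rcosets (K b))) \<le> n" by (simp only: of_nat_le_iff)
  show ?thesis
  proof (rule mon_sym_group_if_subgroup_family[OF is_group fin B(2) K total])
    fix x assume x: "x \<in> carrier G" "x \<noteq> \<one>"
    show "\<exists>b\<in>B. \<exists>g\<in>carrier G. g \<otimes> x \<otimes> inv g \<notin> K b"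
    proof (rule ccontr)
      assume none: "\<not> ?thesis"
      \<comment> \<open>The kernel of the action on all the coset spaces.\<close>
      let ?C = "{y \<in> carrier G. \<forall>b\<in>B. \<forall>g\<in>carrier G. g \<otimes> y \<otimes> inv g \<in> K b}"
      have C: "subgroup ?C G"
      proof (rule finite_subgroupI[OF fin])
        show "\<one> \<in> ?C" using K subgroup.one_closed by auto
        fix u v assume uv: "u \<in> ?C" "v \<in> ?C"
        show "u \<otimes> v \<in> ?C"
        proof (intro CollectI conjI ballI)
          show "u \<otimes> v \<in> carrier G" using uv by simp
          fix b g assume bg: "b \<in> B" "g \<in> carrier G"
          have "g \<otimes> (u \<otimes> v) \<otimes> inv g = (g \<otimes> u \<otimes> inv g) \<otimes> (g \<otimes> v \<otimes> inv g)"
            using uv bg by (simp add: m_assoc cancel_l2)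
          moreover have "g \<otimes> u \<otimes> inv g \<in> K b" "g \<otimes> v \<otimes> inv g \<in> K b" using uv bg by simp_all
          ultimately show "g \<otimes> (u \<otimes> v) \<otimes> inv g \<in> K b" using subgroup.m_closed[OF K[OF bg(1)]] by simp
        qed
      qed auto
      have conj: "h \<otimes> y \<otimes> inv h \<in> ?C" if h: "h \<in> carrier G" and y: "y \<in> ?C" for h y
      proof -
        have "g \<otimes> (h \<otimes> y \<otimes> inv h) \<otimes> inv g = (g \<otimes> h) \<otimes> y \<otimes> inv (g \<otimes> h)" if "g \<in> carrier G" for g
          using h y that by (simp add: m_assoc inv_mult_group)
        then show ?thesis using h y by simp
      qed
      have "x \<in> ?C" using x none by blast
      then obtain p :: nat and t where t: "prime p" "t \<in> ?C" "t \<in> Z" "t [^] p = \<one>" "t \<noteq> \<one>"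
        using exists_prime_order_central[OF C conj _ x(2)] by blast
      then obtain \<chi> where \<chi>: "(\<chi>, p) \<in> B" "\<chi> t \<noteq> 1" using B(3) unfolding separating_def by blast
      have "\<one> \<otimes> t \<otimes> inv \<one> \<in> K (\<chi>, p)" using t(2) \<chi>(1) by blast
      then have "t \<in> K (\<chi>, p)" using Zc[OF t(3)] by simp
      then show False using bspec[OF K0 \<chi>(1)] \<chi>(2) t(3,4) by simp
    qed
  qed
qed

end

section \<open>Comparison of the three degrees\<close>

theorem mon_sym_group_if_quasi_perm_rep:
  fixes G :: "('a, 'b) monoid_scheme" and \<rho> :: "'a \<Rightarrow> complex mat"
  assumes VZ: "VZ_group G" and fin: "finite (carrier G)" and odd: "odd (Coset.order G)"
    and \<rho>: "faithful_quasi_perm_rep G n \<rho>"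
  shows "mon G (sym_group n) \<noteq> {}"
proof -
  interpret group G using VZ by (simp add: VZ_group_def)
  have rep: "matrix_rep G n \<rho>" and inj: "inj_on \<rho> (carrier G)"
    and q: "\<And>g. g \<in> carrier G \<Longrightarrow> rep_character \<rho> g \<in> \<nat>"
    using \<rho> by (auto simp: faithful_quasi_perm_rep_def faithful_rep_def quasi_permutation_mat_def rep_character_def)
  interpret complex_rep G n \<rho> by (intro complex_rep.intro complex_rep_axioms.intro is_group fin rep)
  have comm: "commut G x y \<in> group_center G" if "x \<in> carrier G" "y \<in> carrier G" for x y
    by (rule VZ_group_commut_central[OF VZ fin that])
  interpret faithful_nat_character G "rep_character \<rho>" "group_center G" n
  proof (intro faithful_nat_character.intro nat_character.intro class2_group.intro class2_group_axioms.intro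
      nat_character_axioms.intro faithful_nat_character_axioms.intro is_group fin odd comm q group_center_subgroup
      group_center_commute rep_character_conj char_mult_nat rep_character_one)
    fix H assume H: "subgroup H G" and n: "\<And>h. h \<in> H \<Longrightarrow> rep_character \<rho> h = of_nat n"
    have "h = \<one>\<^bsub>G\<^esub>" if h: "h \<in> H" for h
    proof (rule inj_onD[OF inj])
      show "\<rho> h = \<rho> \<one>\<^bsub>G\<^esub>" using kernel_rep_character[OF H n h] rep_one by simp
    qed (use subgroup.mem_carrier[OF H h] in auto)
    then show "H = {\<one>\<^bsub>G\<^esub>}" using subgroup.one_closed[OF H] by blast
  next
    fix x assume "x \<in> carrier G" "\<And>g. g \<in> carrier G \<Longrightarrow> x \<otimes>\<^bsub>G\<^esub> g = g \<otimes>\<^bsub>G\<^esub> x"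
    then show "x \<in> group_center G" by (simp add: group_center_def)
  qed
  show ?thesis by (rule exists_mon_sym_group)
qed

theorem corollary5:
  fixes G :: "('a, 'b) monoid_scheme"
  assumes "VZ_group G" and "finite (carrier G)" and "odd (Coset.order G)"
  shows "c_degree G = mu_degree G \<and> mu_degree G = q_degree G"
proof -
  have G: "group G" using assms(1) by (simp add: VZ_group_def)
  \<comment> \<open>The three sets of degrees coincide, not only their least elements: a complex
    representation of degree \<open>n\<close> yields an embedding, this yields permutation matrices
    over the rationals, and those are complex matrices again.\<close>
  have c: "(\<exists>\<rho> :: 'a \<Rightarrow> complex mat. faithful_quasi_perm_rep G n \<rho>) \<longleftrightarrow> n > 0 \<and> mon G (sym_group n) \<noteq> {}" for n
  proof
    assume "\<exists>\<rho> :: 'a \<Rightarrow> complex mat. faithful_quasi_perm_rep G n \<rho>"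
    then show "n > 0 \<and> mon G (sym_group n) \<noteq> {}"
      using mon_sym_group_if_quasi_perm_rep[OF assms]
      by (auto simp: faithful_quasi_perm_rep_def faithful_rep_def matrix_rep_def)
  qed (use rational_rep_if_mon_sym_group[OF G] complex_rep_if_rational_rep[OF G] in blast)
  have q: "(\<exists>\<rho> :: 'a \<Rightarrow> rat mat. faithful_quasi_perm_rep G n \<rho>) \<longleftrightarrow> n > 0 \<and> mon G (sym_group n) \<noteq> {}" for n
    using rational_rep_if_mon_sym_group[OF G] complex_rep_if_rational_rep[OF G] c by blast
  show ?thesis unfolding c_degree_def q_degree_def mu_degree_def c q by simp
qed

end
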